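(* Let $G$ be a countable infinite group and let $\mathbf{K}^*$ be the non-compact locally compact Cantor set. (1) $G$ admits a free minimal action on $\mathbf{K}^*$. If $G$ is exact, then the action can, moreover, be taken to be amenable. (2) For each $A\subseteq G$ of minimal type such that $[A]\ne[G]$ and $[A]\ne[\{e\}]$, there are a free minimal action of $G$ on $\mathbf{K}^*$ and a point $x_0\in\mathbf{K}^*$ such that $\mathrm{T}(G,\mathbf{K}^*,x_0)=[A]$. Again, if $G$ is exact, then the action can be taken to be amenable.
   Context: $\mathbf{K}^*$ denotes the unique (up to homeomorphism) non-empty locally compact, non-compact Hausdorff space which is second countable, totally disconnected and without isolated points (e.g. the Cantor set minus a point). Groups are discrete, with neutral element $e$, and act by homeomorphisms. An action is free if $g.x=x$ for some $x$ implies $g=e$; minimal if the space is non-empty and every orbit is dense. Amenability of an action means topological amenability in the usual (Anantharaman-Delaroche) sense; exactness of a discrete group is in the usual sense. A locally compact $G$-space is a locally compact Hausdorff space with an action of $G$; it is co-compact if there is a compact $K\subseteq X$ with $\bigcup_{g\in G}g.K=X$ (minimal ones are co-compact). A pointed locally compact $G$-space is a pair $(X,x_0)$ with $x_0\in X$ such that $G.x_0$ is dense in $X$. For non-empty $A,B\subseteq G$ write $A\propto B$ if $A\subseteq FB=\bigcup_{g\in F}gB$ for some finite $F\subseteq G$, and $A\approx B$ if $A\propto B$ and $B\propto A$; $[A]$ is the $\approx$-class of $A$. Type: for a pointed locally compact $G$-space $(X,x_0)$ put $\mathcal M(G,X,x_0)=\{B\subseteq G:\overline{B.x_0}\text{ is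 compact}\}$, and $\mathcal M_A=\{B\subseteq G: B\subseteq FA\text{ for some finite }F\subseteq G\}$. If $X$ is co-compact, there is a non-empty $A\subseteq G$, unique up to $\approx$, with $\mathcal M(G,X,x_0)=\mathcal M_A$, and $\mathrm{T}(G,X,x_0)=[A]$. A non-empty $A\subseteq G$ is of minimal type if $\mathrm{T}(G,X,x_0)=[A]$ for some pointed minimal locally compact $G$-space $(X,x_0)$. *)

theory Defs
  imports "HOL-Analysis.Analysis" "HOL-Algebra.Group_Action"
begin

section \<open>Locally compact $G$-spaces\<close>

definition noncompact_cantor_space :: "'x topology \<Rightarrow> bool" where
  "noncompact_cantor_space X \<longleftrightarrow>
     topspace X \<noteq> {} \<and> locally_compact_space X \<and> \<not> compact_space X \<and> Hausdorff_space X \<and>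
     second_countable X \<and>
     \<comment> \<open>totally disconnected\<close>
     (\<forall>S. connectedin X S \<longrightarrow> (\<exists>a. S \<subseteq> {a})) \<and>
     \<comment> \<open>no isolated points\<close>
     (\<forall>x \<in> topspace X. \<not> openin X {x})"

text \<open>The maps of a \<^const>\<open>group_action\<close> are bijections of the space that take the value
  \<^const>\<open>undefined\<close> off the space, so the extra requirement is only that they are homeomorphisms.\<close>

definition lc_G_space :: "('g, 'm) monoid_scheme \<Rightarrow> 'x topology \<Rightarrow> ('g \<Rightarrow> 'x \<Rightarrow> 'x) \<Rightarrow> bool" where
  "lc_G_space G X \<alpha> \<longleftrightarrow>
     locally_compact_space X \<and> Hausdorff_space X \<and>
     group_action G (topspace X) \<alpha> \<and> (\<forall>g \<in> carrier G. homeomorphic_map X X (\<alpha> g))"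

definition free_action :: "('g, 'm) monoid_scheme \<Rightarrow> 'x topology \<Rightarrow> ('g \<Rightarrow> 'x \<Rightarrow> 'x) \<Rightarrow> bool" where
  "free_action G X \<alpha> \<longleftrightarrow>
     (\<forall>g \<in> carrier G. (\<exists>x \<in> topspace X. \<alpha> g x = x) \<longrightarrow> g = \<one>\<^bsub>G\<^esub>)"

definition minimal_action :: "('g, 'm) monoid_scheme \<Rightarrow> 'x topology \<Rightarrow> ('g \<Rightarrow> 'x \<Rightarrow> 'x) \<Rightarrow> bool" where
  "minimal_action G X \<alpha> \<longleftrightarrow>
     topspace X \<noteq> {} \<and> (\<forall>x \<in> topspace X. X closure_of (orbit G \<alpha> x) = topspace X)"

definition pointed_lc_G_space ::
  "('g, 'm) monoid_scheme \<Rightarrow> 'x topology \<Rightarrow> ('g \<Rightarrow> 'x \<Rightarrow> 'x) \<Rightarrow> 'x \<Rightarrow> bool" where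
  "pointed_lc_G_space G X \<alpha> x\<^sub>0 \<longleftrightarrow>
     lc_G_space G X \<alpha> \<and> x\<^sub>0 \<in> topspace X \<and> X closure_of (orbit G \<alpha> x\<^sub>0) = topspace X"

text \<open>Topological amenability: there is a net of continuous maps $x \mapsto m^x$ from $X$ to the
  probability measures on $G$ with $\|g.m^x - m^{g.x}\|_1 \to 0$ uniformly on compact subsets of
  $X \times G$.  A compact subset of $X \times G$ lies in some $K \times F$ with $K$ compact and $F$
  finite; the existence of a net is written out with the triples $(K, F, \varepsilon)$ as indices.
  The probability measures carry the weak-* topology as a subset of the dual of $c_0(G)$; on this
  bounded set it is the topology of pointwise convergence.\<close>

definition amenable_action :: "('g, 'm) monoid_scheme \<Rightarrow> 'x topology \<Rightarrow> ('g \<Rightarrow> 'x \<Rightarrow> 'x) \<Rightarrow> bool" where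
  "amenable_action G X \<alpha> \<longleftrightarrow>
     (\<forall>K F. \<forall>\<epsilon>::real. compactin X K \<and> finite F \<and> F \<subseteq> carrier G \<and> \<epsilon> > 0 \<longrightarrow>
        (\<exists>m :: 'x \<Rightarrow> 'g \<Rightarrow> real.
           (\<forall>x \<in> topspace X. (\<forall>h \<in> carrier G. m x h \<ge> 0) \<and> (m x has_sum 1) (carrier G)) \<and>
           (\<forall>h \<in> carrier G. continuous_map X euclideanreal (\<lambda>x. m x h)) \<and>
           (\<forall>x \<in> K. \<forall>g \<in> F.
              (\<Sum>\<^sub>\<infinity>h \<in> carrier G. \<bar>m x (inv\<^bsub>G\<^esub> g \<otimes>\<^bsub>G\<^esub> h) - m (\<alpha> g x) h\<bar>) < \<epsilon>)))"


section \<open>Types\<close>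

definition propto :: "('g, 'm) monoid_scheme \<Rightarrow> 'g set \<Rightarrow> 'g set \<Rightarrow> bool" where
  "propto G A B \<longleftrightarrow> (\<exists>F. finite F \<and> F \<subseteq> carrier G \<and> A \<subseteq> F <#>\<^bsub>G\<^esub> B)"

definition approx :: "('g, 'm) monoid_scheme \<Rightarrow> 'g set \<Rightarrow> 'g set \<Rightarrow> bool" where
  "approx G A B \<longleftrightarrow> propto G A B \<and> propto G B A"

definition approx_class :: "('g, 'm) monoid_scheme \<Rightarrow> 'g set \<Rightarrow> 'g set set" where
  "approx_class G A = {B. B \<subseteq> carrier G \<and> B \<noteq> {} \<and> approx G A B}"

definition rel_compact_sets ::
  "('g, 'm) monoid_scheme \<Rightarrow> 'x topology \<Rightarrow> ('g \<Rightarrow> 'x \<Rightarrow> 'x) \<Rightarrow> 'x \<Rightarrow> 'g set set" where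
  "rel_compact_sets G X \<alpha> x\<^sub>0 =
     {B. B \<subseteq> carrier G \<and> compactin X (X closure_of ((\<lambda>g. \<alpha> g x\<^sub>0) ` B))}"

definition sets_below :: "('g, 'm) monoid_scheme \<Rightarrow> 'g set \<Rightarrow> 'g set set" where
  "sets_below G A = {B. B \<subseteq> carrier G \<and> propto G B A}"

text \<open>The type $\mathrm T(G,X,x_0)$ as the set of all its representatives; by the lemma
  \<open>G_type_eq_approx_class\<close> below it is the class $[A]$ for every admissible $A$ (and it is empty,
  hence no class at all, if there is no admissible $A$).\<close>

definition G_type ::
  "('g, 'm) monoid_scheme \<Rightarrow> 'x topology \<Rightarrow> ('g \<Rightarrow> 'x \<Rightarrow> 'x) \<Rightarrow> 'x \<Rightarrow> 'g set set" where
  "G_type G X \<alpha> x\<^sub>0 =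
     {A. A \<subseteq> carrier G \<and> A \<noteq> {} \<and> rel_compact_sets G X \<alpha> x\<^sub>0 = sets_below G A}"

lemma propto_refl:
  assumes "group G" "A \<subseteq> carrier G"
  shows "propto G A A"
proof -
  interpret group G by fact
  have "A \<subseteq> {\<one>\<^bsub>G\<^esub>} <#>\<^bsub>G\<^esub> A"
    using assms(2) by (force simp: set_mult_def)
  then show ?thesis
    unfolding propto_def by (intro exI[of _ "{\<one>\<^bsub>G\<^esub>}"]) auto
qed

lemma propto_trans:
  assumes "group G" "C \<subseteq> carrier G" "propto G A B" "propto G B C"
  shows "propto G A C"
proof -
  interpret group G by fact
  obtain E F where E: "finite E" "E \<subseteq> carrier G" "A \<subseteq> E <#>\<^bsub>G\<^esub> B"
    and F: "finite F" "F \<subseteq> carrier G" "B \<subseteq> F <#>\<^bsub>G\<^esub> C"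
    using assms(3,4) unfolding propto_def by blast
  have "A \<subseteq> E <#>\<^bsub>G\<^esub> (F <#>\<^bsub>G\<^esub> C)"
    using E(3) F(3) mono_set_mult[of E E B "F <#>\<^bsub>G\<^esub> C" G] by blast
  also have "\<dots> = (E <#>\<^bsub>G\<^esub> F) <#>\<^bsub>G\<^esub> C"
    using set_mult_assoc[OF E(2) F(2) assms(2)] by simp
  finally have "A \<subseteq> (E <#>\<^bsub>G\<^esub> F) <#>\<^bsub>G\<^esub> C" .
  moreover have "finite (E <#>\<^bsub>G\<^esub> F)"
    using E(1) F(1) by (simp add: set_mult_def)
  moreover have "E <#>\<^bsub>G\<^esub> F \<subseteq> carrier G"
    using E(2) F(2) by (rule set_mult_closed)
  ultimately show ?thesis
    unfolding propto_def by blast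
qed

lemma sets_below_eq_iff:
  assumes "group G" "A \<subseteq> carrier G" "B \<subseteq> carrier G"
  shows "sets_below G A = sets_below G B \<longleftrightarrow> approx G A B"
proof
  assume "sets_below G A = sets_below G B"
  then show "approx G A B"
    using propto_refl[OF assms(1)] assms(2,3) unfolding sets_below_def approx_def by blast
next
  assume "approx G A B"
  then show "sets_below G A = sets_below G B"
    using propto_trans[OF assms(1)] assms(2,3) unfolding sets_below_def approx_def by blast
qed

lemma G_type_eq_approx_class:
  assumes "group G" "A \<subseteq> carrier G" "rel_compact_sets G X \<alpha> x\<^sub>0 = sets_below G A"
  shows "G_type G X \<alpha> x\<^sub>0 = approx_class G A"
  using sets_below_eq_iff[OF assms(1,2)] assms(3)
  unfolding G_type_def approx_class_def by blast

text \<open>The spaces $X$ range over the topological spaces with points in a type \<open>'x\<close>.  In a hypothesis of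
  a theorem that leaves \<open>'x\<close> free, this amounts to no restriction on $X$.\<close>

definition minimal_type :: "'x itself \<Rightarrow> ('g, 'm) monoid_scheme \<Rightarrow> 'g set \<Rightarrow> bool" where
  "minimal_type _ G A \<longleftrightarrow>
     A \<subseteq> carrier G \<and> A \<noteq> {} \<and>
     (\<exists>(X :: 'x topology) \<alpha> x\<^sub>0.
        pointed_lc_G_space G X \<alpha> x\<^sub>0 \<and> minimal_action G X \<alpha> \<and>
        G_type G X \<alpha> x\<^sub>0 = approx_class G A)"


section \<open>Exact groups\<close>

text \<open>A discrete group is exact if its reduced C*-algebra is.  A C*-algebra $A$ is exact if it has a
  nuclear faithful representation on a Hilbert space; this does not depend on the faithful
  representation, and for $C^*_r(G)$ we use the defining one on $\ell^2(G)$.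

  Vectors of $\ell^2(I)$ are functions that vanish off \<open>I\<close>, and an operator on $\ell^2(I)$ is a
  function that vanishes off $\ell^2(I)$, so that equality of operators is equality of functions.
  The matrix algebra $M_n$ is the algebra of bounded operators on $\ell^2(\{0,\dots,n-1\})$.\<close>

type_synonym 'i oper = "('i \<Rightarrow> complex) \<Rightarrow> ('i \<Rightarrow> complex)"

definition l2 :: "'i set \<Rightarrow> ('i \<Rightarrow> complex) set" where
  "l2 I = {\<xi>. (\<forall>i. i \<notin> I \<longrightarrow> \<xi> i = 0) \<and> (\<lambda>i. (norm (\<xi> i))\<^sup>2) summable_on I}"

definition l2_inner :: "'i set \<Rightarrow> ('i \<Rightarrow> complex) \<Rightarrow> ('i \<Rightarrow> complex) \<Rightarrow> complex" where
  "l2_inner I \<xi> \<eta> = (\<Sum>\<^sub>\<infinity>i \<in> I. \<xi> i * cnj (\<eta> i))"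

definition l2_norm :: "'i set \<Rightarrow> ('i \<Rightarrow> complex) \<Rightarrow> real" where
  "l2_norm I \<xi> = sqrt (\<Sum>\<^sub>\<infinity>i \<in> I. (norm (\<xi> i))\<^sup>2)"

definition bounded_ops :: "'i set \<Rightarrow> 'i oper set" where
  "bounded_ops I =
     {T. (\<forall>\<xi> \<in> l2 I. T \<xi> \<in> l2 I) \<and> (\<forall>\<xi>. \<xi> \<notin> l2 I \<longrightarrow> T \<xi> = (\<lambda>_. 0)) \<and>
         (\<forall>\<xi> \<in> l2 I. \<forall>\<eta> \<in> l2 I. \<forall>c. T (\<lambda>i. c * \<xi> i + \<eta> i) = (\<lambda>i. c * T \<xi> i + T \<eta> i)) \<and>
         (\<exists>C. \<forall>\<xi> \<in> l2 I. l2_norm I (T \<xi>) \<le> C * l2_norm I \<xi>)}"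

definition op_norm :: "'i set \<Rightarrow> 'i oper \<Rightarrow> real" where
  "op_norm I T = (SUP \<xi> \<in> {\<xi> \<in> l2 I. l2_norm I \<xi> \<le> 1}. l2_norm I (T \<xi>))"

definition op_add :: "'i oper \<Rightarrow> 'i oper \<Rightarrow> 'i oper" where
  "op_add S T = (\<lambda>\<xi> i. S \<xi> i + T \<xi> i)"

definition op_diff :: "'i oper \<Rightarrow> 'i oper \<Rightarrow> 'i oper" where
  "op_diff S T = (\<lambda>\<xi> i. S \<xi> i - T \<xi> i)"

definition op_scale :: "complex \<Rightarrow> 'i oper \<Rightarrow> 'i oper" where
  "op_scale c T = (\<lambda>\<xi> i. c * T \<xi> i)"

definition left_regular :: "('g, 'm) monoid_scheme \<Rightarrow> 'g \<Rightarrow> 'g oper" where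
  "left_regular G g = (\<lambda>\<xi> h.
     if \<xi> \<in> l2 (carrier G) \<and> h \<in> carrier G then \<xi> (inv\<^bsub>G\<^esub> g \<otimes>\<^bsub>G\<^esub> h) else 0)"

text \<open>The norm closure of the linear span of the left regular representation.\<close>

definition reduced_group_cstar :: "('g, 'm) monoid_scheme \<Rightarrow> 'g oper set" where
  "reduced_group_cstar G =
     {T \<in> bounded_ops (carrier G).
        \<forall>\<epsilon>>0. \<exists>F c. finite F \<and> F \<subseteq> carrier G \<and>
          op_norm (carrier G) (op_diff T (\<lambda>\<xi> h. \<Sum>g\<in>F. c g * left_regular G g \<xi> h)) < \<epsilon>}"

text \<open>Positivity of an $m \times m$ matrix of operators on $\ell^2(I)$, regarded as an operator on the
  direct sum of $m$ copies of $\ell^2(I)$.\<close>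

definition positive_op_matrix :: "'i set \<Rightarrow> nat \<Rightarrow> (nat \<Rightarrow> nat \<Rightarrow> 'i oper) \<Rightarrow> bool" where
  "positive_op_matrix I m a \<longleftrightarrow>
     (\<forall>\<xi>. (\<forall>i<m. \<xi> i \<in> l2 I) \<longrightarrow>
        (\<Sum>i<m. \<Sum>j<m. l2_inner I (a i j (\<xi> j)) (\<xi> i)) \<in> \<real>\<^sub>\<ge>\<^sub>0)"

text \<open>Contractive completely positive maps between linear spaces of operators
  \<open>A \<subseteq> bounded_ops I\<close> and \<open>B \<subseteq> bounded_ops J\<close>.\<close>

definition ccp_map ::
  "'i set \<Rightarrow> 'i oper set \<Rightarrow> 'j set \<Rightarrow> 'j oper set \<Rightarrow> ('i oper \<Rightarrow> 'j oper) \<Rightarrow> bool" where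
  "ccp_map I A J B \<phi> \<longleftrightarrow>
     (\<forall>a \<in> A. \<phi> a \<in> B) \<and>
     (\<forall>a \<in> A. \<forall>b \<in> A. \<forall>c. \<phi> (op_add (op_scale c a) b) = op_add (op_scale c (\<phi> a)) (\<phi> b)) \<and>
     (\<forall>m a. (\<forall>i<m. \<forall>j<m. a i j \<in> A) \<and> positive_op_matrix I m a \<longrightarrow>
        positive_op_matrix J m (\<lambda>i j. \<phi> (a i j))) \<and>
     (\<forall>a \<in> A. op_norm J (\<phi> a) \<le> op_norm I a)"

text \<open>Nuclearity of the inclusion of \<open>A\<close> into the bounded operators on $\ell^2(I)$: it is a limit, in
  the point-norm topology, of contractive completely positive maps that factor through matrix
  algebras.\<close>

definition nuclear_inclusion :: "'i set \<Rightarrow> 'i oper set \<Rightarrow> bool" where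
  "nuclear_inclusion I A \<longleftrightarrow>
     (\<forall>F. \<forall>\<epsilon>::real. finite F \<and> F \<subseteq> A \<and> \<epsilon> > 0 \<longrightarrow>
        (\<exists>(n::nat) \<phi> \<psi>.
           ccp_map I A {..<n} (bounded_ops {..<n}) \<phi> \<and>
           ccp_map {..<n} (bounded_ops {..<n}) I (bounded_ops I) \<psi> \<and>
           (\<forall>a \<in> F. op_norm I (op_diff (\<psi> (\<phi> a)) a) < \<epsilon>)))"

definition exact_group :: "('g, 'm) monoid_scheme \<Rightarrow> bool" where
  "exact_group G \<longleftrightarrow> nuclear_inclusion (carrier G) (reduced_group_cstar G)"

end

theory Submission
  imports Defs
begin

text \<open>
  The actions are realised as symbolic systems.  Let \<open>\<D>\<close> be a countable family of subsets of \<open>G\<close> that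
  is invariant under left translation.  A group element is read as the point of the cube of bits
  indexed by \<open>\<D>\<close> that records which members of \<open>\<D>\<close> contain it, and \<open>G\<close> acts by shifting the index.  On
  finitely many coordinates a limit of such points cannot be told from a group element.  Finite
  combinatorial facts about \<open>G\<close> therefore become dynamical facts about every invariant set \<open>W\<close> of
  limits: a finite cover of \<open>G\<close> by sets that \<open>g\<close> moves off themselves excludes fixed points of \<open>g\<close> in \<open>W\<close>
  (\<open>displaced_cover\<close>, \<open>free_act\<close>), and an almost equivariant map from \<open>G\<close> to the probability measures on
  a finite subset of \<open>G\<close>, if it has finitely many values and its level sets belong to \<open>\<D>\<close>, extends to a
  continuous map on \<open>W\<close> (\<open>amenable_act\<close>).  The passage to limits of this kind takes the place of the
  Stone-Cech compactification of \<open>G\<close>.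

  For an action of a given type, start with any minimal \<open>(X, x\<^sub>0)\<close> of this type and admit to \<open>\<D>\<close> the set \<open>S\<close>
  of all \<open>g\<close> with \<open>g.x\<^sub>0\<close> in a compact neighbourhood of \<open>x\<^sub>0\<close>.  In the closure of the points
  \<open>(g.x\<^sub>0, mark g)\<close> of the product of \<open>X\<close> and the cube there is a minimal closed invariant set.  It projects
  onto \<open>X\<close>, by minimality of \<open>X\<close>, and its projection \<open>W\<close> to the cube is minimal.  The coordinate \<open>S\<close> of
  a point of \<open>W\<close> decides whether the companion in \<open>X\<close> is close to \<open>x\<^sub>0\<close>; hence \<open>W\<close> is locally compact and has
  the same type (\<open>minimal_extension\<close>, \<open>rel_compact_sets_Y\<close>).  It is not compact if the type is not
  \<open>[G]\<close>, and by freeness it has no isolated point if the type is not \<open>[{e}]\<close>.  So \<open>W\<close> is homeomorphic to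
  \<open>K\<close> (\<open>noncompact_cantor_spaces_homeomorphic\<close>), and the action is transported.

  The first part needs one minimal type other than \<open>[G]\<close> and \<open>[{e}]\<close>.  It is the type of a set
  \<open>A = \<Union>n. A n\<close>, where \<open>A (n + 1) = A n \<union> A n g n\<close> and \<open>g n\<close> is very far away (\<open>sparse_recurrent_set\<close>,
  \<open>sparse_minimal_type\<close>): seen from any of its points, \<open>A\<close> contains a near and isolated copy of each
  \<open>A n\<close>, which makes its non-trivial limits recur to \<open>A\<close>, while the gaps keep the system
  from being compact.

  Exactness enters through a factorisation of the inclusion of the reduced C*-algebra into the
  bounded operators, up to a small error, into completely positive maps to and from a matrix algebra.
  On finitely many group elements the coefficients of the first map are approximated by those of
  finitely supported vectors (\<open>ccp_coefficients_approximable\<close>), because a functional that separates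
  them would be a positive operator matrix with negative image.  The second map amounts to a positive
  kernel on \<open>G\<close> with matrix values.  Contracting the vectors at a point \<open>q\<close> with the kernel at \<open>(t, t)\<close>
  gives weights \<open>f t q\<close>, supported in a fixed finite set; positivity of the kernel on the pairs
  \<open>(g t, t)\<close> and the fact that the composition nearly fixes the translation by \<open>g\<close> make \<open>f (g t)\<close>
  close to the translate of \<open>f t\<close> in the sum norm.  Rounding leaves finitely many functions
  (\<open>exact_group_finite_valued_weights\<close>).
\<close>

section \<open>Cubes of bits\<close>

text \<open>The index ranges over a set and not over a type: the families of subsets of \<open>G\<close> that serve as index are
  countable, their type is not.\<close>
definition bit_cube :: "'i set \<Rightarrow> ('i \<Rightarrow> bool) topology" where
  "bit_cube I = product_topology (\<lambda>_. discrete_topology UNIV) I"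

lemma topspace_bit_cube: "topspace (bit_cube I) = extensional I"
  unfolding bit_cube_def by (simp add: PiE_UNIV_domain PiE_def)

lemma openin_bit_cube:
  "openin (bit_cube I) U \<longleftrightarrow> U \<subseteq> extensional I \<and>
     (\<forall>w\<in>U. \<exists>E. finite E \<and> E \<subseteq> I \<and> (\<forall>w'\<in>extensional I. (\<forall>i\<in>E. w' i = w i) \<longrightarrow> w' \<in> U))"
  (is "_ \<longleftrightarrow> ?R")
proof
  assume U: "openin (bit_cube I) U"
  show ?R
  proof (intro conjI ballI)
    show "U \<subseteq> extensional I" using openin_subset[OF U] unfolding topspace_bit_cube .
    fix w assume "w \<in> U"
    then obtain V where V: "finite {i \<in> I. V i \<noteq> (UNIV::bool set)}" "w \<in> Pi\<^sub>E I V" "Pi\<^sub>E I V \<subseteq> U"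
      using U unfolding bit_cube_def openin_product_topology_alt by auto
    show "\<exists>E. finite E \<and> E \<subseteq> I \<and> (\<forall>w'\<in>extensional I. (\<forall>i\<in>E. w' i = w i) \<longrightarrow> w' \<in> U)"
    proof (intro exI conjI ballI impI)
      show "finite {i \<in> I. V i \<noteq> UNIV}" by (rule V(1))
      fix w' assume w': "w' \<in> extensional I" "\<forall>i\<in>{i \<in> I. V i \<noteq> UNIV}. w' i = w i"
      have "w' i \<in> V i" if "i \<in> I" for i
        using w'(2) V(2) that by (cases "V i = UNIV") (auto simp: PiE_iff)
      then have "w' \<in> Pi\<^sub>E I V" using w'(1) by (simp add: PiE_def)
      then show "w' \<in> U" using V(3) by blast
    qed auto
  qed
next
  assume R: ?R
  show "openin (bit_cube I) U"
    unfolding bit_cube_def openin_product_topology_alt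
  proof
    fix w assume w: "w \<in> U"
    then obtain E where E: "finite E" "E \<subseteq> I" "\<And>w'. w' \<in> extensional I \<Longrightarrow> \<forall>i\<in>E. w' i = w i \<Longrightarrow> w' \<in> U"
      using bspec[OF conjunct2[OF R] w] by auto
    show "\<exists>V. finite {i \<in> I. V i \<noteq> topspace (discrete_topology (UNIV::bool set))} \<and>
        (\<forall>i\<in>I. openin (discrete_topology UNIV) (V i)) \<and> w \<in> Pi\<^sub>E I V \<and> Pi\<^sub>E I V \<subseteq> U"
    proof (intro exI[of _ "\<lambda>i. if i \<in> E then {w i} else UNIV"] conjI)
      show "finite {i \<in> I. (if i \<in> E then {w i} else UNIV) \<noteq> topspace (discrete_topology (UNIV::bool set))}"
        by (rule finite_subset[OF _ E(1)]) auto
      show "w \<in> (\<Pi>\<^sub>E i\<in>I. if i \<in> E then {w i} else UNIV)"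
        using w R by (auto simp: PiE_iff)
      show "(\<Pi>\<^sub>E i\<in>I. if i \<in> E then {w i} else UNIV) \<subseteq> U"
      proof
        fix w' assume w': "w' \<in> (\<Pi>\<^sub>E i\<in>I. if i \<in> E then {w i} else UNIV)"
        then have "w' i = w i" if "i \<in> E" for i using that E(2) by (force simp: PiE_iff)
        then show "w' \<in> U" using E(3) w' by (simp add: PiE_iff)
      qed
    qed simp
  qed
qed

section \<open>Uniqueness of the non-compact locally compact Cantor set\<close>

text \<open>The component of a point is the point itself, hence compact; and in a locally compact Hausdorff
  space a compact component has arbitrarily small neighbourhoods that are open and closed.\<close>
lemma compact_open_neighbourhood:
  assumes X: "noncompact_cantor_space X" and U: "openin X U" "x \<in> U"
  shows "\<exists>C. openin X C \<and> compactin X C \<and> x \<in> C \<and> C \<subseteq> U"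
proof -
  have lc: "locally_compact_space X" and hd: "Hausdorff_space X"
    and td: "\<And>S. connectedin X S \<Longrightarrow> \<exists>a. S \<subseteq> {a}"
    using X unfolding noncompact_cantor_space_def by auto
  have xX: "x \<in> topspace X" using U openin_subset by blast
  obtain V K where V: "openin X V" "compactin X K" "x \<in> V" "V \<subseteq> K"
    using lc xX unfolding locally_compact_space_def by blast
  let ?C = "connected_component_of_set X x"
  have "x \<in> ?C" using xX by (simp add: connected_component_of_refl)
  moreover obtain a where "?C \<subseteq> {a}" using td[OF connectedin_connected_component_of] by blast
  ultimately have C: "?C = {x}" by blast
  have "{x} \<in> connected_components_of X"
    using connected_component_in_connected_components_of[of X x] xX C by simp
  moreover have "compactin X {x}" using xX by simp
  moreover have "openin X (U \<inter> V)" using U V by blast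
  ultimately obtain A B where AB: "openin X A" "openin X B" "disjnt A B" "A \<union> B = topspace X" "{x} \<subseteq> A" "A \<subseteq> U \<inter> V"
    using wilder_locally_compact_component_thm[OF lc hd, of "{x}" "U \<inter> V"] U V by blast
  have "closedin X A"
  proof -
    have "A = topspace X - B" using AB by (auto simp: disjnt_iff)
    then show ?thesis using AB by (simp add: closedin_diff)
  qed
  then have "compactin X A" using closed_compactin[OF V(2)] AB(6) V(4) by blast
  then show ?thesis using AB by blast
qed

text \<open>A compact open set is the union of finitely many members of a base.\<close>
lemma countable_compact_open_sets:
  assumes "second_countable X"
  shows "countable {C. openin X C \<and> compactin X C}"
proof -
  obtain \<B> where B: "countable \<B>" "\<And>V. V \<in> \<B> \<Longrightarrow> openin X V"
    "\<And>U x. openin X U \<Longrightarrow> x \<in> U \<Longrightarrow> \<exists>V\<in>\<B>. x \<in> V \<and> V \<subseteq> U"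
    using assms by (auto simp: second_countable_def)
  have "{C. openin X C \<and> compactin X C} \<subseteq> Union ` {\<F>. finite \<F> \<and> \<F> \<subseteq> \<B>}"
  proof
    fix C assume "C \<in> {C. openin X C \<and> compactin X C}"
    then have C: "openin X C" "compactin X C" by auto
    have "\<And>V. V \<in> {V\<in>\<B>. V \<subseteq> C} \<Longrightarrow> openin X V" "C \<subseteq> \<Union>{V\<in>\<B>. V \<subseteq> C}" using B C by blast+
    from compactinD[OF C(2) this] obtain \<F> where F: "finite \<F>" "\<F> \<subseteq> {V\<in>\<B>. V \<subseteq> C}" "C \<subseteq> \<Union>\<F>" by blast
    then have "C = \<Union>\<F>" by blast
    then show "C \<in> Union ` {\<F>. finite \<F> \<and> \<F> \<subseteq> \<B>}" using F by blast
  qed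
  then show ?thesis
    by (rule countable_subset[OF _ countable_image[OF countable_Collect_finite_subset[OF B(1)]]])
qed

definition splits :: "'x set \<Rightarrow> 'x set \<Rightarrow> bool" where
  "splits C S \<longleftrightarrow> S \<inter> C \<noteq> {} \<and> S - C \<noteq> {}"

locale enumerated_cantor_space =
  fixes X :: "'x topology" and B :: "nat \<Rightarrow> 'x set"
  assumes X: "noncompact_cantor_space X"
    and B: "range B = {C. openin X C \<and> compactin X C}"
begin

text \<open>Each cell is to be divided by the first set of the enumeration that divides it at all.\<close>
definition splitter :: "'x set \<Rightarrow> nat" where
  "splitter S = (LEAST n. splits (B n) S)"

text \<open>A binary tree of sets that are open and closed.  The compact set that divides a cell is put on the
  side of \<open>True\<close>; so a cell is compact once its branch has contained a \<open>True\<close>, and the cells of the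
  branch that is constantly \<open>False\<close> remain non-compact.\<close>
primrec cell :: "(nat \<Rightarrow> bool) \<Rightarrow> nat \<Rightarrow> 'x set" where
  "cell b 0 = topspace X"
| "cell b (Suc m) = (if b m then cell b m \<inter> B (splitter (cell b m)) else cell b m - B (splitter (cell b m)))"

text \<open>The branch of the tree through a point, described without its code because the code is read off
  from it.\<close>
primrec cell_around :: "'x \<Rightarrow> nat \<Rightarrow> 'x set" where
  "cell_around x 0 = topspace X"
| "cell_around x (Suc m) = (if x \<in> B (splitter (cell_around x m))
     then cell_around x m \<inter> B (splitter (cell_around x m)) else cell_around x m - B (splitter (cell_around x m)))"

definition code :: "'x \<Rightarrow> nat \<Rightarrow> bool" where
  "code x m \<longleftrightarrow> x \<in> B (splitter (cell_around x m))"

lemma B_props: "openin X (B n)" "compactin X (B n)" "closedin X (B n)"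
proof -
  have "B n \<in> {C. openin X C \<and> compactin X C}" using B by blast
  then show o: "openin X (B n)" and c: "compactin X (B n)" by auto
  show "closedin X (B n)"
    using compactin_imp_closedin[OF _ c] X by (simp add: noncompact_cantor_space_def)
qed

lemma B_base:
  assumes "openin X U" "x \<in> U"
  obtains n where "x \<in> B n" "B n \<subseteq> U"
proof -
  obtain C where C: "openin X C" "compactin X C" "x \<in> C" "C \<subseteq> U"
    using compact_open_neighbourhood[OF X assms] by blast
  then have "C \<in> range B" unfolding B by blast
  then show thesis using that C by blast
qed

lemma B_separates:
  assumes "x \<in> topspace X" "y \<in> topspace X" "x \<noteq> y"
  obtains n where "x \<in> B n" "y \<notin> B n"
proof -
  have "closedin X {y}"
    using X assms by (simp add: noncompact_cantor_space_def closedin_Hausdorff_singleton)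
  then have "openin X (topspace X - {y})" by blast
  from B_base[OF this, of x] assms that show thesis by blast
qed

text \<open>Without isolated points a non-empty open set has two points, and some compact open set contains
  exactly one of them.\<close>
lemma some_splits:
  assumes "openin X S" "S \<noteq> {}"
  shows "splits (B (splitter S)) S"
proof -
  obtain x where x: "x \<in> S" "x \<in> topspace X" using assms openin_subset by blast
  have "S \<noteq> {x}" using X assms x unfolding noncompact_cantor_space_def by metis
  then obtain y where y: "y \<in> S" "y \<noteq> x" using x by blast
  have "y \<in> topspace X" using y assms openin_subset by blast
  with x y obtain n where "x \<in> B n" "y \<notin> B n" using B_separates by metis
  then have "splits (B n) S" using x y unfolding splits_def by blast
  then show ?thesis unfolding splitter_def by (rule LeastI)
qed

lemma cell_open_closed: "openin X (cell b m) \<and> closedin X (cell b m) \<and> cell b m \<noteq> {}"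
proof (induction m)
  case 0
  then show ?case using X by (simp add: noncompact_cantor_space_def)
next
  case (Suc m)
  then have "splits (B (splitter (cell b m))) (cell b m)" by (intro some_splits) auto
  then show ?case using Suc B_props by (auto simp: splits_def)
qed

lemma cell_splits: "splits (B (splitter (cell b m))) (cell b m)"
  by (rule some_splits) (use cell_open_closed in auto)

lemma cell_antimono: "m \<le> k \<Longrightarrow> cell b k \<subseteq> cell b m"
  by (rule lift_Suc_antimono_le[of "cell b"]) auto

lemma cell_cong: "(\<And>k. k < m \<Longrightarrow> b k = b' k) \<Longrightarrow> cell b m = cell b' m"
  by (induction m) auto

text \<open>What divides a part of a cell divides the cell, and the set that has just been used divides none of
  the new parts.\<close>
lemma splitter_cell_strict_mono: "splitter (cell b m) < splitter (cell b (Suc m))"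
proof (rule ccontr)
  assume "\<not> splitter (cell b m) < splitter (cell b (Suc m))"
  then have le: "splitter (cell b (Suc m)) \<le> splitter (cell b m)" by simp
  have s: "splits (B (splitter (cell b (Suc m)))) (cell b (Suc m))" by (rule cell_splits)
  have "splits (B (splitter (cell b (Suc m)))) (cell b m)"
    using s unfolding splits_def by (auto split: if_splits)
  then have "splitter (cell b m) \<le> splitter (cell b (Suc m))"
    unfolding splitter_def[of "cell b m"] by (rule Least_le)
  with le have "splitter (cell b (Suc m)) = splitter (cell b m)" by simp
  with s show False unfolding splits_def by (auto split: if_splits)
qed

text \<open>After \<open>n\<close> steps the sets of the enumeration with a smaller index are no longer divided; this is how
  the cells of a branch shrink to a point.\<close>
lemma cell_not_split: "n < m \<Longrightarrow> \<not> splits (B n) (cell b m)"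
proof -
  assume n: "n < m"
  have "strict_mono (\<lambda>m. splitter (cell b m))"
    unfolding strict_mono_Suc_iff using splitter_cell_strict_mono by blast
  then have "m \<le> splitter (cell b m)" by (rule strict_mono_imp_increasing)
  with n have "n < splitter (cell b m)" by simp
  then show ?thesis unfolding splitter_def by (rule not_less_Least)
qed

lemma cell_code: "cell (code x) m = cell_around x m"
  by (induction m) (auto simp: code_def)

lemma mem_cell_code: "x \<in> topspace X \<Longrightarrow> x \<in> cell (code x) m"
  unfolding cell_code by (induction m) auto

lemma code_unique: "x \<in> cell b m \<Longrightarrow> k < m \<Longrightarrow> code x k = b k"
proof (induction m arbitrary: k)
  case (Suc m)
  then have x: "x \<in> cell b m" by (auto split: if_splits)
  then have e: "cell (code x) m = cell b m" using Suc.IH by (intro cell_cong) auto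
  show ?case
  proof (cases "k = m")
    case True
    have "code x m \<longleftrightarrow> x \<in> B (splitter (cell b m))" unfolding code_def cell_code[symmetric] e ..
    then show ?thesis using Suc.prems(1) True by (auto split: if_splits)
  next
    case False
    then show ?thesis using Suc x by simp
  qed
qed simp

lemma mem_cell_iff: "x \<in> cell b m \<longleftrightarrow> x \<in> topspace X \<and> (\<forall>k<m. code x k = b k)"
proof
  assume "x \<in> cell b m"
  then show "x \<in> topspace X \<and> (\<forall>k<m. code x k = b k)"
    using code_unique cell_open_closed openin_subset by blast
next
  assume r: "x \<in> topspace X \<and> (\<forall>k<m. code x k = b k)"
  then have "cell (code x) m = cell b m" by (intro cell_cong) auto
  then show "x \<in> cell b m" using mem_cell_code r by blast
qed

lemma inj_on_code: "inj_on code (topspace X)"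
proof (rule inj_onI, rule ccontr)
  fix x y assume xy: "x \<in> topspace X" "y \<in> topspace X" "code x = code y" "x \<noteq> y"
  obtain n where n: "x \<in> B n" "y \<notin> B n" using B_separates xy by metis
  have "x \<in> cell (code x) (Suc n)" "y \<in> cell (code x) (Suc n)" unfolding mem_cell_iff using xy by auto
  then have "splits (B n) (cell (code x) (Suc n))" using n unfolding splits_def by blast
  then show False using cell_not_split by blast
qed

lemma compl_zero_cell_compact: "compactin X (topspace X - cell (\<lambda>_. False) m)"
proof (induction m)
  case (Suc m)
  let ?S = "cell (\<lambda>_. False) m"
  have "?S \<subseteq> topspace X" using cell_open_closed openin_subset by blast
  then have "topspace X - cell (\<lambda>_. False) (Suc m) = (topspace X - ?S) \<union> (B (splitter ?S) \<inter> ?S)" by auto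
  moreover have "compactin X (B (splitter ?S) \<inter> ?S)"
    using B_props cell_open_closed by (intro compact_Int_closedin) auto
  ultimately show ?case using Suc compactin_Un by metis
qed simp

text \<open>A compact open neighbourhood of a point of all cells of the branch \<open>False\<close> would contain one of these
  cells, whose complement is compact; the space would be compact.\<close>
lemma code_nonzero:
  assumes x: "x \<in> topspace X"
  shows "code x \<noteq> (\<lambda>_. False)"
proof
  assume c: "code x = (\<lambda>_. False)"
  obtain n where n: "x \<in> B n" using B_base[OF openin_topspace x] by blast
  let ?S = "cell (\<lambda>_. False) (Suc n)"
  have "x \<in> ?S" using mem_cell_code[OF x, of "Suc n"] c by simp
  then have "?S \<subseteq> B n" using cell_not_split[of n "Suc n" "\<lambda>_. False"] n unfolding splits_def by blast
  then have "compactin X ?S" using closed_compactin[OF B_props(2)] cell_open_closed by blast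
  then have "compactin X (?S \<union> (topspace X - ?S))" using compl_zero_cell_compact by (rule compactin_Un)
  moreover have "?S \<union> (topspace X - ?S) = topspace X" using cell_open_closed openin_subset by blast
  ultimately show False using X by (simp add: noncompact_cantor_space_def compact_space_def)
qed

text \<open>Behind the first \<open>True\<close> the cells of a branch are compact, so they have a common point.\<close>
lemma code_surj:
  assumes b: "b \<noteq> (\<lambda>_. False)"
  shows "\<exists>x\<in>topspace X. code x = b"
proof -
  obtain k where k: "b k" using b by auto
  let ?K = "cell b (Suc k)"
  have K: "compactin X ?K"
  proof (rule closed_compactin[OF B_props(2)])
    show "?K \<subseteq> B (splitter (cell b k))" using k by simp
  qed (use cell_open_closed in blast)
  let ?C = "\<lambda>n. cell b (Suc k + n)"
  have "(\<Inter>n. ?C n) \<noteq> {}"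
  proof (rule compact_space_imp_nest)
    show "compact_space (subtopology X ?K)" using K by (rule compact_space_subtopology)
    show "closedin (subtopology X ?K) (?C n)" for n
      by (rule closedin_subset_topspace[OF _ cell_antimono]) (simp_all only: cell_open_closed le_add1)
    show "?C n \<noteq> {}" for n using cell_open_closed by blast
    show "decseq ?C" unfolding decseq_def by (intro allI impI cell_antimono) simp
  qed
  then obtain x where x: "\<And>n. x \<in> ?C n" by blast
  have "code x j = b j" for j
  proof -
    have "x \<in> cell b (Suc k + Suc j)" by (rule x)
    then show ?thesis by (rule code_unique) simp
  qed
  then have "code x = b" by blast
  moreover have "x \<in> topspace X" using x[of 0] mem_cell_iff by blast
  ultimately show ?thesis by blast
qed

text \<open>The cells correspond to the cylinders of the cube, and both are bases.\<close>
lemma homeomorphic_map_code: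
  "homeomorphic_map X (subtopology (bit_cube UNIV) (UNIV - {\<lambda>_. False})) code"
proof (rule bijective_open_imp_homeomorphic_map)
  let ?Z = "subtopology (bit_cube UNIV) (UNIV - {\<lambda>_::nat. False})"
  have top: "topspace ?Z = UNIV - {\<lambda>_. False}" by (simp add: topspace_bit_cube)
  show im: "code ` topspace X = topspace ?Z" unfolding top
  proof (intro equalityI subsetI)
    fix b assume "b \<in> UNIV - {\<lambda>_::nat. False}"
    then have "b \<noteq> (\<lambda>_. False)" by simp
    from code_surj[OF this] show "b \<in> code ` topspace X" by blast
  qed (use code_nonzero in auto)
  show "inj_on code (topspace X)" by (rule inj_on_code)
  show "continuous_map X ?Z code"
    unfolding continuous_map_in_subtopology
  proof (intro conjI)
    show "continuous_map X (bit_cube UNIV) code"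
      unfolding bit_cube_def continuous_map_componentwise_UNIV
    proof
      fix k
      show "continuous_map X (discrete_topology UNIV) (\<lambda>x. code x k)"
        unfolding continuous_map_def
      proof (intro conjI allI impI)
        fix U :: "bool set" assume "openin (discrete_topology UNIV) U"
        show "openin X {x \<in> topspace X. code x k \<in> U}"
        proof (subst openin_subopen, intro ballI)
          fix x assume x: "x \<in> {x \<in> topspace X. code x k \<in> U}"
          show "\<exists>T. openin X T \<and> x \<in> T \<and> T \<subseteq> {x \<in> topspace X. code x k \<in> U}"
            using x cell_open_closed[of "code x" "Suc k"]
            by (intro exI[of _ "cell (code x) (Suc k)"]) (auto simp del: cell.simps simp: mem_cell_iff)
        qed
      qed simp
    qed
    show "code \<in> topspace X \<rightarrow> UNIV - {\<lambda>_. False}" using code_nonzero by blast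
  qed
  show "open_map X ?Z code"
    unfolding open_map_def
  proof (intro allI impI)
    fix U assume U: "openin X U"
    define W where "W = {b. \<exists>x\<in>U. \<exists>n. (\<forall>k<n. b k = code x k) \<and> cell (code x) n \<subseteq> U}"
    have "openin (bit_cube UNIV) W"
      unfolding openin_bit_cube
    proof (intro conjI ballI)
      fix b assume "b \<in> W"
      then obtain x n where x: "x \<in> U" "\<forall>k<n. b k = code x k" "cell (code x) n \<subseteq> U" unfolding W_def by blast
      have "w' \<in> W" if "\<forall>i\<in>{..<n}. w' i = b i" for w'
        unfolding W_def mem_Collect_eq by (rule bexI[OF _ x(1)], rule exI[of _ n]) (use x that in auto)
      then show "\<exists>E. finite E \<and> E \<subseteq> UNIV \<and> (\<forall>w'\<in>extensional UNIV. (\<forall>i\<in>E. w' i = b i) \<longrightarrow> w' \<in> W)"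
        by (intro exI[of _ "{..<n}"]) auto
    qed simp
    moreover have "code ` U = (UNIV - {\<lambda>_. False}) \<inter> W"
    proof (intro equalityI subsetI)
      fix b assume "b \<in> code ` U"
      then obtain x where x: "x \<in> U" "b = code x" by blast
      have xX: "x \<in> topspace X" using x U openin_subset by blast
      obtain n where n: "x \<in> B n" "B n \<subseteq> U" using B_base[OF U x(1)] by blast
      have "cell (code x) (Suc n) \<subseteq> U"
        using cell_not_split[of n "Suc n" "code x"] mem_cell_code[OF xX, of "Suc n"] n unfolding splits_def by blast
      then have "b \<in> W"
        unfolding W_def mem_Collect_eq
        by (intro bexI[OF _ x(1)] exI[of _ "Suc n"] conjI) (simp_all add: x(2))
      then show "b \<in> (UNIV - {\<lambda>_. False}) \<inter> W" using x code_nonzero[OF xX] by simp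
    next
      fix b assume b: "b \<in> (UNIV - {\<lambda>_. False}) \<inter> W"
      then obtain x n where x: "x \<in> U" "\<forall>k<n. b k = code x k" "cell (code x) n \<subseteq> U" unfolding W_def by blast
      obtain y where y: "y \<in> topspace X" "code y = b" using code_surj b by blast
      then have "y \<in> cell (code x) n" unfolding mem_cell_iff using x by auto
      then show "b \<in> code ` U" using x y by blast
    qed
    ultimately show "openin ?Z (code ` U)" by (simp add: openin_subtopology_Int2)
  qed
qed

end

text \<open>Each of them is homeomorphic to the Cantor cube with one point removed.\<close>
lemma noncompact_cantor_spaces_homeomorphic:
  assumes "noncompact_cantor_space X" "noncompact_cantor_space Y"
  shows "X homeomorphic_space Y"
proof -
  have model: "Z homeomorphic_space subtopology (bit_cube UNIV) (UNIV - {\<lambda>_::nat. False})"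
    if Z: "noncompact_cantor_space Z" for Z :: "'z topology"
  proof -
    have "countable {C. openin Z C \<and> compactin Z C}"
      using Z by (intro countable_compact_open_sets) (simp add: noncompact_cantor_space_def)
    moreover have "{C. openin Z C \<and> compactin Z C} \<noteq> {}" by (auto intro!: exI[of _ "{}"])
    ultimately interpret enumerated_cantor_space Z "from_nat_into {C. openin Z C \<and> compactin Z C}"
      using Z by unfold_locales (auto simp: range_from_nat_into)
    show ?thesis using homeomorphic_map_code homeomorphic_map_imp_homeomorphic_space by blast
  qed
  show ?thesis
    using model[OF assms(1)] model[OF assms(2)] homeomorphic_space_sym homeomorphic_space_trans by blast
qed

section \<open>Actions given by maps, and their transport\<close>

lemma lc_G_spaceI:
  assumes G: "group G" and lc: "locally_compact_space X" and hd: "Hausdorff_space X"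
    and cont: "\<And>g. g \<in> carrier G \<Longrightarrow> continuous_map X X (act g)"
    and one: "\<And>x. x \<in> topspace X \<Longrightarrow> act \<one>\<^bsub>G\<^esub> x = x"
    and mult: "\<And>g h x. g \<in> carrier G \<Longrightarrow> h \<in> carrier G \<Longrightarrow> x \<in> topspace X \<Longrightarrow> act (g \<otimes>\<^bsub>G\<^esub> h) x = act g (act h x)"
  shows "lc_G_space G X (\<lambda>g. restrict (act g) (topspace X))"
proof -
  interpret group G by (rule G)
  let ?a = "\<lambda>g. restrict (act g) (topspace X)"
  have closed: "act g x \<in> topspace X" if "g \<in> carrier G" "x \<in> topspace X" for g x
    using cont[OF that(1)] that(2) by (auto simp: continuous_map_def)
  have inv1: "act (inv\<^bsub>G\<^esub> g) (act g x) = x" "act g (act (inv\<^bsub>G\<^esub> g) x) = x"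
    if "g \<in> carrier G" "x \<in> topspace X" for g x
    using that mult[of "inv\<^bsub>G\<^esub> g" g x] mult[of g "inv\<^bsub>G\<^esub> g" x] one by simp_all
  have bij: "?a g \<in> Bij (topspace X)" if g: "g \<in> carrier G" for g
  proof -
    have "bij_betw (?a g) (topspace X) (topspace X)"
      by (rule bij_betwI[of _ _ _ "act (inv\<^bsub>G\<^esub> g)"]) (use g closed inv1 in auto)
    then show ?thesis by (simp add: Bij_def)
  qed
  have ga: "group_action G (topspace X) ?a"
  proof (rule group_action.intro, rule group_hom.intro)
    show "group (BijGroup (topspace X))" by (rule group_BijGroup)
    show "group_hom_axioms G (BijGroup (topspace X)) ?a"
    proof (unfold_locales, rule homI)
      show "?a g \<in> carrier (BijGroup (topspace X))" if "g \<in> carrier G" for g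
        using bij[OF that] by (simp add: BijGroup_def)
      show "?a (g \<otimes>\<^bsub>G\<^esub> h) = ?a g \<otimes>\<^bsub>BijGroup (topspace X)\<^esub> ?a h"
        if gh: "g \<in> carrier G" "h \<in> carrier G" for g h
      proof -
        have "?a g \<otimes>\<^bsub>BijGroup (topspace X)\<^esub> ?a h = compose (topspace X) (?a g) (?a h)"
          using bij[OF gh(1)] bij[OF gh(2)] by (simp add: BijGroup_def)
        also have "\<dots> = ?a (g \<otimes>\<^bsub>G\<^esub> h)"
          using closed[OF gh(2)] mult[OF gh] by (auto simp: compose_def fun_eq_iff)
        finally show ?thesis by simp
      qed
    qed
  qed (rule G)
  have "homeomorphic_map X X (?a g)" if g: "g \<in> carrier G" for g
  proof -
    have "homeomorphic_maps X X (act g) (act (inv\<^bsub>G\<^esub> g))"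
      unfolding homeomorphic_maps_def using g cont inv1 by auto
    then have "homeomorphic_map X X (act g)" by (rule homeomorphic_maps_imp_map)
    then show ?thesis by (rule homeomorphic_map_eq) simp
  qed
  then show ?thesis unfolding lc_G_space_def using lc hd ga by blast
qed

lemma lc_G_spaceD:
  assumes "lc_G_space G X \<alpha>"
  shows "locally_compact_space X" "Hausdorff_space X" "group G"
    "g \<in> carrier G \<Longrightarrow> continuous_map X X (\<alpha> g)"
    "g \<in> carrier G \<Longrightarrow> x \<in> topspace X \<Longrightarrow> \<alpha> g x \<in> topspace X"
    "x \<in> topspace X \<Longrightarrow> \<alpha> \<one>\<^bsub>G\<^esub> x = x"
    "g \<in> carrier G \<Longrightarrow> h \<in> carrier G \<Longrightarrow> x \<in> topspace X \<Longrightarrow> \<alpha> (g \<otimes>\<^bsub>G\<^esub> h) x = \<alpha> g (\<alpha> h x)"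
proof -
  interpret group_action G "topspace X" \<alpha> using assms by (simp add: lc_G_space_def)
  show "locally_compact_space X" "Hausdorff_space X" using assms by (auto simp: lc_G_space_def)
  show "group G" using group_hom by (simp add: group_hom_def)
  show "g \<in> carrier G \<Longrightarrow> continuous_map X X (\<alpha> g)"
    using assms by (auto simp: lc_G_space_def homeomorphic_imp_continuous_map)
  show "g \<in> carrier G \<Longrightarrow> x \<in> topspace X \<Longrightarrow> \<alpha> g x \<in> topspace X" by (rule element_image) simp_all
  show "x \<in> topspace X \<Longrightarrow> \<alpha> \<one>\<^bsub>G\<^esub> x = x" using id_eq_one by (metis restrict_apply')
  show "g \<in> carrier G \<Longrightarrow> h \<in> carrier G \<Longrightarrow> x \<in> topspace X \<Longrightarrow> \<alpha> (g \<otimes>\<^bsub>G\<^esub> h) x = \<alpha> g (\<alpha> h x)"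
    by (rule composition_rule)
qed

lemma G_space_transport:
  assumes h: "homeomorphic_maps Y K h k" and a: "lc_G_space G Y \<alpha>"
  defines "\<beta> \<equiv> \<lambda>g. restrict (\<lambda>x. h (\<alpha> g (k x))) (topspace K)"
  shows "lc_G_space G K \<beta>"
    and "free_action G Y \<alpha> \<Longrightarrow> free_action G K \<beta>"
    and "minimal_action G Y \<alpha> \<Longrightarrow> minimal_action G K \<beta>"
    and "amenable_action G Y \<alpha> \<Longrightarrow> amenable_action G K \<beta>"
    and "y\<^sub>0 \<in> topspace Y \<Longrightarrow> h y\<^sub>0 \<in> topspace K \<and> G_type G K \<beta> (h y\<^sub>0) = G_type G Y \<alpha> y\<^sub>0"
proof -
  note aD = lc_G_spaceD[OF a]
  have ch: "continuous_map Y K h" and ck: "continuous_map K Y k"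
    and kh: "\<And>y. y \<in> topspace Y \<Longrightarrow> k (h y) = y" and hk: "\<And>x. x \<in> topspace K \<Longrightarrow> h (k x) = x"
    using h by (auto simp: homeomorphic_maps_def)
  have hT: "h y \<in> topspace K" if "y \<in> topspace Y" for y using ch that by (auto simp: continuous_map_def)
  have kT: "k x \<in> topspace Y" if "x \<in> topspace K" for x using ck that by (auto simp: continuous_map_def)
  have hm: "homeomorphic_map Y K h" using h by (rule homeomorphic_maps_imp_map)
  have ht: "h ` topspace Y = topspace K" using hm by (rule homeomorphic_imp_surjective_map)
  have YK: "Y homeomorphic_space K" using h by (auto simp: homeomorphic_space_def)
  show lK: "lc_G_space G K \<beta>"
    unfolding \<beta>_def
  proof (rule lc_G_spaceI)
    show "locally_compact_space K" using homeomorphic_locally_compact_spaceD[OF aD(1) YK] .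
    show "Hausdorff_space K" using homeomorphic_Hausdorff_space[OF YK] aD(2) by blast
    show "continuous_map K K (\<lambda>x. h (\<alpha> g (k x)))" if "g \<in> carrier G" for g
      using continuous_map_compose[OF continuous_map_compose[OF ck aD(4)[OF that]] ch] by (simp add: o_def)
  qed (use aD kT kh hk in auto)
  have bh: "\<beta> g (h y) = h (\<alpha> g y)" if "y \<in> topspace Y" for g y
    unfolding \<beta>_def using that hT kh by simp
  have closure: "K closure_of (\<lambda>g. \<beta> g (h y)) ` B = h ` (Y closure_of (\<lambda>g. \<alpha> g y) ` B)"
    if "B \<subseteq> carrier G" "y \<in> topspace Y" for B y
  proof -
    have "(\<lambda>g. \<beta> g (h y)) ` B = h ` ((\<lambda>g. \<alpha> g y) ` B)" using bh that by auto
    moreover have "(\<lambda>g. \<alpha> g y) ` B \<subseteq> topspace Y" using aD(5) that by auto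
    ultimately show ?thesis using homeomorphic_map_closure_of[OF hm] by simp
  qed
  have orb: "orbit G \<gamma> z = (\<lambda>g. \<gamma> g z) ` carrier G" for \<gamma> :: "_ \<Rightarrow> 'z \<Rightarrow> 'z" and z
    unfolding orbit_def by auto
  show "free_action G K \<beta>" if fr: "free_action G Y \<alpha>"
    unfolding free_action_def
  proof (intro ballI impI)
    fix g assume g: "g \<in> carrier G" "\<exists>x\<in>topspace K. \<beta> g x = x"
    then obtain x where x: "x \<in> topspace K" "\<beta> g x = x" by blast
    then have "h (\<alpha> g (k x)) = x" unfolding \<beta>_def by simp
    then have "\<alpha> g (k x) = k x" using kh[of "\<alpha> g (k x)"] aD(5)[OF g(1) kT[OF x(1)]] by simp
    then show "g = \<one>\<^bsub>G\<^esub>" using fr g kT[OF x(1)] unfolding free_action_def by blast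
  qed
  show "minimal_action G K \<beta>" if mi: "minimal_action G Y \<alpha>"
    unfolding minimal_action_def
  proof (intro conjI ballI)
    show "topspace K \<noteq> {}" using mi ht unfolding minimal_action_def by auto
    fix x assume x: "x \<in> topspace K"
    have "K closure_of orbit G \<beta> x = h ` (Y closure_of orbit G \<alpha> (k x))"
      using closure[OF order_refl kT[OF x]] hk[OF x] unfolding orb by simp
    then show "K closure_of orbit G \<beta> x = topspace K"
      using mi kT[OF x] ht unfolding minimal_action_def by simp
  qed
  show "amenable_action G K \<beta>" if am: "amenable_action G Y \<alpha>"
    unfolding amenable_action_def
  proof (intro allI impI)
    fix C F and \<epsilon> :: real assume C: "compactin K C \<and> finite F \<and> F \<subseteq> carrier G \<and> \<epsilon> > 0"
    then have "compactin Y (k ` C)" using image_compactin[OF _ ck] by blast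
    then obtain m where m: "\<forall>x\<in>topspace Y. (\<forall>h\<in>carrier G. m x h \<ge> (0::real)) \<and> (m x has_sum 1) (carrier G)"
      "\<forall>h\<in>carrier G. continuous_map Y euclideanreal (\<lambda>x. m x h)"
      "\<forall>x\<in>k ` C. \<forall>g\<in>F. (\<Sum>\<^sub>\<infinity>h\<in>carrier G. \<bar>m x (inv\<^bsub>G\<^esub> g \<otimes>\<^bsub>G\<^esub> h) - m (\<alpha> g x) h\<bar>) < \<epsilon>"
      using am[unfolded amenable_action_def, rule_format, of "k ` C" F \<epsilon>] C by blast
    show "\<exists>m. (\<forall>x\<in>topspace K. (\<forall>h\<in>carrier G. 0 \<le> m x h) \<and> (m x has_sum (1::real)) (carrier G)) \<and>
        (\<forall>h\<in>carrier G. continuous_map K euclideanreal (\<lambda>x. m x h)) \<and>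
        (\<forall>x\<in>C. \<forall>g\<in>F. (\<Sum>\<^sub>\<infinity>h\<in>carrier G. \<bar>m x (inv\<^bsub>G\<^esub> g \<otimes>\<^bsub>G\<^esub> h) - m (\<beta> g x) h\<bar>) < \<epsilon>)"
    proof (intro exI[of _ "\<lambda>x. m (k x)"] conjI ballI)
      fix x q assume x: "x \<in> topspace K" and q: "q \<in> carrier G"
      show "0 \<le> m (k x) q" using m(1) kT[OF x] q by blast
    next
      fix x assume x: "x \<in> topspace K"
      show "(m (k x) has_sum 1) (carrier G)" using m(1) kT[OF x] by blast
    next
      fix q assume q: "q \<in> carrier G"
      show "continuous_map K euclideanreal (\<lambda>x. m (k x) q)"
        using continuous_map_compose[OF ck m(2)[rule_format, OF q]] by (simp add: o_def)
    next
      fix x g assume x: "x \<in> C" and g: "g \<in> F"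
      have xK: "x \<in> topspace K" using x C compactin_subset_topspace by blast
      have gG: "g \<in> carrier G" using g C by blast
      have "k (\<beta> g x) = \<alpha> g (k x)" unfolding \<beta>_def using xK kh aD(5)[OF gG kT[OF xK]] by simp
      then show "(\<Sum>\<^sub>\<infinity>h\<in>carrier G. \<bar>m (k x) (inv\<^bsub>G\<^esub> g \<otimes>\<^bsub>G\<^esub> h) - m (k (\<beta> g x)) h\<bar>) < \<epsilon>"
        using m(3) x g by simp
    qed
  qed
  show "h y\<^sub>0 \<in> topspace K \<and> G_type G K \<beta> (h y\<^sub>0) = G_type G Y \<alpha> y\<^sub>0" if y: "y\<^sub>0 \<in> topspace Y"
  proof -
    have "compactin K (K closure_of (\<lambda>g. \<beta> g (h y\<^sub>0)) ` B) \<longleftrightarrow> compactin Y (Y closure_of (\<lambda>g. \<alpha> g y\<^sub>0) ` B)"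
      if "B \<subseteq> carrier G" for B
      unfolding closure[OF that y] by (rule homeomorphic_map_compactness[OF hm closure_of_subset_topspace])
    then have "rel_compact_sets G K \<beta> (h y\<^sub>0) = rel_compact_sets G Y \<alpha> y\<^sub>0"
      unfolding rel_compact_sets_def by blast
    then show ?thesis unfolding G_type_def using hT[OF y] by simp
  qed
qed

context group begin

text \<open>The map \<open>f\<close> assigns to each point \<open>t\<close> of the group a probability measure on \<open>S\<close>.  Its finite range is what allows
  it to be encoded by finitely many subsets of the group.\<close>
definition almost_equivariant :: "'a set \<Rightarrow> real \<Rightarrow> 'a set \<Rightarrow> ('a \<Rightarrow> 'a \<Rightarrow> real) \<Rightarrow> bool" where
  "almost_equivariant F \<epsilon> S f \<longleftrightarrow> finite S \<and> S \<subseteq> carrier G \<and> finite (f ` carrier G) \<and>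
    (\<forall>t\<in>carrier G. (\<forall>q. f t q \<ge> 0) \<and> (\<forall>q. q \<notin> S \<longrightarrow> f t q = 0) \<and> sum (f t) S = 1) \<and>
    (\<forall>g\<in>F. \<forall>t\<in>carrier G. (\<Sum>\<^sub>\<infinity>h\<in>carrier G. \<bar>f t (inv g \<otimes> h) - f (g \<otimes> t) h\<bar>) < \<epsilon>)"

end

section \<open>Symbolic systems of a family of subsets of the group\<close>

text \<open>The value of a point at a translate \<open>g <# D\<close> is its value at \<open>D\<close> seen from another place of its orbit.
  Shifting by \<open>g\<close> therefore reads the coordinate \<open>inv g <# D\<close>.\<close>
locale symbolic = group G for G (structure) +
  fixes \<D> :: "'a set set"
  assumes subset: "D \<in> \<D> \<Longrightarrow> D \<subseteq> carrier G"
    and translate: "D \<in> \<D> \<Longrightarrow> g \<in> carrier G \<Longrightarrow> g <# D \<in> \<D>"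
begin

definition shift :: "'a \<Rightarrow> ('a set \<Rightarrow> bool) \<Rightarrow> 'a set \<Rightarrow> bool" where
  "shift g w = (\<lambda>D\<in>\<D>. w (inv g <# D))"

definition mark :: "'a \<Rightarrow> 'a set \<Rightarrow> bool" where
  "mark h = (\<lambda>D\<in>\<D>. h \<in> D)"

text \<open>This is the closure of the set of all marks, spelled out with the basic open sets of the cube: on
  finitely many coordinates a trace agrees with a group element.\<close>
definition traces :: "('a set \<Rightarrow> bool) set" where
  "traces = {w \<in> extensional \<D>. \<forall>E. finite E \<and> E \<subseteq> \<D> \<longrightarrow> (\<exists>h\<in>carrier G. \<forall>D\<in>E. w D \<longleftrightarrow> h \<in> D)}"

lemma mem_translate_iff:
  assumes "D \<subseteq> carrier G" "g \<in> carrier G" "h \<in> carrier G"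
  shows "h \<in> inv g <# D \<longleftrightarrow> g \<otimes> h \<in> D"
proof
  assume "h \<in> inv g <# D"
  then obtain d where "d \<in> D" "h = inv g \<otimes> d" unfolding l_coset_def by blast
  then show "g \<otimes> h \<in> D" using assms by (auto simp: m_assoc[symmetric] subset_iff)
next
  assume d: "g \<otimes> h \<in> D"
  have "h = inv g \<otimes> (g \<otimes> h)" using assms by (simp add: m_assoc[symmetric])
  with d show "h \<in> inv g <# D" unfolding l_coset_def by blast
qed

lemma shift_apply: "D \<in> \<D> \<Longrightarrow> shift g w D = w (inv g <# D)"
  unfolding shift_def by simp

lemma shift_extensional: "shift g w \<in> extensional \<D>"
  unfolding shift_def by simp

lemma shift_one: "w \<in> extensional \<D> \<Longrightarrow> shift \<one> w = w"
  unfolding shift_def using subset lcos_mult_one by (auto simp: fun_eq_iff extensional_def)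

lemma shift_mult:
  assumes "g \<in> carrier G" "h \<in> carrier G"
  shows "shift (g \<otimes> h) w = shift g (shift h w)"
proof
  fix D show "shift (g \<otimes> h) w D = shift g (shift h w) D"
  proof (cases "D \<in> \<D>")
    case True
    then have "inv h <# (inv g <# D) = inv (g \<otimes> h) <# D"
      using lcos_m_assoc[OF subset] assms by (simp add: inv_mult_group)
    then show ?thesis using True assms translate by (simp add: shift_apply)
  qed (simp add: shift_def)
qed

lemma shift_mark: "g \<in> carrier G \<Longrightarrow> h \<in> carrier G \<Longrightarrow> shift g (mark h) = mark (g \<otimes> h)"
  unfolding shift_def mark_def using translate subset mem_translate_iff by (auto simp: fun_eq_iff)

lemma mark_in_traces: "h \<in> carrier G \<Longrightarrow> mark h \<in> traces"
  unfolding traces_def mark_def by (auto intro!: bexI[of _ h])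

lemma traces_approx:
  "w \<in> traces \<Longrightarrow> finite E \<Longrightarrow> E \<subseteq> \<D> \<Longrightarrow> \<exists>h\<in>carrier G. \<forall>D\<in>E. w D \<longleftrightarrow> h \<in> D"
  unfolding traces_def by blast

lemma shift_in_traces:
  assumes g: "g \<in> carrier G" and w: "w \<in> traces"
  shows "shift g w \<in> traces"
  unfolding traces_def
proof (intro CollectI conjI allI impI shift_extensional)
  fix E assume E: "finite E \<and> E \<subseteq> \<D>"
  have "finite ((\<lambda>D. inv g <# D) ` E)" "(\<lambda>D. inv g <# D) ` E \<subseteq> \<D>" using E g translate by auto
  from traces_approx[OF w this] obtain h where h: "h \<in> carrier G" "\<forall>D\<in>E. w (inv g <# D) \<longleftrightarrow> h \<in> inv g <# D" by auto
  have "\<forall>D\<in>E. shift g w D \<longleftrightarrow> g \<otimes> h \<in> D"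
  proof
    fix D assume D: "D \<in> E"
    then have D': "D \<in> \<D>" using E by blast
    show "shift g w D \<longleftrightarrow> g \<otimes> h \<in> D"
      using h(2) D mem_translate_iff[OF subset[OF D'] g h(1)] unfolding shift_apply[OF D'] by blast
  qed
  then show "\<exists>h\<in>carrier G. \<forall>D\<in>E. shift g w D \<longleftrightarrow> h \<in> D" using h g by blast
qed

lemma closedin_traces: "closedin (bit_cube \<D>) traces"
  unfolding closedin_def topspace_bit_cube openin_bit_cube
proof (intro conjI ballI)
  show "traces \<subseteq> extensional \<D>" unfolding traces_def by blast
  fix w assume w: "w \<in> extensional \<D> - traces"
  then obtain E where E: "finite E" "E \<subseteq> \<D>" "\<not> (\<exists>h\<in>carrier G. \<forall>D\<in>E. w D \<longleftrightarrow> h \<in> D)"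
    unfolding traces_def by blast
  have "w' \<notin> traces" if "\<forall>D\<in>E. w' D = w D" for w'
  proof
    assume "w' \<in> traces"
    from traces_approx[OF this E(1,2)] obtain h where "h \<in> carrier G" "\<forall>D\<in>E. w' D \<longleftrightarrow> h \<in> D" by blast
    with that E(3) show False by metis
  qed
  then show "\<exists>E. finite E \<and> E \<subseteq> \<D> \<and> (\<forall>w'\<in>extensional \<D>. (\<forall>i\<in>E. w' i = w i) \<longrightarrow> w' \<in> extensional \<D> - traces)"
    using E by blast
qed auto

lemma coordinate_continuous: "D \<in> \<D> \<Longrightarrow> continuous_map (bit_cube \<D>) (discrete_topology UNIV) (\<lambda>w. w D)"
  unfolding bit_cube_def by (rule continuous_map_product_projection)

lemma shift_continuous:
  assumes "g \<in> carrier G"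
  shows "continuous_map (bit_cube \<D>) (bit_cube \<D>) (shift g)"
  unfolding bit_cube_def[of \<D>] continuous_map_componentwise
proof (intro conjI ballI)
  show "shift g ` topspace (product_topology (\<lambda>_. discrete_topology UNIV) \<D>) \<subseteq> extensional \<D>"
    using shift_extensional by blast
  fix D assume D: "D \<in> \<D>"
  have "continuous_map (bit_cube \<D>) (discrete_topology UNIV) (\<lambda>w. w (inv g <# D))"
    by (rule coordinate_continuous) (use D assms translate in simp)
  then show "continuous_map (product_topology (\<lambda>_. discrete_topology UNIV) \<D>) (discrete_topology UNIV) (\<lambda>w. shift g w D)"
    unfolding shift_apply[OF D] bit_cube_def .
qed

lemma openin_coordinate: "D \<in> \<D> \<Longrightarrow> openin (bit_cube \<D>) {w \<in> extensional \<D>. w D = b}"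
  unfolding openin_bit_cube by (auto intro!: exI[of _ "{D}"])

lemma closedin_coordinate: "D \<in> \<D> \<Longrightarrow> closedin (bit_cube \<D>) {w \<in> extensional \<D>. w D = b}"
proof -
  assume D: "D \<in> \<D>"
  have "extensional \<D> - {w \<in> extensional \<D>. w D = b} = {w \<in> extensional \<D>. w D = (\<not> b)}" by auto
  then show ?thesis unfolding closedin_def topspace_bit_cube using openin_coordinate[OF D] by auto
qed

lemma Hausdorff_bit_cube: "Hausdorff_space (bit_cube I)"
  unfolding bit_cube_def by (simp add: Hausdorff_space_product_topology)

lemma compact_bit_cube: "compact_space (bit_cube I)"
  unfolding bit_cube_def by (simp add: compact_space_product_topology compact_space_discrete_topology)

end

lemma second_countable_bit_cube:
  assumes "countable I"
  shows "second_countable (bit_cube I)"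
proof -
  define cyl where "cyl = (\<lambda>(E, T). {w \<in> extensional I. \<forall>i\<in>E. w i \<longleftrightarrow> i \<in> T})"
  define \<B> where "\<B> = cyl ` ({E. finite E \<and> E \<subseteq> I} \<times> {T. finite T \<and> T \<subseteq> I})"
  have "countable \<B>" unfolding \<B>_def
    by (intro countable_image countable_SIGMA countable_Collect_finite_subset assms)
  moreover have "openin (bit_cube I) V" if "V \<in> \<B>" for V
  proof -
    obtain E T where V: "finite E" "E \<subseteq> I" "V = {w \<in> extensional I. \<forall>i\<in>E. w i \<longleftrightarrow> i \<in> T}"
      using \<open>V \<in> \<B>\<close> unfolding \<B>_def cyl_def by auto
    show ?thesis unfolding openin_bit_cube V(3) using V(1,2) by (auto intro!: exI[of _ E])
  qed
  moreover have "\<exists>V\<in>\<B>. w \<in> V \<and> V \<subseteq> U" if U: "openin (bit_cube I) U" "w \<in> U" for U w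
  proof -
    obtain E where E: "finite E" "E \<subseteq> I" "\<forall>w'\<in>extensional I. (\<forall>i\<in>E. w' i = w i) \<longrightarrow> w' \<in> U"
      and w: "w \<in> extensional I"
      using U unfolding openin_bit_cube by blast
    have "cyl (E, {i \<in> E. w i}) \<in> \<B>" unfolding \<B>_def using E by (intro imageI) auto
    moreover have "w \<in> cyl (E, {i \<in> E. w i})" "cyl (E, {i \<in> E. w i}) \<subseteq> U"
      unfolding cyl_def using E w by auto
    ultimately show ?thesis by blast
  qed
  ultimately show ?thesis unfolding second_countable_def by blast
qed

text \<open>The coordinate \<open>S\<close> cuts out a compact open set whose translates cover the system.  It gives local
  compactness, and its return times determine the type.\<close>
locale symbolic_system = symbolic +
  fixes W :: "('a set \<Rightarrow> bool) set" and S :: "'a set"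
  assumes W_traces: "W \<subseteq> traces" and W_shift: "g \<in> carrier G \<Longrightarrow> w \<in> W \<Longrightarrow> shift g w \<in> W"
    and W_nonempty: "W \<noteq> {}" and S: "S \<in> \<D>"
    and W_compact: "compactin (bit_cube \<D>) {w \<in> W. w S}"
    and W_cover: "w \<in> W \<Longrightarrow> \<exists>g\<in>carrier G. shift g w S"
begin

definition Y :: "('a set \<Rightarrow> bool) topology" where "Y = subtopology (bit_cube \<D>) W"

definition act :: "'a \<Rightarrow> ('a set \<Rightarrow> bool) \<Rightarrow> ('a set \<Rightarrow> bool)" where "act g = restrict (shift g) W"

text \<open>The return times to the compact open set of all points with coordinate \<open>S\<close>.\<close>
definition visits :: "('a set \<Rightarrow> bool) \<Rightarrow> 'a set" where "visits w = {g \<in> carrier G. shift g w S}"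

lemma W_extensional: "W \<subseteq> extensional \<D>"
  using W_traces unfolding traces_def by blast

lemma topspace_Y: "topspace Y = W"
  unfolding Y_def using W_extensional by (auto simp: topspace_bit_cube)

lemma openin_Y_coordinate: "D \<in> \<D> \<Longrightarrow> openin Y {w \<in> W. w D = b}"
proof -
  assume D: "D \<in> \<D>"
  have "{w \<in> W. w D = b} = W \<inter> {w \<in> extensional \<D>. w D = b}" using W_extensional by blast
  then show ?thesis unfolding Y_def using openin_coordinate[OF D] by (simp add: openin_subtopology_Int2)
qed

lemma shift_continuous_Y: "g \<in> carrier G \<Longrightarrow> continuous_map Y Y (shift g)"
  unfolding Y_def
  by (intro continuous_map_into_subtopology continuous_map_from_subtopology shift_continuous)
    (use W_extensional W_shift in \<open>auto simp: topspace_bit_cube\<close>)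

lemma compactin_Y: "compactin Y {w \<in> W. w S}"
  unfolding Y_def compactin_subtopology using W_compact by blast

lemma shift_inv:
  assumes "g \<in> carrier G" "w \<in> W"
  shows "shift g (shift (inv g) w) = w" "shift (inv g) (shift g w) = w"
proof -
  have w: "w \<in> extensional \<D>" using assms W_extensional by blast
  show "shift g (shift (inv g) w) = w" "shift (inv g) (shift g w) = w"
    using shift_mult[of g "inv g" w] shift_mult[of "inv g" g w] shift_one[OF w] assms by simp_all
qed

lemma compact_open_translate:
  assumes g: "g \<in> carrier G"
  shows "compactin Y {w \<in> W. shift g w S}" "openin Y {w \<in> W. shift g w S}"
proof -
  have "{w \<in> W. shift g w S} = shift (inv g) ` {w \<in> W. w S}"
  proof (intro equalityI subsetI)
    fix w assume "w \<in> {w \<in> W. shift g w S}"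
    then show "w \<in> shift (inv g) ` {w \<in> W. w S}"
      using W_shift[OF g] shift_inv(2)[OF g] by (intro image_eqI[of _ _ "shift g w"]) auto
  next
    fix w assume "w \<in> shift (inv g) ` {w \<in> W. w S}"
    then show "w \<in> {w \<in> W. shift g w S}"
      using W_shift[of "inv g"] shift_inv(1)[OF g] g by auto
  qed
  then show "compactin Y {w \<in> W. shift g w S}"
    using image_compactin[OF compactin_Y shift_continuous_Y] g by simp
  have "{w \<in> W. shift g w S} = {w \<in> W. w (inv g <# S) = True}" by (simp add: shift_apply[OF S])
  then show "openin Y {w \<in> W. shift g w S}"
    using openin_Y_coordinate[of "inv g <# S" True] translate[OF S] g by simp
qed

lemma Hausdorff_Y: "Hausdorff_space Y"
  unfolding Y_def by (intro Hausdorff_space_subtopology Hausdorff_bit_cube)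

lemma locally_compact_Y: "locally_compact_space Y"
  unfolding locally_compact_space_def topspace_Y
proof
  fix w assume w: "w \<in> W"
  then obtain g where g: "g \<in> carrier G" "shift g w S" using W_cover by blast
  show "\<exists>U K. openin Y U \<and> compactin Y K \<and> w \<in> U \<and> U \<subseteq> K"
    using compact_open_translate[OF g(1)] w g(2) by blast
qed

lemma lc_G_space_Y: "lc_G_space G Y act"
proof -
  have "lc_G_space G Y (\<lambda>g. restrict (shift g) (topspace Y))"
    by (rule lc_G_spaceI)
      (use W_extensional in \<open>auto simp: topspace_Y shift_mult shift_continuous_Y locally_compact_Y Hausdorff_Y
         intro!: shift_one group_axioms\<close>)
  then show ?thesis unfolding topspace_Y act_def .
qed

lemma act_apply: "w \<in> W \<Longrightarrow> act g w = shift g w"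
  unfolding act_def by simp

lemma orbit_act: "w \<in> W \<Longrightarrow> orbit G act w = (\<lambda>g. shift g w) ` carrier G"
  unfolding orbit_def by (auto simp: act_apply)

text \<open>A compact set is covered by finitely many translates of \<open>{w \<in> W. w S}\<close>, and each of them is compact.
  So a piece of an orbit is relatively compact if and only if finitely many translates of the
  return times contain it.\<close>
lemma rel_compact_sets_Y:
  assumes w: "w \<in> W"
  shows "rel_compact_sets G Y act w = sets_below G (visits w)"
proof -
  have "compactin Y (Y closure_of ((\<lambda>g. act g w) ` B)) \<longleftrightarrow> propto G B (visits w)" if B: "B \<subseteq> carrier G" for B
  proof
    assume c: "compactin Y (Y closure_of ((\<lambda>g. act g w) ` B))"
    let ?K = "Y closure_of ((\<lambda>g. act g w) ` B)"
    define \<U> where "\<U> = (\<lambda>g. {w \<in> W. shift g w S}) ` carrier G"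
    have "\<And>U. U \<in> \<U> \<Longrightarrow> openin Y U" unfolding \<U>_def using compact_open_translate by auto
    moreover have "?K \<subseteq> \<Union>\<U>"
      using closure_of_subset_topspace[of Y] W_cover unfolding \<U>_def topspace_Y by fastforce
    ultimately obtain \<F> where F: "finite \<F>" "\<F> \<subseteq> \<U>" "?K \<subseteq> \<Union>\<F>"
      using compactinD[OF c] by metis
    obtain F where F': "finite F" "F \<subseteq> carrier G" "\<F> = (\<lambda>g. {w \<in> W. shift g w S}) ` F"
      using finite_subset_image[OF F(1) F(2)[unfolded \<U>_def]] by blast
    have "B \<subseteq> (\<lambda>g. inv g) ` F <#> visits w"
    proof
      fix b assume b: "b \<in> B"
      then have bG: "b \<in> carrier G" using B by blast
      have "(\<lambda>g. act g w) ` B \<subseteq> topspace Y" using B w W_shift by (auto simp: topspace_Y act_apply)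
      then have "(\<lambda>g. act g w) ` B \<subseteq> ?K" by (rule closure_of_subset)
      then have "shift b w \<in> ?K" using b by (auto simp: act_apply[OF w])
      then obtain g where g: "g \<in> F" "shift g (shift b w) S" using F(3) F'(3) by blast
      have gG: "g \<in> carrier G" using g F' by blast
      then have "g \<otimes> b \<in> visits w" using g(2) bG shift_mult[OF gG bG] by (simp add: visits_def)
      moreover have "b = inv g \<otimes> (g \<otimes> b)" using gG bG by (simp add: m_assoc[symmetric])
      ultimately show "b \<in> (\<lambda>g. inv g) ` F <#> visits w" unfolding set_mult_def using g(1) by blast
    qed
    then show "propto G B (visits w)" unfolding propto_def
      using F' by (intro exI[of _ "(\<lambda>g. inv g) ` F"]) auto
  next
    assume "propto G B (visits w)"
    then obtain F where F: "finite F" "F \<subseteq> carrier G" "B \<subseteq> F <#> visits w" unfolding propto_def by blast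
    define K where "K = (\<Union>f\<in>F. {w \<in> W. shift (inv f) w S})"
    have K: "compactin Y K" unfolding K_def
      by (rule compactin_Union) (use F compact_open_translate in auto)
    have "(\<lambda>g. act g w) ` B \<subseteq> K"
    proof
      fix x assume "x \<in> (\<lambda>g. act g w) ` B"
      then obtain b where b: "b \<in> B" "x = shift b w" by (auto simp: act_apply[OF w])
      then obtain f t where ft: "f \<in> F" "t \<in> visits w" "b = f \<otimes> t" using F(3) unfolding set_mult_def by blast
      have G: "f \<in> carrier G" "t \<in> carrier G" "b \<in> carrier G" using ft F B b by (auto simp: visits_def)
      have "shift (inv f) (shift b w) = shift t w"
        using shift_mult[of "inv f" b w] G ft(3) by (simp add: m_assoc[symmetric])
      then have "shift (inv f) x S" using ft(2) b(2) by (simp add: visits_def)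
      then show "x \<in> K" unfolding K_def using ft(1) b(2) W_shift[OF G(3) w] by blast
    qed
    moreover have "closedin Y K" using compactin_imp_closedin[OF Hausdorff_Y K] .
    ultimately have "Y closure_of ((\<lambda>g. act g w) ` B) \<subseteq> K" by (rule closure_of_minimal)
    then show "compactin Y (Y closure_of ((\<lambda>g. act g w) ` B))" by (rule closed_compactin[OF K _ closedin_closure_of])
  qed
  then show ?thesis unfolding rel_compact_sets_def sets_below_def by blast
qed

text \<open>A group element that agrees with a fixed point of \<open>g\<close> on the cover and on its translates would lie in a
  member of the cover and in the translate of this member.\<close>
lemma free_act:
  assumes "\<And>g. g \<in> carrier G \<Longrightarrow> g \<noteq> \<one> \<Longrightarrow>
    \<exists>P. finite P \<and> P \<subseteq> \<D> \<and> carrier G \<subseteq> \<Union>P \<and> (\<forall>D\<in>P. D \<inter> (inv g <# D) = {})"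
  shows "free_action G Y act"
  unfolding free_action_def topspace_Y
proof (intro ballI impI, rule ccontr)
  fix g assume g: "g \<in> carrier G" "\<exists>w\<in>W. act g w = w" "g \<noteq> \<one>"
  then obtain w where w: "w \<in> W" "shift g w = w" by (auto simp: act_apply)
  obtain P where P: "finite P" "P \<subseteq> \<D>" "carrier G \<subseteq> \<Union>P" "\<forall>D\<in>P. D \<inter> (inv g <# D) = {}"
    using assms[OF g(1,3)] by (elim exE conjE) (rule that)
  have "finite (P \<union> (\<lambda>D. inv g <# D) ` P)" "P \<union> (\<lambda>D. inv g <# D) ` P \<subseteq> \<D>"
    using P g translate by auto
  moreover have "w \<in> traces" using w W_traces by blast
  ultimately obtain h where h: "h \<in> carrier G" "\<forall>D\<in>P \<union> (\<lambda>D. inv g <# D) ` P. w D \<longleftrightarrow> h \<in> D"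
    using traces_approx by metis
  obtain D where D: "D \<in> P" "h \<in> D" using h(1) P(3) by blast
  have "w (inv g <# D) = shift g w D" using shift_apply[of D g w] D(1) P(2) by auto
  then have "h \<in> inv g <# D" using h(2) D w(2) by auto
  then show False using D P(4) by blast
qed

text \<open>The level sets of \<open>f\<close> are coordinates, so \<open>f\<close> extends to all of \<open>W\<close> as a locally constant map.  The
  inequality for \<open>w\<close> and its shift involves finitely many coordinates, on which \<open>w\<close> is a group element.\<close>
lemma amenable_act:
  assumes "\<And>F \<epsilon>. finite F \<Longrightarrow> F \<subseteq> carrier G \<Longrightarrow> \<epsilon> > 0 \<Longrightarrow>
    \<exists>Q f. almost_equivariant F \<epsilon> Q f \<and> (\<forall>v\<in>f ` carrier G. {t \<in> carrier G. f t = v} \<in> \<D>)"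
  shows "amenable_action G Y act"
  unfolding amenable_action_def topspace_Y
proof (intro allI impI)
  fix K F and \<epsilon> :: real assume H: "compactin Y K \<and> finite F \<and> F \<subseteq> carrier G \<and> \<epsilon> > 0"
  then have H': "finite F" "F \<subseteq> carrier G" "\<epsilon> > 0" by auto
  obtain Q f where Q: "finite Q" "Q \<subseteq> carrier G" and fin: "finite (f ` carrier G)"
    and lev: "\<forall>v\<in>f ` carrier G. {t \<in> carrier G. f t = v} \<in> \<D>"
    and f: "\<forall>t\<in>carrier G. (\<forall>q. f t q \<ge> (0::real)) \<and> (\<forall>q. q \<notin> Q \<longrightarrow> f t q = 0) \<and> sum (f t) Q = 1"
    and inv: "\<forall>g\<in>F. \<forall>t\<in>carrier G. (\<Sum>\<^sub>\<infinity>h\<in>carrier G. \<bar>f t (inv g \<otimes> h) - f (g \<otimes> t) h\<bar>) < \<epsilon>"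
    using assms[OF H'] unfolding almost_equivariant_def by (elim exE conjE) (rule that)
  define L where "L v = {t \<in> carrier G. f t = v}" for v
  have L: "L v \<in> \<D>" if "v \<in> f ` carrier G" for v using lev that unfolding L_def by blast
  define m where "m w = (THE v. v \<in> f ` carrier G \<and> w (L v))" for w
  have m_eq: "m w = f h" if h: "h \<in> carrier G" "\<forall>v\<in>f ` carrier G. w (L v) \<longleftrightarrow> h \<in> L v" for w h
    unfolding m_def by (rule the_equality) (use h in \<open>auto simp: L_def\<close>)
  have pair: "\<exists>h\<in>carrier G. m w = f h \<and> m (shift g w) = f (g \<otimes> h) \<and> (\<forall>v\<in>f ` carrier G. w (L v) \<longleftrightarrow> f h = v)"
    if w: "w \<in> W" and g: "g \<in> carrier G" for w g
  proof -
    let ?E = "L ` f ` carrier G \<union> (\<lambda>v. inv g <# L v) ` f ` carrier G"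
    have "finite ?E" "?E \<subseteq> \<D>" using fin L g translate by auto
    moreover have "w \<in> traces" using w W_traces by blast
    ultimately obtain h where h: "h \<in> carrier G" "\<forall>D\<in>?E. w D \<longleftrightarrow> h \<in> D"
      using traces_approx by metis
    have "m w = f h" by (rule m_eq) (use h in auto)
    moreover have "m (shift g w) = f (g \<otimes> h)"
    proof (rule m_eq)
      show "g \<otimes> h \<in> carrier G" using g h by simp
      show "\<forall>v\<in>f ` carrier G. shift g w (L v) \<longleftrightarrow> g \<otimes> h \<in> L v"
      proof
        fix v assume v: "v \<in> f ` carrier G"
        then have "shift g w (L v) \<longleftrightarrow> h \<in> inv g <# L v" using shift_apply[OF L[OF v]] h(2) by simp
        then show "shift g w (L v) \<longleftrightarrow> g \<otimes> h \<in> L v"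
          using mem_translate_iff[of "L v" g h] g h(1) by (auto simp: L_def)
      qed
    qed
    moreover have "\<forall>v\<in>f ` carrier G. w (L v) \<longleftrightarrow> f h = v" using h by (auto simp: L_def)
    ultimately show ?thesis using h(1) by blast
  qed
  show "\<exists>m. (\<forall>x\<in>W. (\<forall>h\<in>carrier G. (0::real) \<le> m x h) \<and> (m x has_sum 1) (carrier G)) \<and>
      (\<forall>h\<in>carrier G. continuous_map Y euclideanreal (\<lambda>x. m x h)) \<and>
      (\<forall>x\<in>K. \<forall>g\<in>F. (\<Sum>\<^sub>\<infinity>h\<in>carrier G. \<bar>m x (inv g \<otimes> h) - m (act g x) h\<bar>) < \<epsilon>)"
  proof (intro exI[of _ m] conjI ballI)
    fix w q assume w: "w \<in> W" and "q \<in> carrier G"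
    from pair[OF w one_closed] f show "0 \<le> m w q" by force
  next
    fix w assume w: "w \<in> W"
    from pair[OF w one_closed] obtain t where t: "t \<in> carrier G" "m w = f t" by blast
    have "(f t has_sum sum (f t) Q) Q" using Q by simp
    then have "(f t has_sum sum (f t) Q) (carrier G)"
      by (rule has_sum_cong_neutral[THEN iffD1, rotated -1]) (use f t Q in auto)
    then show "(m w has_sum 1) (carrier G)" using f t by simp
  next
    fix q assume q: "q \<in> carrier G"
    show "continuous_map Y euclideanreal (\<lambda>x. m x q)"
      unfolding continuous_map_def topspace_Y
    proof (intro conjI allI impI)
      fix U :: "real set"
      have "{w \<in> W. m w q \<in> U} = (\<Union>v\<in>{v \<in> f ` carrier G. v q \<in> U}. {w \<in> W. w (L v) = True})"
        using pair[OF _ one_closed] by fastforce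
      moreover have "openin Y (\<Union>v\<in>{v \<in> f ` carrier G. v q \<in> U}. {w \<in> W. w (L v) = True})"
        by (rule openin_Union) (use L openin_Y_coordinate in blast)
      ultimately show "openin Y {w \<in> W. m w q \<in> U}" by simp
    qed simp
  next
    fix w g assume w: "w \<in> K" and g: "g \<in> F"
    have wW: "w \<in> W" using w H compactin_subset_topspace topspace_Y by blast
    have gG: "g \<in> carrier G" using g H by blast
    from pair[OF wW gG] obtain t where "t \<in> carrier G" "m w = f t" "m (shift g w) = f (g \<otimes> t)" by blast
    then show "(\<Sum>\<^sub>\<infinity>h\<in>carrier G. \<bar>m w (inv g \<otimes> h) - m (act g w) h\<bar>) < \<epsilon>"
      using inv g by (simp add: act_apply[OF wW])
  qed
qed

text \<open>In a compact system every subset of \<open>G\<close> would be below the return times.  An isolated point would lie on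
  every orbit, by minimality, and the system would be discrete; the compact set that belongs to \<open>S\<close>
  would be finite and, as the action is free, so would be its return times.\<close>
lemma noncompact_cantor_Y:
  assumes D: "countable \<D>" and free: "free_action G Y act" and min: "minimal_action G Y act"
    and w: "w \<in> W" and big: "\<not> propto G (carrier G) (visits w)" and inf: "infinite (visits w)"
  shows "noncompact_cantor_space Y"
proof -
  have dense: "Y closure_of orbit G act x = W" if "x \<in> W" for x
    using min that unfolding minimal_action_def topspace_Y by blast
  have "\<not> compact_space Y"
  proof
    assume c: "compact_space Y"
    have "compactin Y (Y closure_of ((\<lambda>g. act g w) ` carrier G))"
      by (rule closedin_compact_space[OF c closedin_closure_of])
    then have "carrier G \<in> rel_compact_sets G Y act w" unfolding rel_compact_sets_def by simp
    then show False using big unfolding rel_compact_sets_Y[OF w] sets_below_def by simp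
  qed
  moreover have "\<forall>A. connectedin Y A \<longrightarrow> (\<exists>a. A \<subseteq> {a})"
  proof (intro allI impI, rule ccontr)
    fix A assume A: "connectedin Y A" "\<not> (\<exists>a. A \<subseteq> {a})"
    have AW: "A \<subseteq> W" using connectedin_subset_topspace[OF A(1)] topspace_Y by simp
    from A(2) obtain x y where xy: "x \<in> A" "y \<in> A" "x \<noteq> y" by blast
    then obtain E where E: "x E \<noteq> y E" by blast
    have "x \<in> extensional \<D>" "y \<in> extensional \<D>" using xy AW W_extensional by auto
    then have "E \<in> \<D>" using E extensional_arb by metis
    then have "openin Y {w \<in> W. w E = True}" "openin Y {w \<in> W. w E = False}" by (rule openin_Y_coordinate)+
    moreover have "A \<subseteq> {w \<in> W. w E = True} \<union> {w \<in> W. w E = False}" using AW by auto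
    moreover have "A \<inter> {w \<in> W. w E = True} \<noteq> {}" "A \<inter> {w \<in> W. w E = False} \<noteq> {}" using xy E AW by auto
    moreover have "{w \<in> W. w E = True} \<inter> {w \<in> W. w E = False} \<inter> A = {}" by auto
    ultimately show False using A(1) unfolding connectedin by blast
  qed
  moreover have "\<forall>x\<in>topspace Y. \<not> openin Y {x}"
  proof (intro ballI notI)
    fix x assume x: "x \<in> topspace Y" "openin Y {x}"
    have hits: "\<exists>g\<in>carrier G. shift g y = x" if y: "y \<in> W" for y
    proof -
      have "x \<in> Y closure_of orbit G act y" using dense[OF y] x topspace_Y by simp
      then show ?thesis using x(2) unfolding in_closure_of orbit_act[OF y] by auto
    qed
    \<comment> \<open>by minimality every orbit contains the isolated point, hence consists of isolated points\<close>
    have single: "openin Y {y}" if y: "y \<in> W" for y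
    proof -
      obtain g where g: "g \<in> carrier G" "shift g y = x" using hits[OF y] by blast
      have "openin Y {z \<in> topspace Y. shift g z \<in> {x}}"
        using shift_continuous_Y[OF g(1)] x(2) unfolding continuous_map_def by blast
      moreover have "{z \<in> topspace Y. shift g z \<in> {x}} = {y}"
        using g y shift_inv(2)[OF g(1)] topspace_Y by (auto, metis)
      ultimately show ?thesis by simp
    qed
    let ?C = "{w \<in> W. w S}"
    have cov: "\<And>U. U \<in> (\<lambda>y. {y}) ` ?C \<Longrightarrow> openin Y U" "?C \<subseteq> \<Union>((\<lambda>y. {y}) ` ?C)"
      using single by auto
    from compactinD[OF compactin_Y cov] obtain \<F> where F: "finite \<F>" "\<F> \<subseteq> (\<lambda>y. {y}) ` ?C" "?C \<subseteq> \<Union>\<F>" by blast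
    have "finite (\<Union>\<F>)" using F by (intro finite_Union) auto
    then have "finite ?C" using F(3) finite_subset by blast
    moreover have "(\<lambda>g. shift g w) ` visits w \<subseteq> ?C"
      unfolding visits_def using W_shift w by auto
    ultimately have "finite ((\<lambda>g. shift g w) ` visits w)" by (rule rev_finite_subset)
    moreover have "inj_on (\<lambda>g. shift g w) (visits w)"
    proof (rule inj_onI)
      fix g h assume gh: "g \<in> visits w" "h \<in> visits w" "shift g w = shift h w"
      then have G: "g \<in> carrier G" "h \<in> carrier G" by (auto simp: visits_def)
      have "act (inv h \<otimes> g) w = w"
        using gh(3) G shift_inv(2)[OF G(2) w] by (simp add: act_apply[OF w] shift_mult)
      then have "inv h \<otimes> g = \<one>" using free G w unfolding free_action_def topspace_Y by blast
      then show "g = h" using G by (metis inv_equality inv_inv inv_closed)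
    qed
    ultimately show False using inf finite_imageD by blast
  qed
  moreover have "second_countable Y" unfolding Y_def
    by (intro second_countable_subtopology second_countable_bit_cube D)
  ultimately show ?thesis
    unfolding noncompact_cantor_space_def topspace_Y using W_nonempty locally_compact_Y Hausdorff_Y by blast
qed

end

section \<open>Covers by displaced sets\<close>

context group begin

text \<open>Take a maximal set that is disjoint from its translate by \<open>g\<close>: a point outside this set and its
  translates by \<open>g\<close> and \<open>inv g\<close> could be added to it.\<close>
lemma displaced_cover:
  assumes g: "g \<in> carrier G" "g \<noteq> \<one>"
  shows "\<exists>D. D \<subseteq> carrier G \<and> (\<forall>h\<in>D. g \<otimes> h \<notin> D) \<and> (\<forall>h\<in>carrier G. h \<in> D \<or> g \<otimes> h \<in> D \<or> inv g \<otimes> h \<in> D)"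
proof -
  define \<A> where "\<A> = {D. D \<subseteq> carrier G \<and> (\<forall>h\<in>D. g \<otimes> h \<notin> D)}"
  have "\<exists>M\<in>\<A>. \<forall>D\<in>\<A>. M \<subseteq> D \<longrightarrow> D = M"
  proof (rule subset_Zorn_nonempty)
    show "\<A> \<noteq> {}" unfolding \<A>_def by blast
    fix \<C> assume C: "\<C> \<noteq> {}" "subset.chain \<A> \<C>"
    then have sub: "\<And>D. D \<in> \<C> \<Longrightarrow> D \<in> \<A>" and cmp: "\<And>D E. D \<in> \<C> \<Longrightarrow> E \<in> \<C> \<Longrightarrow> D \<subseteq> E \<or> E \<subseteq> D"
      by (auto simp: subset_chain_def)
    have "g \<otimes> h \<notin> \<Union>\<C>" if hC: "h \<in> \<Union>\<C>" for h
    proof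
      assume "g \<otimes> h \<in> \<Union>\<C>"
      then obtain D E where DE: "D \<in> \<C>" "E \<in> \<C>" "h \<in> D" "g \<otimes> h \<in> E" using hC by blast
      then obtain F where "F \<in> \<C>" "h \<in> F" "g \<otimes> h \<in> F" using cmp by blast
      then show False using sub unfolding \<A>_def by blast
    qed
    moreover have "\<Union>\<C> \<subseteq> carrier G" using sub unfolding \<A>_def by blast
    ultimately show "\<Union>\<C> \<in> \<A>" unfolding \<A>_def by blast
  qed
  then obtain M where MA: "M \<in> \<A>" and max: "\<And>D. D \<in> \<A> \<Longrightarrow> M \<subseteq> D \<Longrightarrow> D = M"
    by blast
  have M: "M \<subseteq> carrier G" "\<forall>h\<in>M. g \<otimes> h \<notin> M" using MA unfolding \<A>_def by blast+
  have "h \<in> M \<or> g \<otimes> h \<in> M \<or> inv g \<otimes> h \<in> M" if h: "h \<in> carrier G" for h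
  proof (rule ccontr)
    assume n: "\<not> ?thesis"
    have "g \<otimes> x \<notin> insert h M" if x: "x \<in> insert h M" for x
    proof (cases "x = h")
      case True
      have "g \<otimes> h \<noteq> h" using g h by simp
      then show ?thesis using True n by simp
    next
      case False
      then have xM: "x \<in> M" using x by simp
      then have "x = inv g \<otimes> (g \<otimes> x)" using M(1) g by (simp add: m_assoc[symmetric] subset_iff)
      then have "g \<otimes> x \<noteq> h" using n xM by metis
      then show ?thesis using M(2) xM by simp
    qed
    then have "insert h M \<in> \<A>" unfolding \<A>_def using M(1) h by simp
    from max[OF this] n show False by blast
  qed
  then show ?thesis using M by blast
qed

end

section \<open>Minimal symbolic extensions\<close>

text \<open>Zorn's lemma, applied to the complements in \<open>Z\<^sub>0\<close>.  The intersection of a chain is not empty because all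
  its members meet the compact set \<open>K\<close>.\<close>
lemma minimal_closed_set:
  fixes P :: "'p topology"
  assumes Z0: "closedin P Z\<^sub>0" "Z\<^sub>0 \<noteq> {}" "\<And>d. d \<in> \<Delta> \<Longrightarrow> d ` Z\<^sub>0 \<subseteq> Z\<^sub>0"
    and K: "compactin P K" "closedin P K"
    and meet: "\<And>Z. closedin P Z \<Longrightarrow> Z \<noteq> {} \<Longrightarrow> Z \<subseteq> Z\<^sub>0 \<Longrightarrow> (\<And>d. d \<in> \<Delta> \<Longrightarrow> d ` Z \<subseteq> Z) \<Longrightarrow> Z \<inter> K \<noteq> {}"
  obtains Z where "closedin P Z" "Z \<noteq> {}" "Z \<subseteq> Z\<^sub>0" "\<And>d. d \<in> \<Delta> \<Longrightarrow> d ` Z \<subseteq> Z"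
    "\<And>Z'. closedin P Z' \<Longrightarrow> Z' \<noteq> {} \<Longrightarrow> Z' \<subseteq> Z \<Longrightarrow> (\<And>d. d \<in> \<Delta> \<Longrightarrow> d ` Z' \<subseteq> Z') \<Longrightarrow> Z' = Z"
proof -
  define \<Z> where "\<Z> = {Z. closedin P Z \<and> Z \<noteq> {} \<and> Z \<subseteq> Z\<^sub>0 \<and> (\<forall>d\<in>\<Delta>. d ` Z \<subseteq> Z)}"
  define \<O> where "\<O> = (\<lambda>Z. Z\<^sub>0 - Z) ` \<Z>"
  have Z0Z: "Z\<^sub>0 \<in> \<Z>" unfolding \<Z>_def using Z0 by blast
  have twice: "Z\<^sub>0 - (Z\<^sub>0 - Z) = Z" if "Z \<in> \<Z>" for Z using that unfolding \<Z>_def by blast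
  have "\<exists>M\<in>\<O>. \<forall>U\<in>\<O>. M \<subseteq> U \<longrightarrow> U = M"
  proof (rule subset_Zorn_nonempty)
    show "\<O> \<noteq> {}" unfolding \<O>_def using Z0Z by blast
    fix \<C> assume C: "\<C> \<noteq> {}" "subset.chain \<O> \<C>"
    have sub: "Z\<^sub>0 - U \<in> \<Z>" if "U \<in> \<C>" for U
    proof -
      have "U \<in> \<O>" using C(2) that by (auto simp: subset_chain_def)
      then obtain Z where "Z \<in> \<Z>" "U = Z\<^sub>0 - Z" unfolding \<O>_def by blast
      then show ?thesis using twice by simp
    qed
    have cmp: "\<And>U V. U \<in> \<C> \<Longrightarrow> V \<in> \<C> \<Longrightarrow> U \<subseteq> V \<or> V \<subseteq> U" using C(2) by (auto simp: subset_chain_def)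
    define Z where "Z = Z\<^sub>0 - \<Union>\<C>"
    have Zeq: "Z = (\<Inter>U\<in>\<C>. Z\<^sub>0 - U)" unfolding Z_def using C(1) by blast
    have "closedin P Z" unfolding Zeq by (rule closedin_INT) (use C(1) sub in \<open>auto simp: \<Z>_def\<close>)
    moreover have "Z \<noteq> {}"
    proof -
      define \<U> where "\<U> = (\<lambda>U. Z\<^sub>0 - U) ` \<C>"
      have "K \<inter> \<Inter>\<U> \<noteq> {}"
      proof (rule K(1)[unfolded compactin_fip, THEN conjunct2, rule_format], intro conjI ballI allI impI)
        show "closedin P A" if "A \<in> \<U>" for A using that sub unfolding \<U>_def \<Z>_def by blast
        fix \<F> assume F: "finite \<F> \<and> \<F> \<subseteq> \<U>"
        show "K \<inter> \<Inter>\<F> \<noteq> {}"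
        proof (cases "\<F> = {}")
          case True
          have "Z\<^sub>0 \<inter> K \<noteq> {}" by (rule meet) (use Z0 in auto)
          then show ?thesis using True by blast
        next
          case False
          have "\<exists>A\<in>\<F>. \<forall>B\<in>\<F>. A \<subseteq> B"
          proof -
            have "\<Inter>\<F> \<in> \<F>"
            proof (rule Finite_Set.finite_subset_induct'[of \<F> \<F> "\<lambda>\<E>. \<E> \<noteq> {} \<longrightarrow> \<Inter>\<E> \<in> \<E>", THEN mp])
              fix A \<E> assume AE: "A \<in> \<F>" "\<E> \<subseteq> \<F>" "\<E> \<noteq> {} \<longrightarrow> \<Inter>\<E> \<in> \<E>"
              show "insert A \<E> \<noteq> {} \<longrightarrow> \<Inter>(insert A \<E>) \<in> insert A \<E>"
              proof (cases "\<E> = {}")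
                case False
                then have "\<Inter>\<E> \<in> \<U>" "A \<in> \<U>" using AE F by auto
                then have "A \<subseteq> \<Inter>\<E> \<or> \<Inter>\<E> \<subseteq> A" using cmp unfolding \<U>_def by blast
                then have "A \<inter> \<Inter>\<E> = A \<or> A \<inter> \<Inter>\<E> = \<Inter>\<E>" by blast
                then show ?thesis using AE(3) False by auto
              qed simp
            qed (use F False in auto)
            then show ?thesis by blast
          qed
          then obtain A where A: "A \<in> \<F>" "\<And>B. B \<in> \<F> \<Longrightarrow> A \<subseteq> B" by blast
          have "A \<in> \<Z>" using A(1) F sub unfolding \<U>_def by blast
          then have "A \<inter> K \<noteq> {}" using meet[of A] unfolding \<Z>_def by blast
          moreover have "A \<subseteq> \<Inter>\<F>" using A(2) by blast
          ultimately show ?thesis by blast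
        qed
      qed
      moreover have "\<Inter>\<U> = Z" unfolding Zeq \<U>_def by blast
      ultimately show ?thesis by blast
    qed
    moreover have "d ` Z \<subseteq> Z" if d: "d \<in> \<Delta>" for d
    proof -
      have inv: "d z \<in> Z\<^sub>0 - U" if U: "U \<in> \<C>" and z: "z \<in> Z\<^sub>0 - U" for U z
      proof -
        have "d ` (Z\<^sub>0 - U) \<subseteq> Z\<^sub>0 - U" using sub[OF U] d by (simp add: \<Z>_def)
        then show ?thesis using z by blast
      qed
      show ?thesis
      proof (rule image_subsetI)
        fix z assume "z \<in> Z"
        then show "d z \<in> Z" unfolding Zeq using inv by blast
      qed
    qed
    ultimately have "Z \<in> \<Z>" unfolding \<Z>_def Z_def by blast
    moreover have "\<Union>\<C> = Z\<^sub>0 - Z"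
    proof -
      have "\<Union>\<C> \<subseteq> Z\<^sub>0" using C(2) unfolding subset_chain_def \<O>_def by blast
      then show ?thesis unfolding Z_def by blast
    qed
    ultimately show "\<Union>\<C> \<in> \<O>" unfolding \<O>_def by blast
  qed
  then obtain M where M: "M \<in> \<O>" "\<And>U. U \<in> \<O> \<Longrightarrow> M \<subseteq> U \<Longrightarrow> U = M" by blast
  then obtain Z where Z: "Z \<in> \<Z>" "M = Z\<^sub>0 - Z" unfolding \<O>_def by blast
  show thesis
  proof (rule that)
    show "closedin P Z" "Z \<noteq> {}" "Z \<subseteq> Z\<^sub>0" using Z(1) unfolding \<Z>_def by blast+
    show "d \<in> \<Delta> \<Longrightarrow> d ` Z \<subseteq> Z" for d using Z(1) unfolding \<Z>_def by blast
    fix Z' assume Z': "closedin P Z'" "Z' \<noteq> {}" "Z' \<subseteq> Z" "\<And>d. d \<in> \<Delta> \<Longrightarrow> d ` Z' \<subseteq> Z'"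
    have Z'Z: "Z' \<in> \<Z>" unfolding \<Z>_def using Z' \<open>Z \<subseteq> Z\<^sub>0\<close> by blast
    then have "Z\<^sub>0 - Z' = M" using M(2)[of "Z\<^sub>0 - Z'"] Z'(3) unfolding \<O>_def Z(2) by blast
    then have "Z\<^sub>0 - (Z\<^sub>0 - Z') = Z\<^sub>0 - (Z\<^sub>0 - Z)" unfolding Z(2) by (rule arg_cong)
    then show "Z' = Z" unfolding twice[OF Z'Z] twice[OF Z(1)] .
  qed
qed

context symbolic begin

text \<open>The minimal set is found in the product of \<open>X\<close> and the cube, where the sets that are closed and invariant
  meet a fixed compact set; it is then projected to the cube.  The two implications of the conclusion,
  for the open set \<open>U\<close> and the compact set \<open>K\<close>, hold at all marks and pass to the limit, since \<open>K\<close> is closed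
  and \<open>U\<close> is open.\<close>
lemma minimal_extension:
  fixes X :: "'x topology"
  assumes X: "lc_G_space G X a" "minimal_action G X a" "x\<^sub>0 \<in> topspace X"
    and U: "openin X U" "x\<^sub>0 \<in> U" and K: "compactin X K" "U \<subseteq> K"
    and S_def: "S = {g \<in> carrier G. a g x\<^sub>0 \<in> K}" and SD: "S \<in> \<D>"
  shows "\<exists>W w. symbolic_system G \<D> W S \<and> w \<in> W \<and>
     minimal_action G (symbolic_system.Y \<D> W) (symbolic_system.act G \<D> W) \<and>
     (\<forall>g\<in>carrier G. (a g x\<^sub>0 \<in> U \<longrightarrow> shift g w S) \<and> (shift g w S \<longrightarrow> a g x\<^sub>0 \<in> K))"
proof -
  note aX = lc_G_spaceD[OF X(1)]
  define On Off where "On = {w \<in> extensional \<D>. w S = True}" and "Off = {w \<in> extensional \<D>. w S = False}"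
  have On: "closedin (bit_cube \<D>) On" and Off: "closedin (bit_cube \<D>) Off"
    unfolding On_def Off_def using closedin_coordinate[OF SD] by blast+
  define P where "P = prod_topology X (bit_cube \<D>)"
  define d where "d g = (\<lambda>(x, w). (a g x, shift g w))" for g
  have cd: "continuous_map P P (d g)" if g: "g \<in> carrier G" for g
  proof -
    have "continuous_map P X (\<lambda>z. a g (fst z))"
      unfolding P_def using continuous_map_compose[OF continuous_map_fst aX(4)[OF g]] by (simp add: o_def)
    moreover have "continuous_map P (bit_cube \<D>) (\<lambda>z. shift g (snd z))"
      unfolding P_def using continuous_map_compose[OF continuous_map_snd shift_continuous[OF g]] by (simp add: o_def)
    ultimately have "continuous_map P (prod_topology X (bit_cube \<D>)) (\<lambda>z. (a g (fst z), shift g (snd z)))"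
      by (rule continuous_map_pairedI)
    then show ?thesis unfolding P_def d_def by (simp add: case_prod_unfold)
  qed
  define O0 where "O0 = (\<lambda>g. (a g x\<^sub>0, mark g)) ` carrier G"
  define Z0 where "Z0 = P closure_of O0"
  have topP: "topspace P = topspace X \<times> extensional \<D>" unfolding P_def by (simp add: topspace_bit_cube)
  have O0P: "O0 \<subseteq> topspace P" unfolding O0_def topP using aX(5) X(3) by (auto simp: mark_def)
  have Z0P: "Z0 \<subseteq> topspace P" unfolding Z0_def by (rule closure_of_subset_topspace)
  have Z0_closed: "closedin P Z0" unfolding Z0_def by (rule closedin_closure_of)
  have O0Z0: "O0 \<subseteq> Z0" unfolding Z0_def by (rule closure_of_subset[OF O0P])
  have Z0_ne: "Z0 \<noteq> {}" using O0Z0 unfolding O0_def using one_closed by blast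
  have Z0_inv: "d g ` Z0 \<subseteq> Z0" if g: "g \<in> carrier G" for g
  proof -
    have "d g ` O0 \<subseteq> O0"
      unfolding O0_def d_def using g aX(7)[OF g _ X(3)] shift_mark[OF g]
      by (force intro: image_eqI[where x = "g \<otimes> _"])
    then have "P closure_of (d g ` O0) \<subseteq> Z0" unfolding Z0_def by (rule closure_of_mono)
    then show ?thesis using continuous_map_image_closure_subset[OF cd[OF g], of O0] unfolding Z0_def by blast
  qed
  have in_Z0: "z \<in> C" if "z \<in> Z0" "closedin P C" "O0 \<subseteq> C" for z C
    using closure_of_minimal[OF that(3,2)] that(1) unfolding Z0_def by blast
  have Kc: "closedin X K" using compactin_imp_closedin[OF aX(2) K(1)] .
  have traces: "snd z \<in> traces" if z: "z \<in> Z0" for z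
  proof -
    have "closedin P (topspace X \<times> traces)"
      unfolding P_def closedin_prod_Times_iff using closedin_traces by simp
    moreover have "O0 \<subseteq> topspace X \<times> traces" unfolding O0_def using aX(5) X(3) mark_in_traces by auto
    ultimately have "z \<in> topspace X \<times> traces" by (rule in_Z0[OF z])
    then show ?thesis by auto
  qed
  have in_K: "fst z \<in> K" if z: "z \<in> Z0" and s: "snd z S" for z
  proof -
    have "closedin P (K \<times> extensional \<D> \<union> topspace X \<times> Off)"
      unfolding P_def using Kc Off
      by (intro closedin_Un) (simp_all add: closedin_prod_Times_iff topspace_bit_cube[symmetric])
    moreover have "O0 \<subseteq> K \<times> extensional \<D> \<union> topspace X \<times> Off"
      unfolding O0_def using aX(5) X(3) SD by (auto simp: mark_def S_def Off_def)
    ultimately have "z \<in> K \<times> extensional \<D> \<union> topspace X \<times> Off" by (rule in_Z0[OF z])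
    then show ?thesis using s by (auto simp: Off_def)
  qed
  have from_U: "snd z S" if z: "z \<in> Z0" and u: "fst z \<in> U" for z
  proof -
    have "closedin P ((topspace X - U) \<times> extensional \<D> \<union> topspace X \<times> On)"
      unfolding P_def using U(1) On
      by (intro closedin_Un) (simp_all add: closedin_prod_Times_iff topspace_bit_cube[symmetric] closedin_diff)
    moreover have "O0 \<subseteq> (topspace X - U) \<times> extensional \<D> \<union> topspace X \<times> On"
      unfolding O0_def using aX(5) X(3) SD K(2) by (auto simp: mark_def S_def On_def)
    ultimately have "z \<in> (topspace X - U) \<times> extensional \<D> \<union> topspace X \<times> On" by (rule in_Z0[OF z])
    then show ?thesis using u by (auto simp: On_def)
  qed
  have hitU: "\<exists>g\<in>carrier G. a g x \<in> U" if x: "x \<in> topspace X" for x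
  proof -
    have "x\<^sub>0 \<in> X closure_of orbit G a x" using X x unfolding minimal_action_def by blast
    then show ?thesis using U unfolding in_closure_of orbit_def by blast
  qed
  have KP: "compactin P (K \<times> extensional \<D>)"
    unfolding P_def compactin_Times using K(1) compact_bit_cube[of \<D>] by (simp add: compact_space_def topspace_bit_cube)
  have KPc: "closedin P (K \<times> extensional \<D>)"
    unfolding P_def closedin_prod_Times_iff using Kc by (simp add: topspace_bit_cube[symmetric])
  obtain Z where Z: "closedin P Z" "Z \<noteq> {}" "Z \<subseteq> Z0" "\<And>\<delta>. \<delta> \<in> d ` carrier G \<Longrightarrow> \<delta> ` Z \<subseteq> Z"
    and Zmin: "\<And>Z'. closedin P Z' \<Longrightarrow> Z' \<noteq> {} \<Longrightarrow> Z' \<subseteq> Z \<Longrightarrow> (\<And>\<delta>. \<delta> \<in> d ` carrier G \<Longrightarrow> \<delta> ` Z' \<subseteq> Z') \<Longrightarrow> Z' = Z"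
  proof (rule minimal_closed_set[of P Z0 "d ` carrier G" "K \<times> extensional \<D>", OF Z0_closed Z0_ne _ KP KPc])
    show "\<delta> ` Z0 \<subseteq> Z0" if "\<delta> \<in> d ` carrier G" for \<delta> using that Z0_inv by blast
    fix Z' assume Z': "closedin P Z'" "Z' \<noteq> {}" "Z' \<subseteq> Z0" "\<And>\<delta>. \<delta> \<in> d ` carrier G \<Longrightarrow> \<delta> ` Z' \<subseteq> Z'"
    obtain x w where xw: "(x, w) \<in> Z'" using Z'(2) by auto
    then have "(x, w) \<in> topspace P" using Z'(3) Z0P by blast
    then have "x \<in> topspace X" unfolding topP by blast
    then obtain g where g: "g \<in> carrier G" "a g x \<in> U" using hitU by blast
    have "d g (x, w) \<in> Z'" using Z'(4)[OF imageI[OF g(1)]] xw by blast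
    then have "(a g x, shift g w) \<in> Z'" unfolding d_def by simp
    moreover have "(a g x, shift g w) \<in> K \<times> extensional \<D>" using g K(2) shift_extensional by blast
    ultimately show "Z' \<inter> (K \<times> extensional \<D>) \<noteq> {}" by blast
  qed blast
  have ZP: "Z \<subseteq> topspace P" using Z(3) Z0P by blast
  have Zd: "(a g x, shift g w) \<in> Z" if "(x, w) \<in> Z" "g \<in> carrier G" for x w g
    using Z(4)[OF imageI[OF that(2)]] that(1) unfolding d_def by force
  define W where "W = snd ` Z"
  have coords: "x \<in> topspace X" "w \<in> extensional \<D>" if "(x, w) \<in> Z" for x w
    using that ZP unfolding topP by auto
  have sys: "symbolic_system G \<D> W S"
  proof unfold_locales
    show "W \<subseteq> traces" unfolding W_def using traces Z(3) by blast
    show "shift g w \<in> W" if gw: "g \<in> carrier G" "w \<in> W" for g w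
    proof -
      obtain x where "(x, w) \<in> Z" using gw(2) unfolding W_def by auto
      from Zd[OF this gw(1)] show ?thesis unfolding W_def by (force intro: image_eqI)
    qed
    show "W \<noteq> {}" unfolding W_def using Z(2) by blast
    show "S \<in> \<D>" by (rule SD)
    have "{w \<in> W. w S} = snd ` (Z \<inter> (K \<times> extensional \<D> \<inter> topspace X \<times> On))"
    proof (intro equalityI subsetI)
      fix w assume w: "w \<in> {w \<in> W. w S}"
      then obtain x where xw: "(x, w) \<in> Z" unfolding W_def by auto
      have "x \<in> K" using in_K[OF subsetD[OF Z(3) xw]] w by simp
      then have "(x, w) \<in> Z \<inter> (K \<times> extensional \<D> \<inter> topspace X \<times> On)"
        using xw w coords[OF xw] by (simp add: On_def)
      then show "w \<in> snd ` (Z \<inter> (K \<times> extensional \<D> \<inter> topspace X \<times> On))"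
        by (rule image_eqI[rotated]) simp
    next
      fix w assume "w \<in> snd ` (Z \<inter> (K \<times> extensional \<D> \<inter> topspace X \<times> On))"
      then show "w \<in> {w \<in> W. w S}" unfolding W_def On_def by auto
    qed
    moreover have "compactin P (Z \<inter> (K \<times> extensional \<D> \<inter> topspace X \<times> On))"
    proof (rule closed_compactin[OF KP])
      have "closedin P (topspace X \<times> On)"
        unfolding P_def closedin_prod_Times_iff using On by simp
      then show "closedin P (Z \<inter> (K \<times> extensional \<D> \<inter> topspace X \<times> On))"
        by (intro closedin_Int Z(1) KPc)
    qed blast
    ultimately show "compactin (bit_cube \<D>) {w \<in> W. w S}"
      using image_compactin[of P _ "bit_cube \<D>" snd] continuous_map_snd[of X "bit_cube \<D>"] unfolding P_def by simp
    show "\<exists>g\<in>carrier G. shift g w S" if w: "w \<in> W" for w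
    proof -
      obtain x where xw: "(x, w) \<in> Z" using w unfolding W_def by auto
      obtain g where g: "g \<in> carrier G" "a g x \<in> U" using hitU coords(1)[OF xw] by blast
      have "(a g x, shift g w) \<in> Z0" using Zd[OF xw g(1)] Z(3) by blast
      from from_U[OF this] g show ?thesis by auto
    qed
  qed
  interpret symbolic_system G \<D> W S by (rule sys)
  \<comment> \<open>the closure of an orbit in \<open>Z\<close> is again closed and invariant\<close>
  have dense: "P closure_of ((\<lambda>g. (a g x, shift g w)) ` carrier G) = Z" if xw: "(x, w) \<in> Z" for x w
  proof (rule Zmin)
    let ?Q = "(\<lambda>g. (a g x, shift g w)) ` carrier G"
    have xX: "x \<in> topspace X" using coords[OF xw] by blast
    have QZ: "?Q \<subseteq> Z" using Zd[OF xw] by blast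
    show "closedin P (P closure_of ?Q)" by (rule closedin_closure_of)
    show "P closure_of ?Q \<noteq> {}" using closure_of_subset[of ?Q P] QZ ZP by auto
    show "P closure_of ?Q \<subseteq> Z" by (rule closure_of_minimal[OF QZ Z(1)])
    fix \<delta> assume "\<delta> \<in> d ` carrier G"
    then obtain k where k: "k \<in> carrier G" "\<delta> = d k" by blast
    have "d k ` ?Q \<subseteq> ?Q"
    proof
      fix z assume "z \<in> d k ` ?Q"
      then obtain g where g: "g \<in> carrier G" "z = d k (a g x, shift g w)" by blast
      then have "z = (a (k \<otimes> g) x, shift (k \<otimes> g) w)"
        unfolding d_def using aX(7)[OF k(1) g(1) xX] shift_mult[OF k(1) g(1)] by simp
      then show "z \<in> ?Q" using k g by blast
    qed
    then have "P closure_of (d k ` ?Q) \<subseteq> P closure_of ?Q" by (rule closure_of_mono)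
    then show "\<delta> ` (P closure_of ?Q) \<subseteq> P closure_of ?Q"
      using continuous_map_image_closure_subset[OF cd[OF k(1)], of ?Q] unfolding k(2) by blast
  qed
  have min: "minimal_action G Y act"
    unfolding minimal_action_def topspace_Y
  proof (intro conjI ballI W_nonempty equalityI)
    fix w assume w: "w \<in> W"
    show "Y closure_of orbit G act w \<subseteq> W" using closure_of_subset_topspace[of Y] topspace_Y by simp
    obtain x where xw: "(x, w) \<in> Z" using w unfolding W_def by auto
    let ?Q = "(\<lambda>g. (a g x, shift g w)) ` carrier G"
    have "snd ` (P closure_of ?Q) \<subseteq> bit_cube \<D> closure_of (snd ` ?Q)"
      unfolding P_def by (rule continuous_map_image_closure_subset[OF continuous_map_snd])
    moreover have "snd ` ?Q = orbit G act w" unfolding orbit_act[OF w] by (simp add: image_image)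
    ultimately have "W \<subseteq> bit_cube \<D> closure_of orbit G act w" unfolding dense[OF xw] W_def by simp
    moreover have "orbit G act w \<subseteq> W" unfolding orbit_act[OF w] using W_shift w by blast
    ultimately show "W \<subseteq> Y closure_of orbit G act w"
      unfolding Y_def closure_of_subtopology by (simp add: Int_absorb1)
  qed
  have "x\<^sub>0 \<in> fst ` Z"
  proof -
    have "closed_map P X fst" unfolding P_def by (rule closed_map_fst[OF compact_bit_cube])
    then have cl: "closedin X (fst ` Z)" using Z(1) unfolding closed_map_def by blast
    obtain x w where xw: "(x, w) \<in> Z" using Z(2) by auto
    have "orbit G a x \<subseteq> fst ` Z" unfolding orbit_def using Zd[OF xw] by force
    then have "X closure_of orbit G a x \<subseteq> fst ` Z" using cl by (rule closure_of_minimal)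
    then show ?thesis using X(2,3) coords(1)[OF xw] unfolding minimal_action_def by blast
  qed
  then obtain w where w: "(x\<^sub>0, w) \<in> Z" by auto
  have wW: "w \<in> W" unfolding W_def using w by force
  have orb: "(a g x\<^sub>0, shift g w) \<in> Z0" if "g \<in> carrier G" for g using Zd[OF w that] Z(3) by blast
  have 1: "\<forall>g\<in>carrier G. a g x\<^sub>0 \<in> U \<longrightarrow> shift g w S" using from_U[OF orb] by auto
  have 2: "\<forall>g\<in>carrier G. shift g w S \<longrightarrow> a g x\<^sub>0 \<in> K" using in_K[OF orb] by auto
  show ?thesis using sys wW min 1 2 by blast
qed

end

section \<open>A sparse recurrent set\<close>

context group begin

lemma translate_avoiding_finite_set:
  assumes "infinite (carrier G)" "finite P" "finite Z" "P \<subseteq> carrier G"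
  shows "\<exists>g\<in>carrier G. \<forall>a\<in>P. a \<otimes> g \<notin> Z"
proof -
  let ?bad = "(\<lambda>(a, z). inv a \<otimes> z) ` (P \<times> Z)"
  have "finite ?bad" using assms by blast
  then obtain g where g: "g \<in> carrier G" "g \<notin> ?bad" using assms(1) by (meson finite_subset subsetI)
  have "a \<otimes> g \<notin> Z" if a: "a \<in> P" for a
  proof
    assume z: "a \<otimes> g \<in> Z"
    have "g = inv a \<otimes> (a \<otimes> g)" using g a assms(4) by (simp add: m_assoc[symmetric] subset_iff)
    then have "g \<in> ?bad" using a z by (intro image_eqI[of _ _ "(a, a \<otimes> g)"]) auto
    then show False using g by blast
  qed
  then show ?thesis using g by blast
qed

text \<open>The set is the union of finite sets \<open>a n\<close> with \<open>a (n + 1) = a n \<union> a n g n\<close>.  If \<open>g n\<close> avoids a finite set, the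
  translate \<open>a n g n\<close> stays away from \<open>V n a n\<close>, for a finite window \<open>V n\<close>.  Every element of \<open>A\<close> is then a
  product \<open>p r\<close> with \<open>p \<in> a n\<close>, where \<open>A\<close> looks from \<open>r\<close> as it looks from the unit, as far as the window
  \<open>V n\<close> reaches.  At the same time a translate \<open>V n h n\<close> of each window is kept free of \<open>A\<close> for ever, and
  these gaps prevent finitely many translates of \<open>A\<close> from covering \<open>G\<close>.\<close>
lemma sparse_recurrent_set:
  assumes cG: "countable (carrier G)" and iG: "infinite (carrier G)"
  shows "\<exists>A. A \<subseteq> carrier G \<and> \<one> \<in> A \<and> infinite A \<and> \<not> propto G (carrier G) A \<and>
    (\<forall>Q. finite Q \<and> Q \<subseteq> carrier G \<longrightarrow> propto G A {r \<in> carrier G. \<forall>q\<in>Q. q \<otimes> r \<in> A \<longleftrightarrow> q \<in> A})"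
proof -
  define e where "e = from_nat_into (carrier G)"
  have e: "range e = carrier G" unfolding e_def by (rule range_from_nat_into) (use cG in auto)
  have eG: "e k \<in> carrier G" for k using e by blast
  define V where "V n = insert \<one> (e ` {..<n} \<union> (\<lambda>k. inv (e k)) ` {..<n})" for n :: nat
  have V: "finite (V n)" "V n \<subseteq> carrier G" "\<one> \<in> V n" "\<And>q. q \<in> V n \<Longrightarrow> inv q \<in> V n" for n
    unfolding V_def using eG by auto
  have VG: "q \<in> V n \<Longrightarrow> q \<in> carrier G" for q n using V(2) by blast
  have Vmono: "V n \<subseteq> V m" if "n \<le> m" for n m unfolding V_def using that by auto
  have Vex: "\<exists>n. Q \<subseteq> V n" if "finite Q" "Q \<subseteq> carrier G" for Q
    using that
  proof (induction Q rule: finite_induct)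
    case (insert q Q)
    then obtain n where "Q \<subseteq> V n" by auto
    moreover obtain k where "q = e k" using e insert.prems by (metis insert_subset rangeE)
    ultimately have "insert q Q \<subseteq> V (max n (Suc k))"
      using Vmono[of n "max n (Suc k)"] unfolding V_def by auto
    then show ?case by blast
  qed simp
  define good where "good n = (\<lambda>(A, B). finite A \<and> A \<subseteq> carrier G \<and> \<one> \<in> A \<and> finite B \<and> B \<subseteq> carrier G \<and> A \<inter> B = {})" for n :: nat
  define step where "step n = (\<lambda>(A, B) (A', B'). \<exists>g\<in>carrier G. \<exists>h\<in>carrier G. A' = A \<union> (\<lambda>a. a \<otimes> g) ` A \<and>
      B' = B \<union> (\<lambda>q. q \<otimes> h) ` V n \<and> (\<forall>a\<in>A. \<forall>q\<in>V n. \<forall>a'\<in>A. a \<otimes> g \<noteq> q \<otimes> a'))" for n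
  have "\<exists>f. \<forall>n. good n (f n) \<and> step n (f n) (f (Suc n))"
  proof (rule dependent_nat_choice)
    show "\<exists>x. good 0 x" by (rule exI[of _ "({\<one>}, {})"]) (simp add: good_def)
    fix x :: "'a set \<times> 'a set" and n :: nat assume "good n x"
    then obtain A B where x: "x = (A, B)" "finite A" "A \<subseteq> carrier G" "\<one> \<in> A" "finite B" "B \<subseteq> carrier G" "A \<inter> B = {}"
      unfolding good_def by (cases x) auto
    obtain h where h: "h \<in> carrier G" "\<forall>q\<in>V n. q \<otimes> h \<notin> A"
      using translate_avoiding_finite_set[OF iG V(1) x(2) V(2)] by blast
    define B' where "B' = B \<union> (\<lambda>q. q \<otimes> h) ` V n"
    have B': "finite B'" "B' \<subseteq> carrier G" "A \<inter> B' = {}" unfolding B'_def using x V(1) VG h by auto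
    have xG: "y \<in> carrier G" if "y \<in> A" for y using x(3) that by blast
    have "finite (B' \<union> (\<lambda>(q, a). q \<otimes> a) ` (V n \<times> A))" using B'(1) V(1) x(2) by simp
    from translate_avoiding_finite_set[OF iG x(2) this x(3)]
    obtain g where g: "g \<in> carrier G" "\<forall>a\<in>A. a \<otimes> g \<notin> B' \<union> (\<lambda>(q, a). q \<otimes> a) ` (V n \<times> A)" by blast
    have ne: "\<forall>a\<in>A. \<forall>q\<in>V n. \<forall>a'\<in>A. a \<otimes> g \<noteq> q \<otimes> a'"
      using g(2) by fastforce
    define A' where "A' = A \<union> (\<lambda>a. a \<otimes> g) ` A"
    have "good (Suc n) (A', B')" unfolding good_def A'_def using x(2,4) xG B' g by auto
    moreover have "step n x (A', B')" unfolding step_def x A'_def B'_def using g(1) h(1) ne by blast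
    ultimately show "\<exists>y. good (Suc n) y \<and> step n x y" by blast
  qed
  then obtain f where f: "\<And>n. good n (f n)" "\<And>n. step n (f n) (f (Suc n))" by blast
  define a b where "a n = fst (f n)" and "b n = snd (f n)" for n
  have ab: "finite (a n)" "a n \<subseteq> carrier G" "\<one> \<in> a n" "a n \<inter> b n = {}" for n
    using f(1)[of n] unfolding good_def a_def b_def by (auto split: prod.splits)
  have aG: "x \<in> a n \<Longrightarrow> x \<in> carrier G" for x n using ab(2) by blast
  have "\<exists>g h. g \<in> carrier G \<and> h \<in> carrier G \<and> a (Suc n) = a n \<union> (\<lambda>x. x \<otimes> g) ` a n \<and>
      b (Suc n) = b n \<union> (\<lambda>q. q \<otimes> h) ` V n \<and> (\<forall>x\<in>a n. \<forall>q\<in>V n. \<forall>x'\<in>a n. x \<otimes> g \<noteq> q \<otimes> x')" for n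
    using f(2)[of n] unfolding step_def a_def b_def by (auto split: prod.splits)
  then obtain g h where gh: "\<And>n. g n \<in> carrier G" "\<And>n. h n \<in> carrier G"
      "\<And>n. a (Suc n) = a n \<union> (\<lambda>x. x \<otimes> g n) ` a n" "\<And>n. b (Suc n) = b n \<union> (\<lambda>q. q \<otimes> h n) ` V n"
      "\<And>n x q x'. x \<in> a n \<Longrightarrow> q \<in> V n \<Longrightarrow> x' \<in> a n \<Longrightarrow> x \<otimes> g n \<noteq> q \<otimes> x'"
    by metis
  have amono: "a n \<subseteq> a m" if "n \<le> m" for n m using that by (induction rule: dec_induct) (use gh in auto)
  have bmono: "b n \<subseteq> b m" if "n \<le> m" for n m using that by (induction rule: dec_induct) (use gh in auto)
  define A where "A = (\<Union>n. a n)"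
  have AG: "A \<subseteq> carrier G" unfolding A_def using ab by blast
  \<comment> \<open>later stages do not change the set inside the windows around its present points\<close>
  have persist: "q \<otimes> r \<in> A \<longleftrightarrow> q \<otimes> r \<in> a m" if q: "q \<in> V n" "n \<le> m" "r \<in> a m" for q r n m
  proof -
    have "q \<otimes> r \<in> a M \<longleftrightarrow> q \<otimes> r \<in> a m" if "m \<le> M" for M
      using that
    proof (induction rule: dec_induct)
      case (step M)
      have "q \<in> V M" "r \<in> a M" using q step Vmono[of n M] amono[of m M] by auto
      then have "q \<otimes> r \<notin> (\<lambda>x. x \<otimes> g M) ` a M" using gh(5)[of _ M q r] by fastforce
      then show ?case using step gh(3)[of M] by auto
    qed simp
    then show ?thesis unfolding A_def using amono by (metis UN_iff UNIV_I nat_le_linear subsetD)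
  qed
  have base: "q \<in> A \<longleftrightarrow> q \<in> a m" if "q \<in> V n" "n \<le> m" for q n m
    using persist[OF that ab(3)] VG[OF that(1)] by simp
  \<comment> \<open>every element is seen from a point \<open>r\<close> at which the stage looks as it does from the unit\<close>
  have factor: "\<exists>p\<in>a n. \<exists>r\<in>a m. x = p \<otimes> r \<and> (\<forall>q\<in>V n. q \<otimes> r \<in> a m \<longleftrightarrow> q \<in> a m)"
    if "n \<le> m" "x \<in> a m" for n m x
    using that
  proof (induction arbitrary: x rule: dec_induct)
    case base
    then show ?case using ab(3) VG aG by (intro bexI[of _ x] bexI[of _ \<one>]) auto
  next
    case (step m)
    have Vm: "q \<in> V m" "q \<in> carrier G" if "q \<in> V n" for q using that Vmono[OF step(1)] VG by auto
    have keep: "q \<in> a (Suc m) \<longleftrightarrow> q \<in> a m" if "q \<in> V n" for q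
      using base[OF that] step(1) le_SucI by blast
    show ?case
    proof (cases "x \<in> a m")
      case True
      then obtain p r where pr: "p \<in> a n" "r \<in> a m" "x = p \<otimes> r" "\<forall>q\<in>V n. q \<otimes> r \<in> a m \<longleftrightarrow> q \<in> a m"
        using step.IH by blast
      have "q \<otimes> r \<in> a (Suc m) \<longleftrightarrow> q \<in> a (Suc m)" if "q \<in> V n" for q
        using persist[OF that step(1) pr(2)] persist[OF that le_SucI[OF step(1)], of r] pr amono[of m "Suc m"] keep[OF that] that
        by auto
      then show ?thesis using pr amono[of m "Suc m"] by (intro bexI[of _ p] bexI[of _ r]) auto
    next
      case False
      then obtain x' where x': "x' \<in> a m" "x = x' \<otimes> g m" using step.prems gh(3)[of m] by auto
      then obtain p r where pr: "p \<in> a n" "r \<in> a m" "x' = p \<otimes> r" "\<forall>q\<in>V n. q \<otimes> r \<in> a m \<longleftrightarrow> q \<in> a m"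
        using step.IH by blast
      have G: "p \<in> carrier G" "r \<in> carrier G" "g m \<in> carrier G" using pr aG gh(1) by auto
      have "q \<otimes> (r \<otimes> g m) \<in> a (Suc m) \<longleftrightarrow> q \<in> a (Suc m)" if q: "q \<in> V n" for q
      proof -
        have qG: "q \<in> carrier G" using Vm q by blast
        have "q \<otimes> (r \<otimes> g m) \<notin> a m"
        proof
          assume i: "q \<otimes> (r \<otimes> g m) \<in> a m"
          have "r \<otimes> g m = inv q \<otimes> (q \<otimes> (r \<otimes> g m))" using G qG by (simp add: m_assoc[symmetric])
          then show False using gh(5)[OF pr(2) V(4)[OF Vm(1)[OF q]] i] by simp
        qed
        moreover have "q \<otimes> (r \<otimes> g m) \<in> (\<lambda>x. x \<otimes> g m) ` a m \<longleftrightarrow> q \<otimes> r \<in> a m"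
        proof
          assume "q \<otimes> (r \<otimes> g m) \<in> (\<lambda>x. x \<otimes> g m) ` a m"
          then obtain y where y: "y \<in> a m" "q \<otimes> (r \<otimes> g m) = y \<otimes> g m" by blast
          have "q \<otimes> r \<otimes> g m = y \<otimes> g m" using y G qG by (simp add: m_assoc)
          then have "q \<otimes> r = y" using G qG aG[OF y(1)] by simp
          then show "q \<otimes> r \<in> a m" using y by simp
        qed (use G qG in \<open>auto simp: m_assoc intro!: image_eqI[of _ _ "q \<otimes> r"]\<close>)
        ultimately show ?thesis using pr(4) q keep[OF q] unfolding gh(3)[of m] by auto
      qed
      moreover have "x = p \<otimes> (r \<otimes> g m)" using x' pr G by (simp add: m_assoc)
      moreover have "r \<otimes> g m \<in> a (Suc m)" using pr gh(3)[of m] by auto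
      ultimately show ?thesis using pr(1) by blast
    qed
  qed
  have "propto G A {r \<in> carrier G. \<forall>q\<in>Q. q \<otimes> r \<in> A \<longleftrightarrow> q \<in> A}" if Q: "finite Q" "Q \<subseteq> carrier G" for Q
  proof -
    obtain n where n: "Q \<subseteq> V n" using Vex Q by blast
    define R where "R = {r \<in> carrier G. \<forall>q\<in>Q. q \<otimes> r \<in> A \<longleftrightarrow> q \<in> A}"
    have sub: "A \<subseteq> a n <#> R"
    proof
      fix x assume "x \<in> A"
      then obtain m0 where "x \<in> a m0" unfolding A_def by blast
      then have "x \<in> a (max n m0)" using amono[of m0 "max n m0"] by auto
      from factor[OF _ this, of n] obtain p r where pr: "p \<in> a n" "r \<in> a (max n m0)" "x = p \<otimes> r"
         "\<forall>q\<in>V n. q \<otimes> r \<in> a (max n m0) \<longleftrightarrow> q \<in> a (max n m0)" by auto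
      have "q \<otimes> r \<in> A \<longleftrightarrow> q \<in> A" if "q \<in> Q" for q
        using persist[of q n "max n m0" r] base[of q n "max n m0"] pr n that by auto
      then have "r \<in> R" unfolding R_def using aG[OF pr(2)] by simp
      then show "x \<in> a n <#> R" unfolding set_mult_def pr(3) using pr(1) by blast
    qed
    show ?thesis unfolding propto_def R_def[symmetric] by (intro exI[of _ "a n"] conjI ab sub)
  qed
  moreover have "infinite A"
  proof
    assume fin: "finite A"
    \<comment> \<open>each stage is strictly larger than the one before, as \<open>g n\<close> is a new element\<close>
    have "n \<le> card (a n)" for n
    proof (induction n)
      case (Suc n)
      have "g n \<notin> a n" using gh(5)[OF ab(3) V(3), of "g n" n] gh(1)[of n] by auto
      moreover have "g n \<in> a (Suc n)" using ab(3)[of n] gh(1)[of n] gh(3)[of n] by force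
      ultimately have "a n \<subset> a (Suc n)" using amono[of n "Suc n"] by auto
      then have "card (a n) < card (a (Suc n))" using ab(1) by (rule psubset_card_mono[rotated])
      then show ?case using Suc by simp
    qed simp
    moreover have "card (a n) \<le> card A" for n unfolding A_def by (rule card_mono) (use fin A_def in auto)
    ultimately have "Suc (card A) \<le> card A" using order_trans by blast
    then show False by simp
  qed
  moreover have "\<not> propto G (carrier G) A"
  proof
    assume "propto G (carrier G) A"
    then obtain F where F: "finite F" "F \<subseteq> carrier G" "carrier G \<subseteq> F <#> A" unfolding propto_def by blast
    have "finite ((\<lambda>x. inv x) ` F)" "(\<lambda>x. inv x) ` F \<subseteq> carrier G" using F by auto
    then obtain n where n: "(\<lambda>x. inv x) ` F \<subseteq> V n" using Vex by blast
    \<comment> \<open>a translate by \<open>inv k\<close> of the centre \<open>h n\<close> of a gap would be an element of \<open>A\<close> in the gap\<close>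
    obtain k y where k: "k \<in> F" "y \<in> A" "h n = k \<otimes> y" using F(3) gh(2)[of n] unfolding set_mult_def by blast
    have G: "k \<in> carrier G" "y \<in> carrier G" using k F AG by auto
    have "y = inv k \<otimes> h n" unfolding k(3) using G by (simp add: m_assoc[symmetric])
    then have yb: "y \<in> b (Suc n)" using gh(4)[of n] n k(1) by auto
    obtain m where m: "y \<in> a m" using k(2) unfolding A_def by blast
    have "y \<in> a (max m (Suc n))" "y \<in> b (max m (Suc n))"
      using m yb amono[of m "max m (Suc n)"] bmono[of "Suc n" "max m (Suc n)"] by auto
    then show False using ab(4) by blast
  qed
  moreover have "\<one> \<in> A" unfolding A_def using ab(3) by blast
  ultimately show ?thesis using AG by blast
qed

text \<open>The system consists of the limits of marks, for the family of all translates of \<open>A\<close>, that do not vanish at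
  every translate.  Such a limit \<open>y\<close> meets \<open>A\<close> somewhere, and by recurrence it looks, from a place nearby, like
  \<open>A\<close> looks from the unit, on any given window.  So every orbit comes close to the mark of the unit,
  whose orbit is dense.\<close>
lemma sparse_minimal_type:
  assumes cG: "countable (carrier G)" and iG: "infinite (carrier G)"
  shows "\<exists>A. minimal_type TYPE('a set \<Rightarrow> bool) G A \<and> infinite A \<and> \<not> propto G (carrier G) A"
proof -
  obtain A where A: "A \<subseteq> carrier G" "\<one> \<in> A" "infinite A" "\<not> propto G (carrier G) A"
    and rec0: "\<forall>Q. finite Q \<and> Q \<subseteq> carrier G \<longrightarrow> propto G A {r \<in> carrier G. \<forall>q\<in>Q. q \<otimes> r \<in> A \<longleftrightarrow> q \<in> A}"
    using sparse_recurrent_set[OF cG iG] by (elim exE conjE) (rule that)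
  note rec = rec0[rule_format, OF conjI]
  define \<D> where "\<D> = (\<lambda>g. g <# A) ` carrier G"
  interpret symbolic G \<D>
  proof unfold_locales
    show "D \<in> \<D> \<Longrightarrow> D \<subseteq> carrier G" for D unfolding \<D>_def using A(1) l_coset_subset_G by blast
    show "D \<in> \<D> \<Longrightarrow> g \<in> carrier G \<Longrightarrow> g <# D \<in> \<D>" for D g
      unfolding \<D>_def using lcos_m_assoc[OF A(1)] by auto
  qed
  have AD: "A \<in> \<D>" unfolding \<D>_def using lcos_mult_one[OF A(1)] by force
  define W where "W = {w \<in> traces. \<exists>D\<in>\<D>. w D}"
  have hit: "\<exists>g\<in>carrier G. w (inv g <# A)" if w: "w \<in> W" for w
  proof -
    obtain k where "k \<in> carrier G" "w (k <# A)" using w unfolding W_def \<D>_def by blast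
    then show ?thesis by (intro bexI[of _ "inv k"]) auto
  qed
  have one: "mark \<one> \<in> W" unfolding W_def using mark_in_traces[OF one_closed] AD A(2) by (auto simp: mark_def)
  interpret symbolic_system G \<D> W A
  proof unfold_locales
    show "W \<subseteq> traces" unfolding W_def by blast
    show "shift g w \<in> W" if g: "g \<in> carrier G" and w: "w \<in> W" for g w
    proof -
      obtain D where D: "D \<in> \<D>" "w D" using w unfolding W_def by blast
      have "shift g w (g <# D) = w (inv g <# (g <# D))" by (rule shift_apply) (use D g translate in auto)
      also have "inv g <# (g <# D) = D" using lcos_m_assoc[OF subset[OF D(1)]] lcos_mult_one[OF subset[OF D(1)]] g by simp
      finally show ?thesis unfolding W_def using shift_in_traces[OF g] w D translate[OF D(1) g] W_def by blast
    qed
    show "W \<noteq> {}" using one by blast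
    show "A \<in> \<D>" by (rule AD)
    have "{w \<in> W. w A} = traces \<inter> {w \<in> extensional \<D>. w A = True}" unfolding W_def traces_def using AD by auto
    then have "closedin (bit_cube \<D>) {w \<in> W. w A}"
      using closedin_Int[OF closedin_traces closedin_coordinate[OF AD, of True]] by (simp only:)
    then show "compactin (bit_cube \<D>) {w \<in> W. w A}" by (rule closedin_compact_space[OF compact_bit_cube])
    show "\<exists>g\<in>carrier G. shift g w A" if "w \<in> W" for w using hit[OF that] by (simp add: shift_apply[OF AD])
  qed
  \<comment> \<open>every point of the system comes close to the mark of the unit\<close>
  have key: "\<exists>k\<in>carrier G. \<forall>q\<in>Q. shift k y (inv q <# A) \<longleftrightarrow> q \<in> A"
    if y: "y \<in> W" and Q: "finite Q" "Q \<subseteq> carrier G" for y Q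
  proof -
    obtain g where g: "g \<in> carrier G" "y (inv g <# A)" using hit[OF y] by blast
    obtain P where P: "finite P" "P \<subseteq> carrier G" "A \<subseteq> P <#> {r \<in> carrier G. \<forall>q\<in>Q. q \<otimes> r \<in> A \<longleftrightarrow> q \<in> A}"
      using rec[OF Q] unfolding propto_def by blast
    let ?E = "insert (inv g <# A) ((\<lambda>(p, q). inv (inv p \<otimes> g) <# (inv q <# A)) ` (P \<times> Q))"
    have "finite ?E" "?E \<subseteq> \<D>" using P Q g translate AD by (auto simp: subset_iff)
    moreover have "y \<in> traces" using y unfolding W_def by blast
    ultimately obtain h where h: "h \<in> carrier G" "\<forall>D\<in>?E. y D \<longleftrightarrow> h \<in> D" using traces_approx by metis
    have "g \<otimes> h \<in> A" using h(2) g(2) mem_translate_iff[OF A(1) g(1) h(1)] by simp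
    then obtain p r where pr: "p \<in> P" "r \<in> carrier G" "\<forall>q\<in>Q. q \<otimes> r \<in> A \<longleftrightarrow> q \<in> A" "g \<otimes> h = p \<otimes> r"
      using P(3) unfolding set_mult_def by blast
    define k where "k = inv p \<otimes> g"
    have pG: "p \<in> carrier G" using pr(1) P(2) by blast
    have k: "k \<in> carrier G" "k \<otimes> h = r"
    proof -
      show "k \<in> carrier G" unfolding k_def using pG g by simp
      have "k \<otimes> h = inv p \<otimes> (g \<otimes> h)" unfolding k_def using pG g h by (simp add: m_assoc)
      also have "\<dots> = r" unfolding pr(4) using pG pr(2) by (simp add: m_assoc[symmetric])
      finally show "k \<otimes> h = r" .
    qed
    have "shift k y (inv q <# A) \<longleftrightarrow> q \<in> A" if q: "q \<in> Q" for q
    proof -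
      have qG: "q \<in> carrier G" using q Q by blast
      have D: "inv q <# A \<in> \<D>" using translate[OF AD] qG by simp
      have "shift k y (inv q <# A) = y (inv k <# (inv q <# A))" by (rule shift_apply[OF D])
      also have "\<dots> \<longleftrightarrow> h \<in> inv k <# (inv q <# A)"
        by (rule bspec[OF h(2)]) (use pr(1) q in \<open>auto simp: k_def\<close>)
      also have "\<dots> \<longleftrightarrow> k \<otimes> h \<in> inv q <# A" by (rule mem_translate_iff[OF subset[OF D] k(1) h(1)])
      also have "\<dots> \<longleftrightarrow> q \<otimes> r \<in> A" unfolding k(2) by (rule mem_translate_iff[OF A(1) qG pr(2)])
      finally show ?thesis using pr(3) q by blast
    qed
    then show ?thesis using k(1) by blast
  qed
  have min: "minimal_action G Y act"
    unfolding minimal_action_def topspace_Y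
  proof (intro conjI ballI W_nonempty equalityI)
    fix y assume y: "y \<in> W"
    show "Y closure_of orbit G act y \<subseteq> W" using closure_of_subset_topspace[of Y] topspace_Y by simp
    show "W \<subseteq> Y closure_of orbit G act y"
    proof
      fix z assume z: "z \<in> W"
      have "\<exists>x\<in>orbit G act y. x \<in> U" if U: "z \<in> U" "openin Y U" for U
      proof -
        obtain U' where U': "openin (bit_cube \<D>) U'" "U = U' \<inter> W"
          using U(2) unfolding Y_def openin_subtopology by blast
        then obtain E where E: "finite E" "E \<subseteq> \<D>" "\<forall>w'\<in>extensional \<D>. (\<forall>i\<in>E. w' i = z i) \<longrightarrow> w' \<in> U'"
          using U(1) unfolding openin_bit_cube by blast
        have "z \<in> traces" using z W_traces by blast
        from traces_approx[OF this E(1,2)] obtain h where h: "h \<in> carrier G" "\<forall>D\<in>E. z D \<longleftrightarrow> h \<in> D" by blast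
        obtain T where T: "finite T" "T \<subseteq> carrier G" "E = (\<lambda>g. g <# A) ` T"
          using finite_subset_image[OF E(1) E(2)[unfolded \<D>_def]] by blast
        have "finite ((\<lambda>d. inv d \<otimes> h) ` T)" "(\<lambda>d. inv d \<otimes> h) ` T \<subseteq> carrier G" using T h by auto
        from key[OF y this] obtain k where k: "k \<in> carrier G"
          "\<forall>d\<in>T. shift k y (inv (inv d \<otimes> h) <# A) \<longleftrightarrow> inv d \<otimes> h \<in> A" by auto
        \<comment> \<open>near \<open>z\<close> there is the mark of \<open>h\<close>, the shift by \<open>h\<close> of the mark of the unit\<close>
        have "shift (h \<otimes> k) y D = z D" if D: "D \<in> E" for D
        proof -
          obtain d where d: "d \<in> T" "D = d <# A" using D T(3) by blast
          have dG: "d \<in> carrier G" using d T by blast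
          have DD: "D \<in> \<D>" using D E by blast
          have "shift (h \<otimes> k) y D = shift k y (inv h <# D)"
            unfolding shift_mult[OF h(1) k(1)] by (rule shift_apply[OF DD])
          also have "inv h <# D = inv (inv d \<otimes> h) <# A"
            unfolding d(2) using lcos_m_assoc[OF A(1)] dG h(1) by (simp add: inv_mult_group)
          also have "shift k y (inv (inv d \<otimes> h) <# A) \<longleftrightarrow> inv d \<otimes> h \<in> A" using k(2) d(1) by blast
          also have "\<dots> \<longleftrightarrow> h \<in> D"
            using mem_translate_iff[OF A(1), of "inv d" h] dG h(1) unfolding d(2) by simp
          finally show ?thesis using h(2) D by blast
        qed
        then have "shift (h \<otimes> k) y \<in> U'" using E(3) shift_extensional by blast
        moreover have "shift (h \<otimes> k) y \<in> W" using W_shift y h k by simp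
        ultimately show ?thesis unfolding orbit_act[OF y] U'(2) using h k by blast
      qed
      then show "z \<in> Y closure_of orbit G act y" unfolding in_closure_of topspace_Y using z by blast
    qed
  qed
  have "shift g (mark \<one>) A \<longleftrightarrow> g \<in> A" if "g \<in> carrier G" for g
    unfolding shift_mark[OF that one_closed] r_one[OF that] using AD by (simp add: mark_def)
  then have "visits (mark \<one>) = A"
    unfolding visits_def using A(1) by auto
  then have "rel_compact_sets G Y act (mark \<one>) = sets_below G A" using rel_compact_sets_Y[OF one] by simp
  then have "G_type G Y act (mark \<one>) = approx_class G A" by (rule G_type_eq_approx_class[OF group_axioms A(1)])
  moreover have "pointed_lc_G_space G Y act (mark \<one>)"
    unfolding pointed_lc_G_space_def using lc_G_space_Y one min topspace_Y unfolding minimal_action_def by auto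
  ultimately have "minimal_type TYPE('a set \<Rightarrow> bool) G A"
    unfolding minimal_type_def using A min by blast
  then show ?thesis using A by blast
qed

end

section \<open>Operators on square-summable functions\<close>

abbreviation unit_vec :: "'i \<Rightarrow> 'i \<Rightarrow> complex" where
  "unit_vec t \<equiv> (\<lambda>h. if h = t then 1 else 0)"

lemma l2_finite_support:
  assumes "finite S" "S \<subseteq> I" "\<And>i. i \<notin> S \<Longrightarrow> \<xi> i = 0"
  shows "\<xi> \<in> l2 I"
proof -
  have "(\<lambda>i. (norm (\<xi> i))\<^sup>2) summable_on S" using assms by simp
  then have "(\<lambda>i. (norm (\<xi> i))\<^sup>2) summable_on I"
    by (rule summable_on_cong_neutral[THEN iffD1, rotated -1]) (use assms in auto)
  then show ?thesis using assms unfolding l2_def by blast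
qed

lemma infsum_finite_support:
  fixes f :: "'i \<Rightarrow> 'b::{t2_space,topological_comm_monoid_add}"
  assumes "finite S" "S \<subseteq> I" "\<And>i. i \<in> I \<Longrightarrow> i \<notin> S \<Longrightarrow> f i = 0"
  shows "infsum f I = sum f S"
proof -
  have "infsum f I = infsum f S"
    by (rule infsum_cong_neutral) (use assms in auto)
  then show ?thesis using assms by simp
qed

lemma l2_zero: "(\<lambda>_. 0) \<in> l2 I"
  by (rule l2_finite_support[of "{}"]) auto

lemma unit_vec_l2: "t \<in> I \<Longrightarrow> unit_vec t \<in> l2 I"
  by (rule l2_finite_support[of "{t}"]) auto

lemma l2_norm_unit_vec: "t \<in> I \<Longrightarrow> l2_norm I (unit_vec t) = 1"
  unfolding l2_norm_def by (subst infsum_finite_support[of "{t}"]) auto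

lemma cmod_add_square_le: "(cmod (a + b))\<^sup>2 \<le> 2 * (cmod a)\<^sup>2 + 2 * (cmod b)\<^sup>2"
proof -
  have "(cmod (a + b))\<^sup>2 \<le> (cmod a + cmod b)\<^sup>2"
    by (simp add: norm_triangle_ineq power_mono)
  also have "\<dots> \<le> 2 * (cmod a)\<^sup>2 + 2 * (cmod b)\<^sup>2"
    using sum_squares_bound[of "cmod a" "cmod b"] by (simp add: power2_sum)
  finally show ?thesis .
qed

lemma cmod_lincomb_square_le:
  "(cmod (c * a + b))\<^sup>2 \<le> 2 * (cmod c)\<^sup>2 * (cmod a)\<^sup>2 + 2 * (cmod b)\<^sup>2"
  using cmod_add_square_le[of "c * a" b] by (simp add: norm_mult power_mult_distrib)

lemma l2_lincomb:
  assumes "\<xi> \<in> l2 I" "\<eta> \<in> l2 I"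
  shows "(\<lambda>i. c * \<xi> i + \<eta> i) \<in> l2 I"
proof -
  have "(\<lambda>i. 2 * (cmod c)\<^sup>2 * (cmod (\<xi> i))\<^sup>2 + 2 * (cmod (\<eta> i))\<^sup>2) summable_on I"
    using assms unfolding l2_def by (auto intro!: summable_on_add summable_on_cmult_right)
  then have "(\<lambda>i. (cmod (c * \<xi> i + \<eta> i))\<^sup>2) summable_on I"
    by (rule summable_on_comparison_test) (auto intro: cmod_lincomb_square_le)
  then show ?thesis using assms unfolding l2_def by auto
qed

lemma l2_norm_nonneg: "l2_norm I \<xi> \<ge> 0"
  unfolding l2_norm_def by (simp add: infsum_nonneg)

lemma l2_norm_square: "(l2_norm I \<xi>)\<^sup>2 = (\<Sum>\<^sub>\<infinity>i\<in>I. (norm (\<xi> i))\<^sup>2)"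
  unfolding l2_norm_def by (simp add: infsum_nonneg)

text \<open>The factor 2 does no harm, as the estimate only serves to see that operators are bounded.\<close>
lemma l2_norm_lincomb:
  assumes "\<xi> \<in> l2 I" "\<eta> \<in> l2 I"
  shows "l2_norm I (\<lambda>i. c * \<xi> i + \<eta> i) \<le> 2 * (cmod c * l2_norm I \<xi> + l2_norm I \<eta>)"
proof -
  have s: "(\<lambda>i. 2 * (cmod c)\<^sup>2 * (cmod (\<xi> i))\<^sup>2) summable_on I"
     "(\<lambda>i. 2 * (cmod (\<eta> i))\<^sup>2) summable_on I"
    using assms unfolding l2_def by (auto intro!: summable_on_cmult_right)
  have "(l2_norm I (\<lambda>i. c * \<xi> i + \<eta> i))\<^sup>2
      \<le> (\<Sum>\<^sub>\<infinity>i\<in>I. 2 * (cmod c)\<^sup>2 * (cmod (\<xi> i))\<^sup>2 + 2 * (cmod (\<eta> i))\<^sup>2)"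
    unfolding l2_norm_square
    by (rule infsum_mono) (use l2_lincomb[OF assms, of c] s in \<open>auto simp: l2_def intro: cmod_lincomb_square_le summable_on_add\<close>)
  also have "\<dots> = 2 * (cmod c)\<^sup>2 * (l2_norm I \<xi>)\<^sup>2 + 2 * (l2_norm I \<eta>)\<^sup>2"
    unfolding l2_norm_square using s by (simp add: infsum_add infsum_cmult_right')
  also have "\<dots> \<le> (2 * (cmod c * l2_norm I \<xi> + l2_norm I \<eta>))\<^sup>2"
    using l2_norm_nonneg[of I \<xi>] l2_norm_nonneg[of I \<eta>]
    by (simp add: power2_sum power_mult_distrib)
  finally show ?thesis
    by (rule power2_le_imp_le) (simp add: l2_norm_nonneg)
qed

lemma norm_le_l2_norm:
  assumes "\<xi> \<in> l2 I" "t \<in> I"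
  shows "cmod (\<xi> t) \<le> l2_norm I \<xi>"
proof -
  have "(\<Sum>\<^sub>\<infinity>i\<in>{t}. (norm (\<xi> i))\<^sup>2) \<le> (\<Sum>\<^sub>\<infinity>i\<in>I. (norm (\<xi> i))\<^sup>2)"
    by (rule infsum_mono_neutral) (use assms in \<open>auto simp: l2_def\<close>)
  then have "(cmod (\<xi> t))\<^sup>2 \<le> (l2_norm I \<xi>)\<^sup>2"
    unfolding l2_norm_square by simp
  then show ?thesis by (rule power2_le_imp_le) (simp add: l2_norm_nonneg)
qed

lemma bounded_opsI:
  assumes "\<And>\<xi>. \<xi> \<in> l2 I \<Longrightarrow> T \<xi> \<in> l2 I" "\<And>\<xi>. \<xi> \<notin> l2 I \<Longrightarrow> T \<xi> = (\<lambda>_. 0)"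
    "\<And>\<xi> \<eta> c. \<xi> \<in> l2 I \<Longrightarrow> \<eta> \<in> l2 I \<Longrightarrow> T (\<lambda>i. c * \<xi> i + \<eta> i) = (\<lambda>i. c * T \<xi> i + T \<eta> i)"
    "\<And>\<xi>. \<xi> \<in> l2 I \<Longrightarrow> l2_norm I (T \<xi>) \<le> C * l2_norm I \<xi>"
  shows "T \<in> bounded_ops I"
  using assms unfolding bounded_ops_def by blast

lemma bounded_opsD:
  assumes "T \<in> bounded_ops I"
  shows "\<And>\<xi>. \<xi> \<in> l2 I \<Longrightarrow> T \<xi> \<in> l2 I" "\<And>\<xi>. \<xi> \<notin> l2 I \<Longrightarrow> T \<xi> = (\<lambda>_. 0)"
    "\<And>\<xi> \<eta> c. \<xi> \<in> l2 I \<Longrightarrow> \<eta> \<in> l2 I \<Longrightarrow> T (\<lambda>i. c * \<xi> i + \<eta> i) = (\<lambda>i. c * T \<xi> i + T \<eta> i)"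
    "\<exists>C. \<forall>\<xi>\<in>l2 I. l2_norm I (T \<xi>) \<le> C * l2_norm I \<xi>"
  using assms unfolding bounded_ops_def by auto

lemma zero_bounded_op: "(\<lambda>\<xi> i. 0) \<in> bounded_ops I"
  by (rule bounded_opsI[where C = 0]) (auto simp: l2_zero l2_norm_def)

lemma bounded_ops_lincomb:
  assumes "S \<in> bounded_ops I" "T \<in> bounded_ops I"
  shows "(\<lambda>\<xi> i. c * S \<xi> i + T \<xi> i) \<in> bounded_ops I"
proof -
  obtain B C where B: "\<And>\<xi>. \<xi> \<in> l2 I \<Longrightarrow> l2_norm I (S \<xi>) \<le> B * l2_norm I \<xi>"
    and C: "\<And>\<xi>. \<xi> \<in> l2 I \<Longrightarrow> l2_norm I (T \<xi>) \<le> C * l2_norm I \<xi>"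
    using bounded_opsD(4)[OF assms(1)] bounded_opsD(4)[OF assms(2)] by blast
  show ?thesis
  proof (rule bounded_opsI[where C = "2 * (cmod c * B + C)"])
    fix \<xi> assume x: "\<xi> \<in> l2 I"
    show "(\<lambda>i. c * S \<xi> i + T \<xi> i) \<in> l2 I"
      using x assms bounded_opsD(1) by (intro l2_lincomb) auto
    have "l2_norm I (\<lambda>i. c * S \<xi> i + T \<xi> i) \<le> 2 * (cmod c * l2_norm I (S \<xi>) + l2_norm I (T \<xi>))"
      using x assms bounded_opsD(1) by (intro l2_norm_lincomb) auto
    also have "\<dots> \<le> 2 * (cmod c * (B * l2_norm I \<xi>) + C * l2_norm I \<xi>)"
      using B[OF x] C[OF x] by (intro mult_left_mono add_mono) auto
    finally show "l2_norm I (\<lambda>i. c * S \<xi> i + T \<xi> i) \<le> 2 * (cmod c * B + C) * l2_norm I \<xi>"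
      by (simp add: algebra_simps)
  next
    fix \<xi> \<eta> b assume "\<xi> \<in> l2 I" "\<eta> \<in> l2 I"
    then show "(\<lambda>i. c * S (\<lambda>i. b * \<xi> i + \<eta> i) i + T (\<lambda>i. b * \<xi> i + \<eta> i) i)
        = (\<lambda>i. b * (c * S \<xi> i + T \<xi> i) + (c * S \<eta> i + T \<eta> i))"
      using assms by (simp only: bounded_opsD(3)) (simp add: algebra_simps)
  qed (use assms in \<open>auto simp: bounded_opsD(2)\<close>)
qed

lemma bounded_ops_sum:
  assumes "finite X" "\<And>x. x \<in> X \<Longrightarrow> a x \<in> bounded_ops I"
  shows "(\<lambda>\<xi> i. \<Sum>x\<in>X. c x * a x \<xi> i) \<in> bounded_ops I"
  using assms
proof (induction X rule: finite_induct)
  case empty then show ?case by (simp add: zero_bounded_op)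
next
  case (insert x X)
  then show ?case
    using bounded_ops_lincomb[of "a x" I "\<lambda>\<xi> i. \<Sum>x\<in>X. c x * a x \<xi> i" "c x"] by simp
qed

lemma bounded_ops_diff:
  assumes "S \<in> bounded_ops I" "T \<in> bounded_ops I"
  shows "op_diff S T \<in> bounded_ops I"
  using bounded_ops_lincomb[OF assms(2,1), of "-1"] unfolding op_diff_def by simp

lemma op_norm_le:
  assumes "\<And>\<xi>. \<xi> \<in> l2 I \<Longrightarrow> l2_norm I \<xi> \<le> 1 \<Longrightarrow> l2_norm I (T \<xi>) \<le> c"
  shows "op_norm I T \<le> c"
proof -
  have "(\<lambda>_. 0) \<in> {\<xi> \<in> l2 I. l2_norm I \<xi> \<le> 1}" by (simp add: l2_zero l2_norm_def)
  then show ?thesis unfolding op_norm_def using assms by (intro cSUP_least) auto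
qed

text \<open>The supremum in the definition of the norm is that of a bounded set only for a bounded operator.\<close>
lemma op_entry_le_op_norm:
  assumes "T \<in> bounded_ops I" "s \<in> I" "t \<in> I"
  shows "cmod (T (unit_vec t) s) \<le> op_norm I T"
proof -
  obtain C where C: "\<And>\<xi>. \<xi> \<in> l2 I \<Longrightarrow> l2_norm I (T \<xi>) \<le> C * l2_norm I \<xi>"
    using bounded_opsD(4)[OF assms(1)] by blast
  have bdd: "bdd_above ((\<lambda>\<xi>. l2_norm I (T \<xi>)) ` {\<xi> \<in> l2 I. l2_norm I \<xi> \<le> 1})"
  proof (rule bdd_aboveI2)
    fix \<xi> assume x: "\<xi> \<in> {\<xi> \<in> l2 I. l2_norm I \<xi> \<le> 1}"
    have "l2_norm I (T \<xi>) \<le> C * l2_norm I \<xi>" using C x by auto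
    also have "\<dots> \<le> \<bar>C\<bar> * 1"
      using x by (intro mult_mono) (auto simp: l2_norm_nonneg)
    finally show "l2_norm I (T \<xi>) \<le> \<bar>C\<bar>" by simp
  qed
  have "cmod (T (unit_vec t) s) \<le> l2_norm I (T (unit_vec t))"
    by (rule norm_le_l2_norm[OF bounded_opsD(1)[OF assms(1) unit_vec_l2[OF assms(3)]] assms(2)])
  also have "\<dots> \<le> op_norm I T"
    unfolding op_norm_def
    by (rule cSUP_upper[OF _ bdd]) (use assms in \<open>simp add: unit_vec_l2 l2_norm_unit_vec\<close>)
  finally show ?thesis .
qed

lemma summable_l2_inner:
  assumes "\<xi> \<in> l2 I" "\<eta> \<in> l2 I"
  shows "(\<lambda>i. \<xi> i * cnj (\<eta> i)) summable_on I"
proof -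
  have "(\<lambda>i. (cmod (\<xi> i))\<^sup>2 + (cmod (\<eta> i))\<^sup>2) summable_on I"
    using assms unfolding l2_def by (auto intro: summable_on_add)
  then have "(\<lambda>i. cmod (\<xi> i * cnj (\<eta> i))) summable_on I"
  proof (rule summable_on_comparison_test)
    fix i show "cmod (\<xi> i * cnj (\<eta> i)) \<le> (cmod (\<xi> i))\<^sup>2 + (cmod (\<eta> i))\<^sup>2"
      using sum_squares_bound[of "cmod (\<xi> i)" "cmod (\<eta> i)"]
        mult_nonneg_nonneg[OF norm_ge_zero norm_ge_zero, of "\<xi> i" "\<eta> i"]
      unfolding norm_mult complex_mod_cnj by linarith
  qed auto
  then show ?thesis by (rule abs_summable_summable)
qed

lemma l2_inner_unit_vec: "t \<in> I \<Longrightarrow> l2_inner I \<xi> (unit_vec t) = \<xi> t"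
  unfolding l2_inner_def by (subst infsum_finite_support[of "{t}"]) auto

lemma l2_inner_add_right:
  assumes "\<xi> \<in> l2 I" "\<eta> \<in> l2 I" "\<zeta> \<in> l2 I"
  shows "l2_inner I \<xi> (\<lambda>i. c * \<eta> i + \<zeta> i) = cnj c * l2_inner I \<xi> \<eta> + l2_inner I \<xi> \<zeta>"
proof -
  have "l2_inner I \<xi> (\<lambda>i. c * \<eta> i + \<zeta> i)
      = (\<Sum>\<^sub>\<infinity>i\<in>I. cnj c * (\<xi> i * cnj (\<eta> i)) + \<xi> i * cnj (\<zeta> i))"
    unfolding l2_inner_def by (simp add: algebra_simps)
  then show ?thesis unfolding l2_inner_def
    using summable_l2_inner[OF assms(1,2)] summable_l2_inner[OF assms(1,3)]
    by (simp add: infsum_add infsum_cmult_right' summable_on_cmult_right)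
qed

lemma l2_inner_lincomb_left:
  assumes "\<xi> \<in> l2 I" "\<eta> \<in> l2 I" "\<zeta> \<in> l2 I"
  shows "l2_inner I (\<lambda>i. c * \<xi> i + \<eta> i) \<zeta> = c * l2_inner I \<xi> \<zeta> + l2_inner I \<eta> \<zeta>"
proof -
  have "l2_inner I (\<lambda>i. c * \<xi> i + \<eta> i) \<zeta>
      = (\<Sum>\<^sub>\<infinity>i\<in>I. c * (\<xi> i * cnj (\<zeta> i)) + \<eta> i * cnj (\<zeta> i))"
    unfolding l2_inner_def by (simp add: algebra_simps)
  then show ?thesis unfolding l2_inner_def
    using summable_l2_inner[OF assms(1,3)] summable_l2_inner[OF assms(2,3)]
    by (simp add: infsum_add infsum_cmult_right' summable_on_cmult_right)
qed

lemma l2_sum: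
  assumes "finite X" "\<And>x. x \<in> X \<Longrightarrow> \<xi> x \<in> l2 I"
  shows "(\<lambda>i. \<Sum>x\<in>X. c x * \<xi> x i) \<in> l2 I"
  using assms
  by (induction X rule: finite_induct) (auto simp: l2_zero intro!: l2_lincomb)

lemma l2_inner_sum_left:
  assumes "finite X" "\<And>x. x \<in> X \<Longrightarrow> \<xi> x \<in> l2 I" "\<eta> \<in> l2 I"
  shows "l2_inner I (\<lambda>i. \<Sum>x\<in>X. c x * \<xi> x i) \<eta> = (\<Sum>x\<in>X. c x * l2_inner I (\<xi> x) \<eta>)"
  using assms
proof (induction X rule: finite_induct)
  case empty then show ?case by (simp add: l2_inner_def)
next
  case (insert x X)
  then show ?case
    using l2_inner_lincomb_left[of "\<xi> x" I "\<lambda>i. \<Sum>x\<in>X. c x * \<xi> x i" \<eta> "c x"]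
    by (simp add: l2_sum)
qed

context group begin

lemma bij_betw_left_mult: "g \<in> carrier G \<Longrightarrow> bij_betw (\<lambda>h. g \<otimes> h) (carrier G) (carrier G)"
  by (rule bij_betwI[of _ _ _ "\<lambda>h. inv g \<otimes> h"]) (auto simp: inv_solve_left m_assoc[symmetric])

lemma left_regular_l2:
  assumes "g \<in> carrier G" "\<xi> \<in> l2 (carrier G)"
  shows "left_regular G g \<xi> \<in> l2 (carrier G)"
    and "l2_norm (carrier G) (left_regular G g \<xi>) = l2_norm (carrier G) \<xi>"
proof -
  have b: "bij_betw (\<lambda>h. inv g \<otimes> h) (carrier G) (carrier G)"
    using bij_betw_left_mult assms by simp
  have "(\<lambda>h. (cmod (\<xi> (inv g \<otimes> h)))\<^sup>2) summable_on carrier G"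
    using summable_on_reindex_bij_betw[OF b, of "\<lambda>h. (cmod (\<xi> h))\<^sup>2"] assms by (simp add: l2_def)
  then have "(\<lambda>h. (cmod (left_regular G g \<xi> h))\<^sup>2) summable_on carrier G"
    by (rule summable_on_cong[THEN iffD1, rotated]) (use assms in \<open>simp add: left_regular_def\<close>)
  then show "left_regular G g \<xi> \<in> l2 (carrier G)"
    unfolding l2_def by (simp add: left_regular_def)
  have "(\<Sum>\<^sub>\<infinity>h\<in>carrier G. (cmod (left_regular G g \<xi> h))\<^sup>2) = (\<Sum>\<^sub>\<infinity>h\<in>carrier G. (cmod (\<xi> (inv g \<otimes> h)))\<^sup>2)"
    by (rule infsum_cong) (use assms in \<open>simp add: left_regular_def\<close>)
  also have "\<dots> = (\<Sum>\<^sub>\<infinity>h\<in>carrier G. (cmod (\<xi> h))\<^sup>2)"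
    using infsum_reindex_bij_betw[OF b, of "\<lambda>h. (cmod (\<xi> h))\<^sup>2"] by simp
  finally show "l2_norm (carrier G) (left_regular G g \<xi>) = l2_norm (carrier G) \<xi>"
    unfolding l2_norm_def by simp
qed

lemma left_regular_bounded:
  assumes "g \<in> carrier G"
  shows "left_regular G g \<in> bounded_ops (carrier G)"
proof (rule bounded_opsI[where C = 1])
  fix \<xi> \<eta> :: "'a \<Rightarrow> complex" and c assume "\<xi> \<in> l2 (carrier G)" "\<eta> \<in> l2 (carrier G)"
  then show "left_regular G g (\<lambda>i. c * \<xi> i + \<eta> i) = (\<lambda>i. c * left_regular G g \<xi> i + left_regular G g \<eta> i)"
    using l2_lincomb[of \<xi> "carrier G" \<eta> c] by (auto simp: left_regular_def fun_eq_iff)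
qed (use assms left_regular_l2 in \<open>auto simp: left_regular_def\<close>)

lemma op_norm_left_regular_le: "g \<in> carrier G \<Longrightarrow> op_norm (carrier G) (left_regular G g) \<le> 1"
  by (rule op_norm_le) (simp add: left_regular_l2)

lemma left_regular_unit_vec:
  assumes "g \<in> carrier G" "t \<in> carrier G"
  shows "left_regular G g (unit_vec t) (g \<otimes> t) = 1"
  using assms by (simp add: left_regular_def unit_vec_l2 m_assoc[symmetric])

lemma left_regular_combination_in_cstar:
  assumes "finite F" "F \<subseteq> carrier G"
  shows "(\<lambda>\<xi> h. \<Sum>g\<in>F. c g * left_regular G g \<xi> h) \<in> reduced_group_cstar G"
proof -
  let ?T = "\<lambda>\<xi> h. \<Sum>g\<in>F. c g * left_regular G g \<xi> h"
  have "op_norm (carrier G) (op_diff ?T ?T) \<le> 0"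
    by (rule op_norm_le) (simp add: op_diff_def l2_norm_def)
  moreover have "?T \<in> bounded_ops (carrier G)"
    by (rule bounded_ops_sum) (use assms left_regular_bounded in auto)
  ultimately show ?thesis
    unfolding reduced_group_cstar_def using assms
    by (intro CollectI conjI allI impI exI[of _ F] exI[of _ c]) auto
qed

lemma left_regular_in_cstar:
  assumes "g \<in> carrier G"
  shows "left_regular G g \<in> reduced_group_cstar G"
  using left_regular_combination_in_cstar[of "{g}" "\<lambda>_. 1"] assms by simp

end

section \<open>Approximation in a convex cone\<close>

lemma weighted_square_expand:
  fixes w s :: "'j \<Rightarrow> complex" and t :: real
  shows "(\<Sum>x\<in>J. (cmod (w x - of_real t * s x))\<^sup>2)
    = (\<Sum>x\<in>J. (cmod (w x))\<^sup>2) - 2 * t * Re (\<Sum>x\<in>J. cnj (w x) * s x) + t\<^sup>2 * (\<Sum>x\<in>J. (cmod (s x))\<^sup>2)"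
proof -
  have "(cmod (w x - of_real t * s x))\<^sup>2
     = (cmod (w x))\<^sup>2 - 2 * t * Re (cnj (w x) * s x) + t\<^sup>2 * (cmod (s x))\<^sup>2" for x
    unfolding cmod_power2 by (simp add: power2_eq_square algebra_simps)
  then show ?thesis
    by (simp only: sum.distrib sum_subtractf sum_distrib_left Re_sum)
qed

text \<open>A version of the bipolar theorem for finitely many coordinates and a cone that need not be closed.  If \<open>v\<close>
  had positive distance from the cone, let \<open>c\<close> be a nearly closest point and \<open>w = v - c\<close>.  Moving \<open>c\<close>
  along the generators and towards \<open>0\<close> shows that \<open>w\<close>, as a functional, is nearly non-positive on the generators
  and nearly non-negative at \<open>c\<close>.  Then \<open>w\<close> is small at \<open>v\<close> by hypothesis, and its square norm, the difference
  of its values at \<open>v\<close> and \<open>c\<close>, is small.\<close>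
lemma cone_approximates_if_weakly_dominated:
  fixes s :: "'p \<Rightarrow> 'j \<Rightarrow> complex" and N :: "'p \<Rightarrow> real" and v :: "'j \<Rightarrow> complex"
  assumes bound: "\<And>p. p \<in> P \<Longrightarrow> (\<Sum>x\<in>J. (cmod (s p x))\<^sup>2) \<le> (B * N p)\<^sup>2" "B > 0"
    "\<And>p. p \<in> P \<Longrightarrow> N p \<ge> 0"
    and dom: "\<And>w \<kappa>. (\<And>p. p \<in> P \<Longrightarrow> Re (\<Sum>x\<in>J. cnj (w x) * s p x) \<le> \<kappa> * N p) \<Longrightarrow> \<kappa> \<ge> 0 \<Longrightarrow>
       Re (\<Sum>x\<in>J. cnj (w x) * v x) \<le> \<kappa> * M"
    and C: "C \<noteq> {}"
      "\<And>c p t. c \<in> C \<Longrightarrow> p \<in> P \<Longrightarrow> t \<ge> 0 \<Longrightarrow> (\<lambda>x. c x + of_real t * s p x) \<in> C"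
      "\<And>c t. c \<in> C \<Longrightarrow> t \<ge> 0 \<Longrightarrow> (\<lambda>x. of_real t * c x) \<in> C"
    and M: "M \<ge> 0" and eps: "\<epsilon> > 0"
  shows "\<exists>c\<in>C. (\<Sum>x\<in>J. (cmod (v x - c x))\<^sup>2) < \<epsilon>"
proof (rule ccontr)
  define q where "q f = (\<Sum>x\<in>J. (cmod (f x))\<^sup>2)" for f :: "'j \<Rightarrow> complex"
  have qn: "q f \<ge> 0" for f unfolding q_def by (simp add: sum_nonneg)
  define D where "D = (\<lambda>c. q (\<lambda>x. v x - c x)) ` C"
  assume "\<not> ?thesis"
  then have ge: "q (\<lambda>x. v x - c x) \<ge> \<epsilon>" if "c \<in> C" for c
    using that unfolding q_def by force
  define d where "d = Inf D"
  have Dne: "D \<noteq> {}" and Dbdd: "bdd_below D"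
    using C(1) qn unfolding D_def bdd_below_def by auto
  have dle: "d \<le> q (\<lambda>x. v x - c x)" if "c \<in> C" for c
    unfolding d_def by (rule cInf_lower[OF _ Dbdd]) (use that in \<open>auto simp: D_def\<close>)
  have deps: "d \<ge> \<epsilon>"
    unfolding d_def by (rule cInf_greatest[OF Dne]) (use ge in \<open>auto simp: D_def\<close>)
  define L where "L = B * M + 1/2 + q v + d + 1"
  have L: "L > 0" unfolding L_def using M bound(2) qn[of v] deps eps
    by (intro add_nonneg_pos add_nonneg_nonneg) auto
  \<comment> \<open>\<open>r\<^sup>2\<close> is the defect of optimality of \<open>c\<close>; the errors that it causes add up to at most \<open>r * L\<close>\<close>
  define r where "r = min 1 (\<epsilon> / (2 * L))"
  have r: "r > 0" "r \<le> 1" "r * L < \<epsilon>"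
    unfolding r_def using L eps by (auto simp: min_def field_simps)
  have "d < d + r\<^sup>2" using r by simp
  then obtain y where y: "y \<in> D" "y < d + r\<^sup>2"
    using cInf_lessD[OF Dne] unfolding d_def by blast
  then obtain c where c: "c \<in> C" "q (\<lambda>x. v x - c x) \<le> d + r\<^sup>2"
    unfolding D_def by auto
  define w where "w x = v x - c x" for x
  have qw: "d \<le> q w" "q w \<le> d + r\<^sup>2" using dle[OF c(1)] c(2) unfolding w_def by auto
  have q_move: "q (\<lambda>x. w x - of_real t * f x) = q w - 2 * t * Re (\<Sum>x\<in>J. cnj (w x) * f x) + t\<^sup>2 * q f"
    for t f unfolding q_def by (rule weighted_square_expand)
  \<comment> \<open>\<open>c\<close> is nearly closest to \<open>v\<close>, so \<open>w\<close> nearly does not increase along the cone\<close>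
  have gen: "Re (\<Sum>x\<in>J. cnj (w x) * s p x) \<le> (r * B) * N p" if p: "p \<in> P" for p
  proof -
    define I where "I = Re (\<Sum>x\<in>J. cnj (w x) * s p x)"
    have step: "2 * t * I \<le> r\<^sup>2 + t\<^sup>2 * (B * N p)\<^sup>2" if t: "t \<ge> 0" for t
    proof -
      have "d \<le> q (\<lambda>x. v x - (c x + of_real t * s p x))"
        by (rule dle[OF C(2)[OF c(1) p t]])
      also have "\<dots> = q (\<lambda>x. w x - of_real t * s p x)" unfolding w_def by (simp add: algebra_simps)
      also have "\<dots> = q w - 2 * t * I + t\<^sup>2 * q (s p)" unfolding q_move I_def ..
      finally have "2 * t * I \<le> r\<^sup>2 + t\<^sup>2 * q (s p)" using qw by linarith
      also have "\<dots> \<le> r\<^sup>2 + t\<^sup>2 * (B * N p)\<^sup>2"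
        using bound(1)[OF p] unfolding q_def by (intro add_left_mono mult_left_mono) auto
      finally show ?thesis .
    qed
    show ?thesis
    proof (cases "N p = 0")
      case True
      then have "q (s p) \<le> 0" using bound(1)[OF p] unfolding q_def by simp
      have "I \<le> 0"
      proof (rule ccontr)
        assume "\<not> I \<le> 0"
        then have "2 * (r\<^sup>2 / I) * I \<le> r\<^sup>2" using step[of "r\<^sup>2 / I"] True by simp
        then show False using \<open>\<not> I \<le> 0\<close> r by simp
      qed
      then show ?thesis using True unfolding I_def by simp
    next
      case False
      define b where "b = B * N p"
      have b: "b > 0" using False bound(2,3) p unfolding b_def by (simp add: less_le)
      \<comment> \<open>the step length \<open>r / b\<close> balances the two error terms\<close>
      have "2 * (r / b) * I \<le> r\<^sup>2 + (r / b)\<^sup>2 * b\<^sup>2" using step[of "r / b"] r b unfolding b_def by simp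
      also have "\<dots> = 2 * r\<^sup>2" using b by (simp add: power_divide)
      finally have "I \<le> r * b" using r b by (simp add: field_simps power2_eq_square)
      then show ?thesis unfolding I_def b_def by (simp add: mult.assoc)
    qed
  qed
  have up: "Re (\<Sum>x\<in>J. cnj (w x) * v x) \<le> (r * B) * M"
    by (rule dom[OF gen]) (use r bound(2) in auto)
  \<comment> \<open>shrinking \<open>c\<close> by the factor \<open>1 - r\<close> stays in the cone and brings it no closer to \<open>v\<close>\<close>
  have low: "Re (\<Sum>x\<in>J. cnj (w x) * c x) \<ge> - (r / 2) - (r / 2) * q c"
  proof -
    have "d \<le> q (\<lambda>x. v x - of_real (1 - r) * c x)"
      by (rule dle[OF C(3)[OF c(1)]]) (use r in auto)
    also have "\<dots> = q (\<lambda>x. w x - of_real (- r) * c x)" unfolding w_def by (simp add: algebra_simps)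
    also have "\<dots> = q w + 2 * r * Re (\<Sum>x\<in>J. cnj (w x) * c x) + r\<^sup>2 * q c"
      using q_move[of "-r" c] by simp
    finally have "0 \<le> r * (2 * Re (\<Sum>x\<in>J. cnj (w x) * c x) + r + r * q c)"
      using qw by (simp add: algebra_simps power2_eq_square)
    then have "0 \<le> 2 * Re (\<Sum>x\<in>J. cnj (w x) * c x) + r + r * q c"
      using r by (simp add: zero_le_mult_iff)
    then show ?thesis by simp
  qed
  have qc: "q c \<le> 2 * q v + 2 * (d + 1)"
  proof -
    have "(cmod (c x))\<^sup>2 \<le> 2 * (cmod (v x))\<^sup>2 + 2 * (cmod (w x))\<^sup>2" for x
    proof -
      have "cmod (c x) \<le> cmod (v x) + cmod (w x)"
        using norm_triangle_ineq4[of "v x" "w x"] unfolding w_def by simp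
      then have "(cmod (c x))\<^sup>2 \<le> (cmod (v x) + cmod (w x))\<^sup>2" by (intro power_mono) auto
      then show ?thesis
        using sum_squares_bound[of "cmod (v x)" "cmod (w x)"] by (simp add: power2_sum)
    qed
    then have "q c \<le> 2 * q v + 2 * q w"
      unfolding q_def sum_distrib_left sum.distrib[symmetric] by (rule sum_mono)
    also have "\<dots> \<le> 2 * q v + 2 * (d + 1)"
      using qw(2) power_le_one[of r 2] r by (intro add_left_mono mult_left_mono) auto
    finally show ?thesis .
  qed
  have "Re (\<Sum>x\<in>J. cnj (w x) * w x) = q w"
  proof -
    have "cnj (w x) * w x = of_real ((cmod (w x))\<^sup>2)" for x
      by (simp only: complex_norm_square[symmetric] mult.commute)
    then show ?thesis unfolding q_def by simp
  qed
  moreover have "cnj (w x) * w x = cnj (w x) * v x - cnj (w x) * c x" for x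
    unfolding w_def by (simp add: algebra_simps)
  ultimately have "q w = Re (\<Sum>x\<in>J. cnj (w x) * v x) - Re (\<Sum>x\<in>J. cnj (w x) * c x)"
    by (simp only: sum_subtractf minus_complex.sel)
  then have "d \<le> r * (B * M) + r / 2 + (r / 2) * q c" using up low qw by linarith
  also have "\<dots> \<le> r * (B * M) + r / 2 + (r / 2) * (2 * q v + 2 * (d + 1))"
    using qc r by (intro add_left_mono mult_left_mono) auto
  also have "\<dots> = r * L" unfolding L_def by (simp add: algebra_simps)
  finally show False using r deps by linarith
qed

section \<open>The coefficients of a completely positive map into matrices\<close>

lemma ccp_mapD:
  assumes "ccp_map I A J B \<phi>"
  shows "\<And>a. a \<in> A \<Longrightarrow> \<phi> a \<in> B"
    and "\<And>m a. (\<And>i j. i < m \<Longrightarrow> j < m \<Longrightarrow> a i j \<in> A) \<Longrightarrow> positive_op_matrix I m a \<Longrightarrow>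
      positive_op_matrix J m (\<lambda>i j. \<phi> (a i j))"
    and "\<And>a. a \<in> A \<Longrightarrow> op_norm J (\<phi> a) \<le> op_norm I a"
  using assms unfolding ccp_map_def by simp_all

lemma ccp_map_sum:
  fixes \<phi> :: "'i oper \<Rightarrow> 'j oper"
  assumes "ccp_map I A J B \<phi>" "finite X"
    "\<And>X'. X' \<subseteq> X \<Longrightarrow> (\<lambda>\<xi> i. \<Sum>x\<in>X'. c x * a x \<xi> i) \<in> A" "\<And>x. x \<in> X \<Longrightarrow> a x \<in> A"
  shows "\<phi> (\<lambda>\<xi> i. \<Sum>x\<in>X. c x * a x \<xi> i) = (\<lambda>\<eta> j. \<Sum>x\<in>X. c x * \<phi> (a x) \<eta> j)"
proof -
  have lin: "\<phi> (op_add (op_scale b S) T) = op_add (op_scale b (\<phi> S)) (\<phi> T)"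
    if "S \<in> A" "T \<in> A" for b S T
    using assms(1) that unfolding ccp_map_def by blast
  have z: "\<phi> (\<lambda>_ _. 0) = (\<lambda>_ _. 0)"
  proof (intro ext)
    fix \<eta> j
    have "(\<lambda>_ _. 0) \<in> A" using assms(3)[of "{}"] by simp
    moreover have "op_add (op_scale 1 (\<lambda>_ _. 0)) (\<lambda>_ _. 0) = ((\<lambda>_ _. 0) :: 'i oper)"
      by (simp add: op_add_def op_scale_def)
    ultimately have "\<phi> (\<lambda>_ _. 0) = op_add (op_scale 1 (\<phi> (\<lambda>_ _. 0))) (\<phi> (\<lambda>_ _. 0))"
      using lin[of "\<lambda>_ _. 0" "\<lambda>_ _. 0" 1] by simp
    from fun_cong[OF fun_cong[OF this]]
    have "\<phi> (\<lambda>_ _. 0) \<eta> j = \<phi> (\<lambda>_ _. 0) \<eta> j + \<phi> (\<lambda>_ _. 0) \<eta> j"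
      unfolding op_add_def op_scale_def mult_1 .
    then show "\<phi> (\<lambda>_ _. 0) \<eta> j = 0" by simp
  qed
  from assms(2-) show ?thesis
  proof (induction X rule: finite_induct)
    case empty then show ?case using z by simp
  next
    case (insert x X)
    have "(\<lambda>\<xi> i. \<Sum>x\<in>X. c x * a x \<xi> i) \<in> A" using insert.prems(1)[of X] by blast
    from lin[OF insert.prems(2)[of x] this, of "c x"]
    have "\<phi> (\<lambda>\<xi> i. \<Sum>x\<in>insert x X. c x * a x \<xi> i)
        = op_add (op_scale (c x) (\<phi> (a x))) (\<phi> (\<lambda>\<xi> i. \<Sum>x\<in>X. c x * a x \<xi> i))"
      using insert.hyps by (simp add: op_add_def op_scale_def)
    also have "\<phi> (\<lambda>\<xi> i. \<Sum>x\<in>X. c x * a x \<xi> i) = (\<lambda>\<eta> j. \<Sum>x\<in>X. c x * \<phi> (a x) \<eta> j)"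
      by (rule insert.IH) (use insert.prems in auto)
    finally show ?case using insert.hyps by (simp add: op_add_def op_scale_def)
  qed
qed

context group begin

definition cut :: "'a set \<Rightarrow> ('a \<Rightarrow> complex) \<Rightarrow> 'a \<Rightarrow> complex" where
  "cut S \<xi> = (\<lambda>h. if h \<in> S then \<xi> h else 0)"

text \<open>This reduces inequalities between inner products of arbitrary vectors to finitely supported ones.\<close>
lemma cut_limit:
  assumes "\<xi> \<in> l2 (carrier G)" "\<eta> \<in> l2 (carrier G)" "g \<in> carrier G"
  shows "((\<lambda>S. l2_inner (carrier G) (left_regular G g (cut S \<xi>)) (cut S \<eta>)) \<longlongrightarrow>
     l2_inner (carrier G) (left_regular G g \<xi>) \<eta>) (finite_subsets_at_top (carrier G))"
proof -
  define f where "f h = left_regular G g \<xi> h * cnj (\<eta> h)" for h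
  define T where "T S = {h \<in> S. inv g \<otimes> h \<in> S}" for S
  have "(f has_sum l2_inner (carrier G) (left_regular G g \<xi>) \<eta>) (carrier G)"
    unfolding f_def l2_inner_def
    by (intro has_sum_infsum summable_l2_inner left_regular_l2 assms)
  then have 1: "(sum f \<longlongrightarrow> l2_inner (carrier G) (left_regular G g \<xi>) \<eta>) (finite_subsets_at_top (carrier G))"
    by (simp add: has_sum_def)
  have "filterlim T (finite_subsets_at_top (carrier G)) (finite_subsets_at_top (carrier G))"
    unfolding filterlim_finite_subsets_at_top eventually_finite_subsets_at_top
  proof (intro allI impI)
    fix X assume X: "finite X \<and> X \<subseteq> carrier G"
    show "\<exists>Y. finite Y \<and> Y \<subseteq> carrier G \<and> (\<forall>S. finite S \<and> Y \<subseteq> S \<and> S \<subseteq> carrier G \<longrightarrow>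
        finite (T S) \<and> X \<subseteq> T S \<and> T S \<subseteq> carrier G)"
      using X assms(3) by (intro exI[of _ "X \<union> (\<lambda>h. inv g \<otimes> h) ` X"]) (auto simp: T_def)
  qed
  from filterlim_compose[OF 1 this]
  show ?thesis
  proof (rule Lim_transform_eventually)
    have "sum f (T S) = l2_inner (carrier G) (left_regular G g (cut S \<xi>)) (cut S \<eta>)"
      if S: "finite S" "S \<subseteq> carrier G" for S
    proof -
      have l: "cut S \<xi> \<in> l2 (carrier G)"
        by (rule l2_finite_support[OF S]) (auto simp: cut_def)
      have "l2_inner (carrier G) (left_regular G g (cut S \<xi>)) (cut S \<eta>)
         = (\<Sum>h\<in>T S. left_regular G g (cut S \<xi>) h * cnj (cut S \<eta> h))"
        unfolding l2_inner_def
        by (rule infsum_finite_support) (use S in \<open>auto simp: T_def cut_def left_regular_def\<close>)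
      also have "\<dots> = sum f (T S)"
        by (rule sum.cong) (use S assms l in \<open>auto simp: T_def f_def cut_def left_regular_def\<close>)
      finally show ?thesis by simp
    qed
    then show "\<forall>\<^sub>F S in finite_subsets_at_top (carrier G).
       sum f (T S) = l2_inner (carrier G) (left_regular G g (cut S \<xi>)) (cut S \<eta>)"
      unfolding eventually_finite_subsets_at_top by blast
  qed
qed

lemma l2_inner_left_regular_inv:
  assumes "\<xi> \<in> l2 (carrier G)" "\<eta> \<in> l2 (carrier G)" "g \<in> carrier G"
  shows "l2_inner (carrier G) (left_regular G (inv g) \<xi>) \<eta> = cnj (l2_inner (carrier G) (left_regular G g \<eta>) \<xi>)"
proof -
  have b: "bij_betw (\<lambda>h. g \<otimes> h) (carrier G) (carrier G)"
    by (rule bij_betw_left_mult[OF assms(3)])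
  have "cnj (l2_inner (carrier G) (left_regular G g \<eta>) \<xi>)
     = (\<Sum>\<^sub>\<infinity>h\<in>carrier G. cnj (left_regular G g \<eta> h * cnj (\<xi> h)))"
    unfolding l2_inner_def by (rule infsum_cnj[symmetric])
  also have "\<dots> = (\<Sum>\<^sub>\<infinity>h\<in>carrier G. cnj (left_regular G g \<eta> (g \<otimes> h) * cnj (\<xi> (g \<otimes> h))))"
    using infsum_reindex_bij_betw[OF b, of "\<lambda>h. cnj (left_regular G g \<eta> h * cnj (\<xi> h))"] by simp
  also have "\<dots> = l2_inner (carrier G) (left_regular G (inv g) \<xi>) \<eta>"
    unfolding l2_inner_def
    by (rule infsum_cong) (use assms in \<open>simp add: left_regular_def m_assoc[symmetric] mult.commute\<close>)
  finally show ?thesis by simp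
qed

lemma left_regular_one: "\<xi> \<in> l2 (carrier G) \<Longrightarrow> left_regular G \<one> \<xi> = \<xi>"
  by (auto simp: left_regular_def fun_eq_iff l2_def)

lemma l2_inner_self:
  assumes "\<xi> \<in> l2 I"
  shows "l2_inner I \<xi> \<xi> = of_real ((l2_norm I \<xi>)\<^sup>2)"
proof -
  have "l2_inner I \<xi> \<xi> = (\<Sum>\<^sub>\<infinity>i\<in>I. of_real ((norm (\<xi> i))\<^sup>2))"
    unfolding l2_inner_def complex_norm_square ..
  also have "\<dots> = of_real (\<Sum>\<^sub>\<infinity>i\<in>I. (norm (\<xi> i))\<^sup>2)"
    by (rule infsumI) (use assms in \<open>simp only: has_sum_of_real_iff has_sum_infsum l2_def mem_Collect_eq\<close>)
  finally show ?thesis unfolding l2_norm_square .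
qed

text \<open>A positive operator matrix has hermitian coefficients; the symmetrised form on the left is needed to apply
  complete positivity, the one on the right is the functional that occurs in the separation argument.
  The identity is used for inner products of vectors and for the values of a completely positive map.\<close>
lemma hermitian_coefficient_sum:
  fixes u w :: "'a \<Rightarrow> nat \<Rightarrow> nat \<Rightarrow> complex"
  assumes E: "finite E" "E \<subseteq> carrier G" "\<one> \<in> E" "\<And>g. g \<in> E \<Longrightarrow> inv g \<in> E"
  shows "(\<Sum>i<n. \<Sum>j<n. \<Sum>g\<in>E. ((if i = j \<and> g = \<one> then \<kappa> else 0) - (cnj (w g i j) + w (inv g) j i) / 2) * u g i j)
    = \<kappa> * (\<Sum>i<n. u \<one> i i) -
      ((\<Sum>g\<in>E. \<Sum>i<n. \<Sum>j<n. cnj (w g i j) * u g i j) + (\<Sum>g\<in>E. \<Sum>i<n. \<Sum>j<n. w g i j * u (inv g) j i)) / 2"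
proof -
  have "(\<Sum>i<n. \<Sum>j<n. \<Sum>g\<in>E. ((if i = j \<and> g = \<one> then \<kappa> else 0) - (cnj (w g i j) + w (inv g) j i) / 2) * u g i j)
     = (\<Sum>i<n. \<Sum>j<n. \<Sum>g\<in>E. (if i = j then (if g = \<one> then \<kappa> * u g i j else 0) else 0))
      - ((\<Sum>i<n. \<Sum>j<n. \<Sum>g\<in>E. cnj (w g i j) * u g i j) + (\<Sum>i<n. \<Sum>j<n. \<Sum>g\<in>E. w (inv g) j i * u g i j)) / 2"
    unfolding sum_subtractf[symmetric] sum.distrib[symmetric] sum_divide_distrib
    by (intro sum.cong refl) (auto simp: field_simps)
  also have "(\<Sum>i<n. \<Sum>j<n. \<Sum>g\<in>E. (if i = j then (if g = \<one> then \<kappa> * u g i j else 0) else 0)) = \<kappa> * (\<Sum>i<n. u \<one> i i)"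
  proof -
    have "(\<Sum>j<n. \<Sum>g\<in>E. (if i = j then (if g = \<one> then \<kappa> * u g i j else 0) else 0)) = \<kappa> * u \<one> i i"
      if "i < n" for i
    proof -
      have "(\<Sum>j<n. \<Sum>g\<in>E. (if i = j then (if g = \<one> then \<kappa> * u g i j else 0) else 0))
         = (\<Sum>j<n. if i = j then (\<Sum>g\<in>E. (if g = \<one> then \<kappa> * u g i j else 0)) else 0)"
        by (intro sum.cong refl) auto
      then show ?thesis using that E by (simp add: sum.delta)
    qed
    then show ?thesis by (simp add: sum_distrib_left)
  qed
  also have "(\<Sum>i<n. \<Sum>j<n. \<Sum>g\<in>E. w (inv g) j i * u g i j) = (\<Sum>g\<in>E. \<Sum>i<n. \<Sum>j<n. w g i j * u (inv g) j i)"
  proof -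
    have "(\<Sum>i<n. \<Sum>j<n. \<Sum>g\<in>E. w (inv g) j i * u g i j) = (\<Sum>i<n. \<Sum>g\<in>E. \<Sum>j<n. w (inv g) j i * u g i j)"
      by (intro sum.cong refl sum.swap)
    also have "\<dots> = (\<Sum>g\<in>E. \<Sum>i<n. \<Sum>j<n. w (inv g) j i * u g i j)"
      by (rule sum.swap)
    also have "\<dots> = (\<Sum>g\<in>E. \<Sum>j<n. \<Sum>i<n. w (inv g) j i * u g i j)"
      by (intro sum.cong refl sum.swap)
    also have "\<dots> = (\<Sum>g\<in>E. \<Sum>i<n. \<Sum>j<n. w g i j * u (inv g) j i)"
      by (rule sum.reindex_bij_witness[of _ "\<lambda>g. inv g" "\<lambda>g. inv g"]) (use E in auto)
    finally show ?thesis .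
  qed
  also have "(\<Sum>i<n. \<Sum>j<n. \<Sum>g\<in>E. cnj (w g i j) * u g i j) = (\<Sum>g\<in>E. \<Sum>i<n. \<Sum>j<n. cnj (w g i j) * u g i j)"
  proof -
    have "(\<Sum>i<n. \<Sum>j<n. \<Sum>g\<in>E. cnj (w g i j) * u g i j) = (\<Sum>i<n. \<Sum>g\<in>E. \<Sum>j<n. cnj (w g i j) * u g i j)"
      by (intro sum.cong refl sum.swap)
    then show ?thesis using sum.swap by simp
  qed
  finally show ?thesis .
qed

definition finite_tuples :: "(nat \<Rightarrow> 'a \<Rightarrow> complex) set" where
  "finite_tuples = {\<xi>. \<exists>S. finite S \<and> S \<subseteq> carrier G \<and> (\<forall>i h. h \<notin> S \<longrightarrow> \<xi> i h = 0)}"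

definition shift_coeff :: "(nat \<Rightarrow> 'a \<Rightarrow> complex) \<Rightarrow> 'a \<Rightarrow> nat \<Rightarrow> nat \<Rightarrow> complex" where
  "shift_coeff \<xi> g i j = l2_inner (carrier G) (left_regular G g (\<xi> j)) (\<xi> i)"

lemma finite_tuples_l2: "\<xi> \<in> finite_tuples \<Longrightarrow> \<xi> i \<in> l2 (carrier G)"
  unfolding finite_tuples_def by (auto intro: l2_finite_support)

text \<open>The bound says that a certain self-adjoint operator matrix over the reduced C*-algebra is positive.  Its
  image under \<open>\<phi>\<close> is positive, too, and is tested on the tuple of all unit vectors.\<close>
lemma ccp_positive_combination:
  assumes E: "finite E" "E \<subseteq> carrier G" "\<one> \<in> E" "\<And>g. g \<in> E \<Longrightarrow> inv g \<in> E"
    and ccp: "ccp_map (carrier G) (reduced_group_cstar G) {..<n} (bounded_ops {..<n}) \<phi>"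
    and v: "\<And>g i j. v g i j = \<phi> (left_regular G g) (unit_vec j) i"
    and bound: "\<And>\<xi>. \<xi> \<in> finite_tuples \<Longrightarrow>
       Re (\<Sum>g\<in>E. \<Sum>i<n. \<Sum>j<n. cnj (w g i j) * shift_coeff \<xi> g i j) \<le> \<kappa> * (\<Sum>i<n. (l2_norm (carrier G) (\<xi> i))\<^sup>2)"
  shows "of_real \<kappa> * (\<Sum>i<n. v \<one> i i) -
      ((\<Sum>g\<in>E. \<Sum>i<n. \<Sum>j<n. cnj (w g i j) * v g i j) + (\<Sum>g\<in>E. \<Sum>i<n. \<Sum>j<n. w g i j * v (inv g) j i)) / 2
      \<in> \<real>\<^sub>\<ge>\<^sub>0"
proof -
  define C where "C i j g = (if i = j \<and> g = \<one> then of_real \<kappa> else 0) - (cnj (w g i j) + w (inv g) j i) / 2" for i j g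
  define a where "a i j = (\<lambda>\<xi> h. \<Sum>g\<in>E. C i j g * left_regular G g \<xi> h)" for i j
  have aA: "a i j \<in> reduced_group_cstar G" for i j
    unfolding a_def by (rule left_regular_combination_in_cstar) (use E in auto)
  \<comment> \<open>the bound extends from finitely supported tuples to all of l2\<close>
  have bound2: "Re (\<Sum>g\<in>E. \<Sum>i<n. \<Sum>j<n. cnj (w g i j) * shift_coeff \<xi> g i j) \<le> \<kappa> * Re (\<Sum>i<n. shift_coeff \<xi> \<one> i i)"
    if xi: "\<forall>i<n. \<xi> i \<in> l2 (carrier G)" for \<xi>
  proof (rule tendsto_le[OF finite_subsets_at_top_neq_bot])
    let ?x = "\<lambda>S i. cut S (\<xi> i)"
    have lim: "((\<lambda>S. shift_coeff (?x S) g i j) \<longlongrightarrow> shift_coeff \<xi> g i j) (finite_subsets_at_top (carrier G))"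
      if "g \<in> E" "i < n" "j < n" for g i j
      unfolding shift_coeff_def by (rule cut_limit) (use that xi E in auto)
    show "((\<lambda>S. Re (\<Sum>g\<in>E. \<Sum>i<n. \<Sum>j<n. cnj (w g i j) * shift_coeff (?x S) g i j)) \<longlongrightarrow>
        Re (\<Sum>g\<in>E. \<Sum>i<n. \<Sum>j<n. cnj (w g i j) * shift_coeff \<xi> g i j)) (finite_subsets_at_top (carrier G))"
      by (intro tendsto_Re tendsto_sum tendsto_mult tendsto_const lim) auto
    show "((\<lambda>S. \<kappa> * Re (\<Sum>i<n. shift_coeff (?x S) \<one> i i)) \<longlongrightarrow> \<kappa> * Re (\<Sum>i<n. shift_coeff \<xi> \<one> i i)) (finite_subsets_at_top (carrier G))"
      by (intro tendsto_mult tendsto_const tendsto_Re tendsto_sum lim) (use E in auto)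
    have "Re (\<Sum>g\<in>E. \<Sum>i<n. \<Sum>j<n. cnj (w g i j) * shift_coeff (?x S) g i j) \<le> \<kappa> * Re (\<Sum>i<n. shift_coeff (?x S) \<one> i i)"
      if S: "finite S" "S \<subseteq> carrier G" for S
    proof -
      have f: "?x S \<in> finite_tuples"
        unfolding finite_tuples_def using S by (auto simp: cut_def intro!: exI[of _ S])
      show ?thesis
        using bound[OF f] finite_tuples_l2[OF f]
        by (simp add: shift_coeff_def left_regular_one l2_inner_self)
    qed
    then show "\<forall>\<^sub>F S in finite_subsets_at_top (carrier G).
       Re (\<Sum>g\<in>E. \<Sum>i<n. \<Sum>j<n. cnj (w g i j) * shift_coeff (?x S) g i j) \<le> \<kappa> * Re (\<Sum>i<n. shift_coeff (?x S) \<one> i i)"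
      unfolding eventually_finite_subsets_at_top by blast
  qed
  have "positive_op_matrix (carrier G) n a"
    unfolding positive_op_matrix_def
  proof (intro allI impI)
    fix \<xi> :: "nat \<Rightarrow> 'a \<Rightarrow> complex" assume xi: "\<forall>i<n. \<xi> i \<in> l2 (carrier G)"
    let ?Z = "\<Sum>g\<in>E. \<Sum>i<n. \<Sum>j<n. cnj (w g i j) * shift_coeff \<xi> g i j"
    have "(\<Sum>i<n. \<Sum>j<n. l2_inner (carrier G) (a i j (\<xi> j)) (\<xi> i))
        = (\<Sum>i<n. \<Sum>j<n. \<Sum>g\<in>E. C i j g * shift_coeff \<xi> g i j)"
      unfolding a_def shift_coeff_def
      by (intro sum.cong refl l2_inner_sum_left) (use E xi left_regular_l2 in auto)
    also have "\<dots> = of_real \<kappa> * (\<Sum>i<n. shift_coeff \<xi> \<one> i i) -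
       (?Z + (\<Sum>g\<in>E. \<Sum>i<n. \<Sum>j<n. w g i j * shift_coeff \<xi> (inv g) j i)) / 2"
      unfolding C_def by (rule hermitian_coefficient_sum[OF E])
    also have "(\<Sum>g\<in>E. \<Sum>i<n. \<Sum>j<n. w g i j * shift_coeff \<xi> (inv g) j i) = cnj ?Z"
      unfolding shift_coeff_def cnj_sum
      by (intro sum.cong refl) (use E xi in \<open>auto simp: l2_inner_left_regular_inv\<close>)
    also have "of_real \<kappa> * (\<Sum>i<n. shift_coeff \<xi> \<one> i i) = of_real (\<kappa> * Re (\<Sum>i<n. shift_coeff \<xi> \<one> i i))"
    proof -
      have "(\<Sum>i<n. shift_coeff \<xi> \<one> i i) = of_real (\<Sum>i<n. (l2_norm (carrier G) (\<xi> i))\<^sup>2)"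
        using xi by (simp add: shift_coeff_def left_regular_one l2_inner_self)
      then show ?thesis by simp
    qed
    also have "\<dots> - (?Z + cnj ?Z) / 2 = of_real (\<kappa> * Re (\<Sum>i<n. shift_coeff \<xi> \<one> i i) - Re ?Z)"
      by (simp only: complex_add_cnj) simp
    finally show "(\<Sum>i<n. \<Sum>j<n. l2_inner (carrier G) (a i j (\<xi> j)) (\<xi> i)) \<in> \<real>\<^sub>\<ge>\<^sub>0"
      using bound2[OF xi] by (simp only: nonneg_Reals_of_real_iff diff_ge_0_iff_ge)
  qed
  then have "positive_op_matrix {..<n} n (\<lambda>i j. \<phi> (a i j))"
    using ccp aA unfolding ccp_map_def by blast
  then have "(\<Sum>i<n. \<Sum>j<n. l2_inner {..<n} (\<phi> (a i j) (unit_vec j)) (unit_vec i)) \<in> \<real>\<^sub>\<ge>\<^sub>0"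
    unfolding positive_op_matrix_def using unit_vec_l2[of _ "{..<n}"] by simp
  also have "(\<Sum>i<n. \<Sum>j<n. l2_inner {..<n} (\<phi> (a i j) (unit_vec j)) (unit_vec i))
     = (\<Sum>i<n. \<Sum>j<n. \<Sum>g\<in>E. C i j g * v g i j)"
  proof (intro sum.cong refl)
    fix i j assume i: "i \<in> {..<n}" "j \<in> {..<n}"
    have "\<phi> (a i j) = (\<lambda>\<eta> k. \<Sum>g\<in>E. C i j g * \<phi> (left_regular G g) \<eta> k)"
      unfolding a_def
    proof (rule ccp_map_sum[OF ccp E(1)])
      fix X' assume "X' \<subseteq> E"
      then show "(\<lambda>\<xi> h. \<Sum>g\<in>X'. C i j g * left_regular G g \<xi> h) \<in> reduced_group_cstar G"
        using E finite_subset by (intro left_regular_combination_in_cstar) auto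
    qed (use E left_regular_in_cstar in auto)
    then show "l2_inner {..<n} (\<phi> (a i j) (unit_vec j)) (unit_vec i) = (\<Sum>g\<in>E. C i j g * v g i j)"
      using i by (simp add: l2_inner_unit_vec v)
  qed
  also have "\<dots> = of_real \<kappa> * (\<Sum>i<n. v \<one> i i) -
      ((\<Sum>g\<in>E. \<Sum>i<n. \<Sum>j<n. cnj (w g i j) * v g i j) + (\<Sum>g\<in>E. \<Sum>i<n. \<Sum>j<n. w g i j * v (inv g) j i)) / 2"
    unfolding C_def by (rule hermitian_coefficient_sum[OF E])
  finally show ?thesis .
qed

lemma cmod_l2_inner_le:
  assumes "\<xi> \<in> l2 I" "\<eta> \<in> l2 I"
  shows "cmod (l2_inner I \<xi> \<eta>) \<le> ((l2_norm I \<xi>)\<^sup>2 + (l2_norm I \<eta>)\<^sup>2) / 2"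
proof -
  have s: "(\<lambda>i. (cmod (\<xi> i))\<^sup>2 / 2 + (cmod (\<eta> i))\<^sup>2 / 2) summable_on I"
    "(\<lambda>i. (cmod (\<xi> i))\<^sup>2 / 2) summable_on I" "(\<lambda>i. (cmod (\<eta> i))\<^sup>2 / 2) summable_on I"
    using assms summable_on_cmult_left[of _ I "1/2 :: real"] unfolding l2_def
    by (auto intro!: summable_on_add)
  have le: "cmod (\<xi> i * cnj (\<eta> i)) \<le> (cmod (\<xi> i))\<^sup>2 / 2 + (cmod (\<eta> i))\<^sup>2 / 2" for i
    using sum_squares_bound[of "cmod (\<xi> i)" "cmod (\<eta> i)"] by (simp add: norm_mult)
  have s1: "(\<lambda>i. cmod (\<xi> i * cnj (\<eta> i))) summable_on I"
  proof (rule summable_on_comparison_test)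
    show "(\<lambda>i. (cmod (\<xi> i))\<^sup>2 / 2 + (cmod (\<eta> i))\<^sup>2 / 2) summable_on I" by (rule s(1))
    show "cmod (\<xi> i * cnj (\<eta> i)) \<le> (cmod (\<xi> i))\<^sup>2 / 2 + (cmod (\<eta> i))\<^sup>2 / 2" for i by (rule le)
  qed simp
  have "cmod (l2_inner I \<xi> \<eta>) \<le> (\<Sum>\<^sub>\<infinity>i\<in>I. cmod (\<xi> i * cnj (\<eta> i)))"
    unfolding l2_inner_def by (rule norm_infsum_bound[OF s1])
  also have "\<dots> \<le> (\<Sum>\<^sub>\<infinity>i\<in>I. (cmod (\<xi> i))\<^sup>2 / 2 + (cmod (\<eta> i))\<^sup>2 / 2)"
    by (rule infsum_mono[OF s1 s(1)]) (rule le)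
  also have "\<dots> = (\<Sum>\<^sub>\<infinity>i\<in>I. (cmod (\<xi> i))\<^sup>2 / 2) + (\<Sum>\<^sub>\<infinity>i\<in>I. (cmod (\<eta> i))\<^sup>2 / 2)"
    by (rule infsum_add[OF s(2,3)])
  also have "\<dots> = ((l2_norm I \<xi>)\<^sup>2 + (l2_norm I \<eta>)\<^sup>2) / 2"
    unfolding l2_norm_square
    using infsum_cmult_left'[of "\<lambda>i. (cmod (\<xi> i))\<^sup>2" "1/2" I]
      infsum_cmult_left'[of "\<lambda>i. (cmod (\<eta> i))\<^sup>2" "1/2" I] by (simp add: add_divide_distrib)
  finally show ?thesis .
qed

lemma cmod_shift_coeff_le:
  assumes "\<xi> \<in> finite_tuples" "g \<in> carrier G" "i < n" "j < n"
  shows "cmod (shift_coeff \<xi> g i j) \<le> (\<Sum>i<n. (l2_norm (carrier G) (\<xi> i))\<^sup>2)"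
proof -
  have "cmod (shift_coeff \<xi> g i j) \<le> ((l2_norm (carrier G) (\<xi> j))\<^sup>2 + (l2_norm (carrier G) (\<xi> i))\<^sup>2) / 2"
    unfolding shift_coeff_def
    using cmod_l2_inner_le[OF left_regular_l2(1) finite_tuples_l2, OF assms(2) finite_tuples_l2 assms(1)]
      assms left_regular_l2(2) finite_tuples_l2 by simp
  moreover have "(l2_norm (carrier G) (\<xi> k))\<^sup>2 \<le> (\<Sum>i<n. (l2_norm (carrier G) (\<xi> i))\<^sup>2)" if "k < n" for k
    by (rule member_le_sum) (use that in auto)
  from this[OF assms(3)] this[OF assms(4)]
  have "((l2_norm (carrier G) (\<xi> j))\<^sup>2 + (l2_norm (carrier G) (\<xi> i))\<^sup>2) / 2 \<le> (\<Sum>i<n. (l2_norm (carrier G) (\<xi> i))\<^sup>2)"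
    by simp
  ultimately show ?thesis by (rule order_trans)
qed

lemma finite_tuples_scale:
  assumes "\<xi> \<in> finite_tuples"
  shows "(\<lambda>i h. c * \<xi> i h) \<in> finite_tuples"
proof -
  obtain S where "finite S" "S \<subseteq> carrier G" "\<forall>i h. h \<notin> S \<longrightarrow> \<xi> i h = 0"
    using assms unfolding finite_tuples_def by blast
  then show ?thesis unfolding finite_tuples_def by (intro CollectI exI[of _ S]) simp
qed

lemma shift_coeff_scale:
  assumes "\<xi> \<in> finite_tuples"
  shows "shift_coeff (\<lambda>i h. of_real r * \<xi> i h) g i j = of_real (r\<^sup>2) * shift_coeff \<xi> g i j"
proof -
  have l: "\<xi> j \<in> l2 (carrier G)" "(\<lambda>h. of_real r * \<xi> j h) \<in> l2 (carrier G)"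
    using finite_tuples_l2[OF assms] finite_tuples_l2[OF finite_tuples_scale[OF assms, of "of_real r"]] by auto
  have "left_regular G g (\<lambda>h. of_real r * \<xi> j h) h * cnj (of_real r * \<xi> i h)
      = of_real (r\<^sup>2) * (left_regular G g (\<xi> j) h * cnj (\<xi> i h))" for h
    using l by (simp add: left_regular_def power2_eq_square)
  then show ?thesis unfolding shift_coeff_def l2_inner_def by (simp only: infsum_cmult_right')
qed

lemma sum_triple_delta:
  fixes f :: "'c \<Rightarrow> nat \<Rightarrow> nat \<Rightarrow> complex"
  assumes "finite E" "g \<in> E" "i < n" "j < n"
  shows "(\<Sum>g'\<in>E. \<Sum>i'<n. \<Sum>j'<n. if g' = g \<and> i' = i \<and> j' = j then f g' i' j' else 0) = f g i j"
proof -
  have "(\<Sum>g'\<in>E. \<Sum>i'<n. \<Sum>j'<n. if g' = g \<and> i' = i \<and> j' = j then f g' i' j' else 0)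
     = (\<Sum>x\<in>E \<times> {..<n} \<times> {..<n}. if x = (g, i, j) then f g i j else 0)"
    unfolding sum.cartesian_product by (rule sum.cong) (auto split: if_splits)
  also have "\<dots> = f g i j" using assms by (simp add: sum.delta)
  finally show ?thesis .
qed

text \<open>The coefficients of the maps that come from tuples of finitely supported vectors generate a convex cone.  A
  functional that is at most \<open>\<kappa>\<close> times the square norm on these tuples defines a positive operator matrix, so it
  is at most \<open>\<kappa> n\<close> at the coefficients of \<open>\<phi>\<close>.  No functional separates them from the cone.\<close>
lemma ccp_coefficients_approximable:
  assumes E: "finite E" "E \<subseteq> carrier G" "\<one> \<in> E" "\<And>g. g \<in> E \<Longrightarrow> inv g \<in> E"
    and ccp: "ccp_map (carrier G) (reduced_group_cstar G) {..<n} (bounded_ops {..<n}) \<phi>"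
    and v: "\<And>g i j. v g i j = \<phi> (left_regular G g) (unit_vec j) i"
    and eps: "\<epsilon> > 0"
  shows "\<exists>(m::nat) \<Xi>. (\<forall>k<m. \<Xi> k \<in> finite_tuples) \<and>
    (\<forall>g\<in>E. \<forall>i<n. \<forall>j<n. (cmod (v g i j - (\<Sum>k<m. shift_coeff (\<Xi> k) g i j)))\<^sup>2 < \<epsilon>)"
proof -
  define N where "N \<xi> = (\<Sum>i<n. (l2_norm (carrier G) (\<xi> i))\<^sup>2)" for \<xi> :: "nat \<Rightarrow> 'a \<Rightarrow> complex"
  have N0: "N \<xi> \<ge> 0" for \<xi> unfolding N_def by (simp add: sum_nonneg)
  define X where "X = (\<Sum>i<n. v \<one> i i)"
  have pos: "of_real \<kappa> * X -
      ((\<Sum>g\<in>E. \<Sum>i<n. \<Sum>j<n. cnj (w g i j) * v g i j) + (\<Sum>g\<in>E. \<Sum>i<n. \<Sum>j<n. w g i j * v (inv g) j i)) / 2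
      \<in> \<real>\<^sub>\<ge>\<^sub>0"
    if "\<And>\<xi>. \<xi> \<in> finite_tuples \<Longrightarrow> Re (\<Sum>g\<in>E. \<Sum>i<n. \<Sum>j<n. cnj (w g i j) * shift_coeff \<xi> g i j) \<le> \<kappa> * N \<xi>"
    for w \<kappa>
    unfolding X_def by (rule ccp_positive_combination[OF E ccp v that[unfolded N_def]])
  have "X \<in> \<real>\<^sub>\<ge>\<^sub>0" using pos[of "\<lambda>_ _ _. 0" 1] N0 by simp
  then have imX: "Im X = 0" by (simp add: complex_nonneg_Reals_iff)
  \<comment> \<open>testing on a single coefficient \<open>b\<close>, for \<open>b = 1\<close> and \<open>b = \<i>\<close>, shows that \<open>\<phi>\<close> respects adjoints\<close>
  have herm: "v (inv g) j i = cnj (v g i j)" if gij: "g \<in> E" "i < n" "j < n" for g i j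
  proof -
    have "Im (cnj b * v g i j + b * v (inv g) j i) = 0" for b
    proof -
      define w where "w g' i' j' = (if g' = g \<and> i' = i \<and> j' = j then b else 0)" for g' i' j'
      have pick: "(\<Sum>g'\<in>E. \<Sum>i'<n. \<Sum>j'<n. cnj (w g' i' j') * u g' i' j') = cnj b * u g i j"
        "(\<Sum>g'\<in>E. \<Sum>i'<n. \<Sum>j'<n. w g' i' j' * u g' i' j') = b * u g i j" for u
      proof -
        have "cnj (w g' i' j') * u g' i' j' = (if g' = g \<and> i' = i \<and> j' = j then cnj b * u g' i' j' else 0)"
          "w g' i' j' * u g' i' j' = (if g' = g \<and> i' = i \<and> j' = j then b * u g' i' j' else 0)" for g' i' j'
          by (simp_all add: w_def)
        then show "(\<Sum>g'\<in>E. \<Sum>i'<n. \<Sum>j'<n. cnj (w g' i' j') * u g' i' j') = cnj b * u g i j"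
          "(\<Sum>g'\<in>E. \<Sum>i'<n. \<Sum>j'<n. w g' i' j' * u g' i' j') = b * u g i j"
          using sum_triple_delta[OF E(1) gij] by simp_all
      qed
      have "of_real (cmod b) * X - (cnj b * v g i j + b * v (inv g) j i) / 2 \<in> \<real>\<^sub>\<ge>\<^sub>0"
        using pos[of w "cmod b"] unfolding pick
      proof -
        assume *: "(\<And>\<xi>. \<xi> \<in> finite_tuples \<Longrightarrow> Re (cnj b * shift_coeff \<xi> g i j) \<le> cmod b * N \<xi>) \<Longrightarrow>
          of_real (cmod b) * X - (cnj b * v g i j + b * v (inv g) j i) / 2 \<in> \<real>\<^sub>\<ge>\<^sub>0"
        show ?thesis
        proof (rule *)
          fix \<xi> assume xi: "\<xi> \<in> finite_tuples"
          have "Re (cnj b * shift_coeff \<xi> g i j) \<le> cmod (cnj b * shift_coeff \<xi> g i j)" by (rule complex_Re_le_cmod)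
          also have "\<dots> \<le> cmod b * N \<xi>"
            unfolding norm_mult complex_mod_cnj N_def
            by (intro mult_left_mono cmod_shift_coeff_le xi) (use gij E in auto)
          finally show "Re (cnj b * shift_coeff \<xi> g i j) \<le> cmod b * N \<xi>" .
        qed
      qed
      then show ?thesis using imX by (simp add: complex_nonneg_Reals_iff)
    qed
    from this[of 1] this[of \<i>] show ?thesis by (simp add: complex_eq_iff)
  qed
  have one: "Re X \<le> n"
  proof -
    have "cmod (v \<one> i i) \<le> 1" if "i < n" for i
    proof -
      have A: "left_regular G \<one> \<in> reduced_group_cstar G" by (rule left_regular_in_cstar) simp
      have "cmod (v \<one> i i) \<le> op_norm {..<n} (\<phi> (left_regular G \<one>))"
        unfolding v by (rule op_entry_le_op_norm) (use ccp A that in \<open>auto simp: ccp_map_def\<close>)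
      also have "\<dots> \<le> op_norm (carrier G) (left_regular G \<one>)" using ccp A unfolding ccp_map_def by blast
      also have "\<dots> \<le> 1" by (rule op_norm_left_regular_le) simp
      finally show ?thesis .
    qed
    then have "Re (v \<one> i i) \<le> 1" if "i < n" for i
      using that complex_Re_le_cmod order_trans by blast
    then have "(\<Sum>i<n. Re (v \<one> i i)) \<le> (\<Sum>i<n. 1)" by (intro sum_mono) auto
    then show ?thesis unfolding X_def by simp
  qed
  define J where "J = E \<times> {..<n} \<times> {..<n}"
  have finJ: "finite J" unfolding J_def using E by simp
  define s where "s \<xi> = (\<lambda>(g, i, j). shift_coeff \<xi> g i j)" for \<xi>
  define V where "V = (\<lambda>(g, i, j). v g i j)"
  define B where "B = 1 + real (card J)"
  define C where "C = {c. \<exists>(m::nat) \<Xi>. (\<forall>k<m. \<Xi> k \<in> finite_tuples) \<and> (\<forall>x. c x = (\<Sum>k<m. s (\<Xi> k) x))}"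
  have nest: "(\<Sum>x\<in>J. f x) = (\<Sum>g\<in>E. \<Sum>i<n. \<Sum>j<n. f (g, i, j))" for f :: "_ \<Rightarrow> complex"
    unfolding J_def by (simp add: sum.cartesian_product case_prod_unfold)
  have sscale: "s (\<lambda>i h. of_real (sqrt t) * \<xi> i h) x = of_real t * s \<xi> x"
    if "\<xi> \<in> finite_tuples" "t \<ge> 0" for \<xi> t x
    using that shift_coeff_scale[of \<xi> "sqrt t"] unfolding s_def by (cases x) simp
  have "\<exists>c\<in>C. (\<Sum>x\<in>J. (cmod (V x - c x))\<^sup>2) < \<epsilon>"
  proof (rule cone_approximates_if_weakly_dominated[where s = s and N = N and P = finite_tuples and B = B and M = n])
    fix \<xi> assume xi: "\<xi> \<in> finite_tuples"
    have "(cmod (s \<xi> x))\<^sup>2 \<le> (N \<xi>)\<^sup>2" if "x \<in> J" for x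
      using cmod_shift_coeff_le[OF xi] that E unfolding s_def J_def N_def by (auto intro!: power_mono)
    then have "(\<Sum>x\<in>J. (cmod (s \<xi> x))\<^sup>2) \<le> (\<Sum>x\<in>J. (N \<xi>)\<^sup>2)" by (rule sum_mono)
    also have "\<dots> = real (card J) * (N \<xi>)\<^sup>2" by simp
    also have "\<dots> \<le> B\<^sup>2 * (N \<xi>)\<^sup>2" unfolding B_def by (intro mult_right_mono) (auto simp: power2_sum)
    finally show "(\<Sum>x\<in>J. (cmod (s \<xi> x))\<^sup>2) \<le> (B * N \<xi>)\<^sup>2" by (simp add: power_mult_distrib)
  next
    fix w :: "'a \<times> nat \<times> nat \<Rightarrow> complex" and \<kappa> :: real
    assume w: "\<And>\<xi>. \<xi> \<in> finite_tuples \<Longrightarrow> Re (\<Sum>x\<in>J. cnj (w x) * s \<xi> x) \<le> \<kappa> * N \<xi>" and k: "\<kappa> \<ge> 0"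
    define Z where "Z = (\<Sum>g\<in>E. \<Sum>i<n. \<Sum>j<n. cnj (w (g, i, j)) * v g i j)"
    have "of_real \<kappa> * X - (Z + (\<Sum>g\<in>E. \<Sum>i<n. \<Sum>j<n. w (g, i, j) * v (inv g) j i)) / 2 \<in> \<real>\<^sub>\<ge>\<^sub>0"
      unfolding Z_def by (rule pos) (use w in \<open>simp add: nest s_def\<close>)
    also have "(\<Sum>g\<in>E. \<Sum>i<n. \<Sum>j<n. w (g, i, j) * v (inv g) j i) = cnj Z"
      unfolding Z_def cnj_sum by (intro sum.cong refl) (simp add: herm)
    finally have "Re (of_real \<kappa> * X - (Z + cnj Z) / 2) \<ge> 0" by (simp only: complex_nonneg_Reals_iff)
    then have "Re Z \<le> \<kappa> * Re X" by simp
    also have "\<dots> \<le> \<kappa> * n" using one k by (rule mult_left_mono)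
    finally show "Re (\<Sum>x\<in>J. cnj (w x) * V x) \<le> \<kappa> * n" unfolding Z_def nest V_def by simp
  next
    show "C \<noteq> {}" unfolding C_def by (auto intro!: exI[of _ "0::nat"])
  next
    fix c \<xi> and t :: real assume c: "c \<in> C" and xi: "\<xi> \<in> finite_tuples" and t: "t \<ge> 0"
    obtain m :: nat and \<Xi> where m: "\<forall>k<m. \<Xi> k \<in> finite_tuples" "\<forall>x. c x = (\<Sum>k<m. s (\<Xi> k) x)"
      using c unfolding C_def by blast
    define \<Xi>' where "\<Xi>' = \<Xi>(m := (\<lambda>i h. of_real (sqrt t) * \<xi> i h))"
    have "(\<Sum>k<m. s (\<Xi>' k) x) = c x" for x unfolding m(2)[rule_format] \<Xi>'_def by (intro sum.cong) auto
    moreover have "s (\<Xi>' m) x = of_real t * s \<xi> x" for x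
      unfolding \<Xi>'_def using sscale[OF xi t] by simp
    ultimately have "\<forall>x. c x + of_real t * s \<xi> x = (\<Sum>k<Suc m. s (\<Xi>' k) x)" by simp
    moreover have "\<forall>k<Suc m. \<Xi>' k \<in> finite_tuples"
      unfolding \<Xi>'_def using m(1) finite_tuples_scale[OF xi] by (auto simp: less_Suc_eq)
    ultimately show "(\<lambda>x. c x + of_real t * s \<xi> x) \<in> C" unfolding C_def by blast
  next
    fix c and t :: real assume c: "c \<in> C" and t: "t \<ge> 0"
    obtain m :: nat and \<Xi> where m: "\<forall>k<m. \<Xi> k \<in> finite_tuples" "\<forall>x. c x = (\<Sum>k<m. s (\<Xi> k) x)"
      using c unfolding C_def by blast
    define \<Xi>' where "\<Xi>' k = (\<lambda>i h. of_real (sqrt t) * \<Xi> k i h)" for k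
    have "\<forall>x. of_real t * c x = (\<Sum>k<m. s (\<Xi>' k) x)"
      unfolding m(2)[rule_format] sum_distrib_left \<Xi>'_def by (intro allI sum.cong refl) (use sscale m(1) t in simp)
    moreover have "\<forall>k<m. \<Xi>' k \<in> finite_tuples"
      unfolding \<Xi>'_def using m(1) finite_tuples_scale by auto
    ultimately show "(\<lambda>x. of_real t * c x) \<in> C" unfolding C_def by blast
  qed (use eps N0 in \<open>auto simp: B_def\<close>)
  then obtain c where c: "c \<in> C" "(\<Sum>x\<in>J. (cmod (V x - c x))\<^sup>2) < \<epsilon>" by blast
  obtain m :: nat and \<Xi> where m0: "\<forall>k<m. \<Xi> k \<in> finite_tuples" "\<forall>x. c x = (\<Sum>k<m. s (\<Xi> k) x)"
    using c(1) unfolding C_def by blast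
  have m: "\<forall>k<m. \<Xi> k \<in> finite_tuples"
    "(\<Sum>x\<in>J. (cmod (V x - (\<Sum>k<m. s (\<Xi> k) x)))\<^sup>2) < \<epsilon>"
    using m0(1) c(2) unfolding m0(2)[rule_format] by simp_all
  have "\<forall>x\<in>J. (cmod (V x - (\<Sum>k<m. s (\<Xi> k) x)))\<^sup>2 < \<epsilon>"
  proof
    fix x assume "x \<in> J"
    from member_le_sum[OF this, of "\<lambda>x. (cmod (V x - (\<Sum>k<m. s (\<Xi> k) x)))\<^sup>2"] finJ m(2)
    show "(cmod (V x - (\<Sum>k<m. s (\<Xi> k) x)))\<^sup>2 < \<epsilon>" by simp
  qed
  then have "(cmod (v g i j - (\<Sum>k<m. shift_coeff (\<Xi> k) g i j)))\<^sup>2 < \<epsilon>" if "g \<in> E" "i < n" "j < n" for g i j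
    using that unfolding J_def V_def s_def by (force dest: bspec[of _ _ "(g, i, j)"])
  then show ?thesis using m(1) by blast
qed

end

section \<open>The kernel of a completely positive map out of matrices\<close>

lemma bounded_op_sum_apply:
  assumes "T \<in> bounded_ops I" "finite X" "\<And>x. x \<in> X \<Longrightarrow> \<xi> x \<in> l2 I"
  shows "T (\<lambda>i. \<Sum>x\<in>X. c x * \<xi> x i) = (\<lambda>i. \<Sum>x\<in>X. c x * T (\<xi> x) i)"
  using assms(2,3)
proof (induction X rule: finite_induct)
  case empty
  have "T (\<lambda>i. 1 * 0 + 0) = (\<lambda>i. 1 * T (\<lambda>i. 0) i + T (\<lambda>i. 0) i)"
    by (rule bounded_opsD(3)[OF assms(1) l2_zero l2_zero])
  then have "T (\<lambda>i. 0) i = T (\<lambda>i. 0) i + T (\<lambda>i. 0) i" for i by (simp add: fun_eq_iff)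
  then have "T (\<lambda>i. 0) i = 0" for i by (metis add_cancel_right_right)
  then show ?case by (simp add: fun_eq_iff)
next
  case (insert x X)
  then show ?case
    using bounded_opsD(3)[OF assms(1), of "\<xi> x" "\<lambda>i. \<Sum>x\<in>X. c x * \<xi> x i" "c x"] l2_sum[of X \<xi> I c]
    by simp
qed

definition matrix_unit :: "nat \<Rightarrow> nat \<Rightarrow> nat \<Rightarrow> nat oper" where
  "matrix_unit n i j = (\<lambda>\<xi> k. if \<xi> \<in> l2 {..<n} \<and> k = i then \<xi> j else 0)"

lemma matrix_unit_bounded:
  assumes "i < n" "j < n"
  shows "matrix_unit n i j \<in> bounded_ops {..<n}" "op_norm {..<n} (matrix_unit n i j) \<le> 1"
proof -
  have l: "matrix_unit n i j \<xi> \<in> l2 {..<n}" for \<xi>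
    by (rule l2_finite_support[of "{i}"]) (use assms in \<open>auto simp: matrix_unit_def\<close>)
  have nrm: "l2_norm {..<n} (matrix_unit n i j \<xi>) \<le> l2_norm {..<n} \<xi>" if "\<xi> \<in> l2 {..<n}" for \<xi>
  proof -
    have "l2_norm {..<n} (matrix_unit n i j \<xi>) = sqrt ((cmod (\<xi> j))\<^sup>2)"
      unfolding l2_norm_def
      by (subst infsum_finite_support[of "{i}"]) (use assms that in \<open>auto simp: matrix_unit_def\<close>)
    then show ?thesis using norm_le_l2_norm[OF that, of j] assms by simp
  qed
  show "matrix_unit n i j \<in> bounded_ops {..<n}"
  proof (rule bounded_opsI[where C = 1])
    fix \<xi> \<eta> :: "nat \<Rightarrow> complex" and c assume "\<xi> \<in> l2 {..<n}" "\<eta> \<in> l2 {..<n}"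
    then show "matrix_unit n i j (\<lambda>i. c * \<xi> i + \<eta> i) = (\<lambda>k. c * matrix_unit n i j \<xi> k + matrix_unit n i j \<eta> k)"
      using l2_lincomb[of \<xi> "{..<n}" \<eta> c] by (auto simp: matrix_unit_def fun_eq_iff)
  next
    fix \<xi> :: "nat \<Rightarrow> complex" assume "\<xi> \<in> l2 {..<n}"
    then show "l2_norm {..<n} (matrix_unit n i j \<xi>) \<le> 1 * l2_norm {..<n} \<xi>" using nrm by simp
  qed (rule l, simp add: matrix_unit_def)
  show "op_norm {..<n} (matrix_unit n i j) \<le> 1"
    by (rule op_norm_le) (rule order_trans[OF nrm])
qed

lemma matrix_unit_expansion:
  assumes "b \<in> bounded_ops {..<n}"
  shows "b = (\<lambda>\<xi> k. \<Sum>x\<in>{..<n} \<times> {..<n}. b (unit_vec (snd x)) (fst x) * matrix_unit n (fst x) (snd x) \<xi> k)"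
proof (intro ext)
  fix \<xi> k
  show "b \<xi> k = (\<Sum>x\<in>{..<n} \<times> {..<n}. b (unit_vec (snd x)) (fst x) * matrix_unit n (fst x) (snd x) \<xi> k)"
  proof (cases "\<xi> \<in> l2 {..<n}")
    case False
    then show ?thesis using bounded_opsD(2)[OF assms] by (simp add: matrix_unit_def)
  next
    case True
    have "\<xi> i = (\<Sum>j<n. \<xi> j * unit_vec j i)" for i
    proof -
      have "(\<Sum>j<n. \<xi> j * unit_vec j i) = (\<Sum>j<n. if j = i then \<xi> i else 0)"
        by (intro sum.cong) auto
      then show ?thesis using True by (simp add: l2_def)
    qed
    then have "\<xi> = (\<lambda>i. \<Sum>j<n. \<xi> j * unit_vec j i)" by (rule ext)
    then have "b \<xi> = b (\<lambda>i. \<Sum>j<n. \<xi> j * unit_vec j i)" by (rule arg_cong)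
    also have "\<dots> = (\<lambda>i. \<Sum>j<n. \<xi> j * b (unit_vec j) i)"
      by (rule bounded_op_sum_apply[OF assms]) (auto intro: unit_vec_l2)
    finally have e: "b \<xi> k = (\<Sum>j<n. \<xi> j * b (unit_vec j) k)" by simp
    have "(\<Sum>x\<in>{..<n} \<times> {..<n}. b (unit_vec (snd x)) (fst x) * matrix_unit n (fst x) (snd x) \<xi> k)
      = (\<Sum>i<n. \<Sum>j<n. b (unit_vec j) i * matrix_unit n i j \<xi> k)"
      by (simp add: sum.cartesian_product case_prod_unfold)
    also have "\<dots> = (\<Sum>i<n. if i = k then (\<Sum>j<n. \<xi> j * b (unit_vec j) k) else 0)"
      using True by (intro sum.cong refl) (auto simp: matrix_unit_def mult.commute)
    also have "\<dots> = b \<xi> k"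
    proof (cases "k < n")
      case True then show ?thesis using e by simp
    next
      case False
      then show ?thesis using bounded_opsD(1)[OF assms True] by (auto simp: l2_def)
    qed
    finally show ?thesis by simp
  qed
qed

text \<open>The quadratic form of the matrix of all matrix units is the square of the sum of the diagonal entries.\<close>
lemma matrix_units_positive: "positive_op_matrix {..<n} n (matrix_unit n)"
  unfolding positive_op_matrix_def
proof (intro allI impI)
  fix \<xi> :: "nat \<Rightarrow> nat \<Rightarrow> complex" assume xi: "\<forall>i<n. \<xi> i \<in> l2 {..<n}"
  have "l2_inner {..<n} (matrix_unit n i j (\<xi> j)) (\<xi> i) = \<xi> j j * cnj (\<xi> i i)" if "i < n" "j < n" for i j
    unfolding l2_inner_def
    by (subst infsum_finite_support[of "{i}"]) (use that xi in \<open>auto simp: matrix_unit_def\<close>)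
  then have "(\<Sum>i<n. \<Sum>j<n. l2_inner {..<n} (matrix_unit n i j (\<xi> j)) (\<xi> i))
     = (\<Sum>i<n. \<Sum>j<n. \<xi> j j * cnj (\<xi> i i))" by simp
  also have "\<dots> = (\<Sum>j<n. \<xi> j j) * cnj (\<Sum>i<n. \<xi> i i)"
    by (subst sum.swap) (simp add: sum_product)
  also have "\<dots> = of_real ((cmod (\<Sum>j<n. \<xi> j j))\<^sup>2)" by (rule complex_norm_square[symmetric])
  finally show "(\<Sum>i<n. \<Sum>j<n. l2_inner {..<n} (matrix_unit n i j (\<xi> j)) (\<xi> i)) \<in> \<real>\<^sub>\<ge>\<^sub>0"
    by (simp only: nonneg_Reals_of_real_iff zero_le_power2)
qed

text \<open>Positivity of the operator matrix \<open>p\<close> on the vectors with blocks \<open>\<alpha>\<close> at \<open>s\<close> and \<open>\<beta>\<close> at \<open>t\<close>.  Two points at a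
  time suffice to compare the weights at \<open>t\<close> and \<open>g t\<close>.\<close>
definition positive_kernel :: "nat \<Rightarrow> 'i set \<Rightarrow> (nat \<Rightarrow> nat \<Rightarrow> 'i \<Rightarrow> 'i \<Rightarrow> complex) \<Rightarrow> bool" where
  "positive_kernel n I p \<longleftrightarrow> (\<forall>s\<in>I. \<forall>t\<in>I. \<forall>\<alpha> \<beta> :: nat \<Rightarrow> complex.
     (\<Sum>i<n. \<Sum>j<n. \<alpha> j * cnj (\<alpha> i) * p i j s s + \<beta> j * cnj (\<alpha> i) * p i j s t
        + (\<alpha> j * cnj (\<beta> i) * p i j t s + \<beta> j * cnj (\<beta> i) * p i j t t)) \<in> \<real>\<^sub>\<ge>\<^sub>0)"

lemma positive_kernel_of_ccp_map:
  assumes ccp: "ccp_map {..<n} (bounded_ops {..<n}) I (bounded_ops I) \<psi>"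
  shows "positive_kernel n I (\<lambda>i j s t. \<psi> (matrix_unit n i j) (unit_vec t) s)"
  unfolding positive_kernel_def
proof (intro ballI allI)
  fix s t :: 'a and \<alpha> \<beta> :: "nat \<Rightarrow> complex"
  assume st: "s \<in> I" "t \<in> I"
  have pos: "positive_op_matrix I n (\<lambda>i j. \<psi> (matrix_unit n i j))"
    by (rule ccp_mapD(2)[OF ccp matrix_unit_bounded(1) matrix_units_positive])
  have B: "\<psi> (matrix_unit n i j) \<in> bounded_ops I" if "i < n" "j < n" for i j
    using ccp matrix_unit_bounded(1)[OF that] unfolding ccp_map_def by blast
  define p where "p i j r q = \<psi> (matrix_unit n i j) (unit_vec q) r" for i j r q
  note u = unit_vec_l2[OF st(1)] unit_vec_l2[OF st(2)]
  define x where "x i = (\<lambda>h. \<alpha> i * unit_vec s h + (\<beta> i * unit_vec t h + 0))" for i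
  have x2: "(\<lambda>h. \<beta> i * unit_vec t h + 0) \<in> l2 I" for i by (rule l2_lincomb[OF u(2) l2_zero])
  have xl: "x i \<in> l2 I" for i unfolding x_def by (rule l2_lincomb[OF u(1) x2])
  have "l2_inner I (\<psi> (matrix_unit n i j) (x j)) (x i)
     = \<alpha> j * cnj (\<alpha> i) * p i j s s + \<beta> j * cnj (\<alpha> i) * p i j s t
        + (\<alpha> j * cnj (\<beta> i) * p i j t s + \<beta> j * cnj (\<beta> i) * p i j t t)"
    if ij: "i < n" "j < n" for i j
  proof -
    let ?T = "\<psi> (matrix_unit n i j)"
    have z: "?T (\<lambda>_. 0) h = 0" for h
      using bounded_op_sum_apply[OF B[OF ij], of "{}"] by simp
    have T: "?T (x j) h = \<alpha> j * ?T (unit_vec s) h + \<beta> j * ?T (unit_vec t) h" for h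
    proof -
      have "?T (x j) = (\<lambda>h. \<alpha> j * ?T (unit_vec s) h + ?T (\<lambda>h. \<beta> j * unit_vec t h + 0) h)"
        unfolding x_def by (rule bounded_opsD(3)[OF B[OF ij] u(1) x2])
      moreover have "?T (\<lambda>h. \<beta> j * unit_vec t h + 0) = (\<lambda>h. \<beta> j * ?T (unit_vec t) h + ?T (\<lambda>_. 0) h)"
        by (rule bounded_opsD(3)[OF B[OF ij] u(2) l2_zero])
      ultimately show ?thesis using z by simp
    qed
    have Tl: "?T (x j) \<in> l2 I" using bounded_opsD(1)[OF B[OF ij] xl] .
    have "l2_inner I (?T (x j)) (x i) = cnj (\<alpha> i) * ?T (x j) s + l2_inner I (?T (x j)) (\<lambda>h. \<beta> i * unit_vec t h + 0)"
      unfolding x_def[of i] l2_inner_add_right[OF Tl u(1) x2] l2_inner_unit_vec[OF st(1)] ..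
    also have "l2_inner I (?T (x j)) (\<lambda>h. \<beta> i * unit_vec t h + 0) = cnj (\<beta> i) * ?T (x j) t"
      unfolding l2_inner_add_right[OF Tl u(2) l2_zero] l2_inner_unit_vec[OF st(2)] by (simp add: l2_inner_def)
    finally show ?thesis unfolding T p_def by (simp add: algebra_simps)
  qed
  then have "(\<Sum>i<n. \<Sum>j<n. \<alpha> j * cnj (\<alpha> i) * p i j s s + \<beta> j * cnj (\<alpha> i) * p i j s t
        + (\<alpha> j * cnj (\<beta> i) * p i j t s + \<beta> j * cnj (\<beta> i) * p i j t t))
     = (\<Sum>i<n. \<Sum>j<n. l2_inner I (\<psi> (matrix_unit n i j) (x j)) (x i))" by simp
  also have "\<dots> \<in> \<real>\<^sub>\<ge>\<^sub>0"
    using pos xl unfolding positive_op_matrix_def by blast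
  finally show "(\<Sum>i<n. \<Sum>j<n. \<alpha> j * cnj (\<alpha> i) * \<psi> (matrix_unit n i j) (unit_vec s) s
        + \<beta> j * cnj (\<alpha> i) * \<psi> (matrix_unit n i j) (unit_vec t) s
        + (\<alpha> j * cnj (\<beta> i) * \<psi> (matrix_unit n i j) (unit_vec s) t
        + \<beta> j * cnj (\<beta> i) * \<psi> (matrix_unit n i j) (unit_vec t) t)) \<in> \<real>\<^sub>\<ge>\<^sub>0"
    unfolding p_def .
qed

text \<open>The composition of the two maps of a factorisation, evaluated at the translation by \<open>g\<close> and the matrix
  entry \<open>(g t, t)\<close>, is close to 1; the first map may be replaced by one that comes from finitely supported
  vectors.\<close>
lemma (in group) exact_group_kernel:
  assumes ex: "exact_group G"
    and E: "finite E" "E \<subseteq> carrier G" "\<one> \<in> E" "\<And>g. g \<in> E \<Longrightarrow> inv g \<in> E" and d: "\<delta> > 0"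
  shows "\<exists>n (m::nat) \<Xi> p. (\<forall>k<m. \<Xi> k \<in> finite_tuples) \<and> positive_kernel n (carrier G) p \<and>
    (\<forall>g\<in>E. \<forall>t\<in>carrier G.
       cmod ((\<Sum>i<n. \<Sum>j<n. (\<Sum>k<m. shift_coeff (\<Xi> k) g i j) * p i j (g \<otimes> t) t) - 1) < \<delta>)"
proof -
  have "finite (left_regular G ` E)" "left_regular G ` E \<subseteq> reduced_group_cstar G" "\<delta> / 2 > 0"
    using E d left_regular_in_cstar by auto
  then obtain n :: nat and \<phi> \<psi> where phi: "ccp_map (carrier G) (reduced_group_cstar G) {..<n} (bounded_ops {..<n}) \<phi>"
    and psi: "ccp_map {..<n} (bounded_ops {..<n}) (carrier G) (bounded_ops (carrier G)) \<psi>"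
    and near: "\<forall>a\<in>left_regular G ` E. op_norm (carrier G) (op_diff (\<psi> (\<phi> a)) a) < \<delta> / 2"
    using ex[unfolded exact_group_def nuclear_inclusion_def, rule_format, of "left_regular G ` E" "\<delta> / 2", OF conjI[OF _ conjI]]
    by blast
  define v where "v g i j = \<phi> (left_regular G g) (unit_vec j) i" for g i j
  define p where "p i j s t = \<psi> (matrix_unit n i j) (unit_vec t) s" for i j s t
  define \<eta> where "\<eta> = \<delta> / (2 * (real n * real n + 1))"
  have eta: "\<eta> > 0" "real n * real n * \<eta> \<le> \<delta> / 2"
  proof -
    have c: "real n * real n + 1 > 0" by (simp add: add_nonneg_pos)
    then show "\<eta> > 0" unfolding \<eta>_def using d by simp
    have "real n * real n * \<eta> = (\<delta> / 2) * ((real n * real n) / (real n * real n + 1))"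
      unfolding \<eta>_def by (simp add: field_simps)
    also have "\<dots> \<le> (\<delta> / 2) * 1" using c d by (intro mult_left_mono) auto
    finally show "real n * real n * \<eta> \<le> \<delta> / 2" by simp
  qed
  obtain m :: nat and \<Xi> where m: "\<forall>k<m. \<Xi> k \<in> finite_tuples"
    "\<forall>g\<in>E. \<forall>i<n. \<forall>j<n. (cmod (v g i j - (\<Sum>k<m. shift_coeff (\<Xi> k) g i j)))\<^sup>2 < \<eta>\<^sup>2"
    using ccp_coefficients_approximable[OF E phi v_def, of "\<eta>\<^sup>2"] eta by auto
  have p1: "cmod (p i j s t) \<le> 1" if "i < n" "j < n" "s \<in> carrier G" "t \<in> carrier G" for i j s t
  proof -
    have "cmod (p i j s t) \<le> op_norm (carrier G) (\<psi> (matrix_unit n i j))"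
      unfolding p_def
      by (rule op_entry_le_op_norm) (use psi matrix_unit_bounded(1) that in \<open>auto simp: ccp_map_def\<close>)
    also have "\<dots> \<le> op_norm {..<n} (matrix_unit n i j)"
      using psi matrix_unit_bounded(1) that unfolding ccp_map_def by blast
    also have "\<dots> \<le> 1" using matrix_unit_bounded(2) that by blast
    finally show ?thesis .
  qed
  have main: "cmod ((\<Sum>i<n. \<Sum>j<n. (\<Sum>k<m. shift_coeff (\<Xi> k) g i j) * p i j (g \<otimes> t) t) - 1) < \<delta>"
    if g: "g \<in> E" and t: "t \<in> carrier G" for g t
  proof -
    let ?c = "\<lambda>i j. \<Sum>k<m. shift_coeff (\<Xi> k) g i j"
    have gG: "g \<in> carrier G" "g \<otimes> t \<in> carrier G" using g t E by auto
    let ?a = "left_regular G g"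
    have ba: "\<phi> ?a \<in> bounded_ops {..<n}"
      using phi left_regular_in_cstar[OF gG(1)] unfolding ccp_map_def by blast
    have "\<psi> (\<phi> ?a) = \<psi> (\<lambda>\<xi> k. \<Sum>x\<in>{..<n} \<times> {..<n}. v g (fst x) (snd x) * matrix_unit n (fst x) (snd x) \<xi> k)"
      using matrix_unit_expansion[OF ba] unfolding v_def by (rule arg_cong)
    also have "\<dots> = (\<lambda>\<xi> k. \<Sum>x\<in>{..<n} \<times> {..<n}. v g (fst x) (snd x) * \<psi> (matrix_unit n (fst x) (snd x)) \<xi> k)"
    proof (rule ccp_map_sum[OF psi])
      fix X' assume "X' \<subseteq> {..<n} \<times> {..<n}"
      then show "(\<lambda>\<xi> i. \<Sum>x\<in>X'. v g (fst x) (snd x) * matrix_unit n (fst x) (snd x) \<xi> i) \<in> bounded_ops {..<n}"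
        by (intro bounded_ops_sum matrix_unit_bounded) (auto intro: finite_subset[of _ "{..<n} \<times> {..<n}"])
    qed (auto intro: matrix_unit_bounded)
    finally have vp: "\<psi> (\<phi> ?a) (unit_vec t) (g \<otimes> t) = (\<Sum>i<n. \<Sum>j<n. v g i j * p i j (g \<otimes> t) t)"
      unfolding p_def by (simp add: sum.cartesian_product case_prod_unfold)
    have "\<psi> (\<phi> ?a) \<in> bounded_ops (carrier G)" using psi ba unfolding ccp_map_def by blast
    then have "cmod (op_diff (\<psi> (\<phi> ?a)) ?a (unit_vec t) (g \<otimes> t)) \<le> op_norm (carrier G) (op_diff (\<psi> (\<phi> ?a)) ?a)"
      by (intro op_entry_le_op_norm bounded_ops_diff left_regular_bounded) (use gG t in auto)
    also have "\<dots> < \<delta> / 2" using near g by auto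
    finally have 1: "cmod ((\<Sum>i<n. \<Sum>j<n. v g i j * p i j (g \<otimes> t) t) - 1) < \<delta> / 2"
      unfolding op_diff_def vp left_regular_unit_vec[OF gG(1) t] .
    have "cmod ((\<Sum>i<n. \<Sum>j<n. ?c i j * p i j (g \<otimes> t) t) - (\<Sum>i<n. \<Sum>j<n. v g i j * p i j (g \<otimes> t) t))
      = cmod (\<Sum>i<n. \<Sum>j<n. (?c i j - v g i j) * p i j (g \<otimes> t) t)"
      by (simp only: sum_subtractf[symmetric] left_diff_distrib)
    also have "\<dots> \<le> (\<Sum>i<n. \<Sum>j<n. \<eta>)"
    proof (intro sum_norm_le)
      fix i j assume ij: "i \<in> {..<n}" "j \<in> {..<n}"
      have "(cmod (?c i j - v g i j))\<^sup>2 \<le> \<eta>\<^sup>2" using m(2) g ij by (simp add: norm_minus_commute less_imp_le)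
      then have "cmod (?c i j - v g i j) \<le> \<eta>" by (rule power2_le_imp_le) (use eta in simp)
      moreover have "cmod (p i j (g \<otimes> t) t) \<le> 1" using p1 ij gG t by auto
      ultimately have "cmod (?c i j - v g i j) * cmod (p i j (g \<otimes> t) t) \<le> \<eta> * 1"
        by (intro mult_mono) (use eta in auto)
      then show "cmod ((?c i j - v g i j) * p i j (g \<otimes> t) t) \<le> \<eta>" by (simp add: norm_mult)
    qed
    also have "\<dots> \<le> \<delta> / 2" using eta(2) by simp
    finally have 2: "cmod ((\<Sum>i<n. \<Sum>j<n. ?c i j * p i j (g \<otimes> t) t) - (\<Sum>i<n. \<Sum>j<n. v g i j * p i j (g \<otimes> t) t)) \<le> \<delta> / 2" .
    have "cmod ((\<Sum>i<n. \<Sum>j<n. ?c i j * p i j (g \<otimes> t) t) - 1) \<le>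
       cmod ((\<Sum>i<n. \<Sum>j<n. ?c i j * p i j (g \<otimes> t) t) - (\<Sum>i<n. \<Sum>j<n. v g i j * p i j (g \<otimes> t) t))
       + cmod ((\<Sum>i<n. \<Sum>j<n. v g i j * p i j (g \<otimes> t) t) - 1)"
      by (rule order_trans[OF _ norm_triangle_ineq]) simp
    with 1 2 show ?thesis by linarith
  qed
  have "positive_kernel n (carrier G) p"
    unfolding p_def by (rule positive_kernel_of_ccp_map[OF psi])
  then show ?thesis using m(1) main by blast
qed

section \<open>Almost equivariant weights on an exact group\<close>

text \<open>Positivity gives \<open>r \<le> 2 * sqrt x * sqrt y\<close>, and \<open>\<bar>x - y\<bar>\<close> is the product of the difference and the sum of the
  two roots, to which the inequality of the arithmetic and geometric mean applies.\<close>
lemma abs_diff_le_of_positive_form: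
  fixes x y r \<tau> :: real
  assumes form: "\<And>a b. a\<^sup>2 * x + a * b * r + b\<^sup>2 * y \<ge> 0" and t: "\<tau> > 0"
  shows "\<bar>x - y\<bar> \<le> (x + y - r) / (2 * \<tau>) + \<tau> * (x + y)"
proof -
  have x: "x \<ge> 0" and y: "y \<ge> 0" using form[of 1 0] form[of 0 1] by auto
  define X Y where "X = sqrt x" and "Y = sqrt y"
  have XY: "x = X\<^sup>2" "y = Y\<^sup>2" "X \<ge> 0" "Y \<ge> 0" unfolding X_def Y_def using x y by auto
  have r: "r \<le> 2 * (X * Y)"
  proof (cases "X * Y = 0")
    case False
    have "2 * (X * Y) * (X * Y) - (X * Y) * r \<ge> 0"
      using form[of Y "-X"] unfolding XY by (simp add: power2_eq_square algebra_simps)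
    then have "(X * Y) * (2 * (X * Y) - r) \<ge> 0" by (simp add: algebra_simps)
    moreover have "X * Y > 0" using False XY by (simp add: less_le)
    ultimately show ?thesis by (simp add: zero_le_mult_iff)
  next
    case True
    show ?thesis
    proof (rule ccontr)
      assume "\<not> r \<le> 2 * (X * Y)"
      then have r: "r > 0" using True by simp
      from True consider "x = 0" | "y = 0" using XY by auto
      then show False
      proof cases
        case 1
        have "0 \<le> (- (y + 1) / r) * r + y" using form[of "- (y + 1) / r" 1] 1 r by simp
        also have "\<dots> = -1" using r by simp
        finally show False by simp
      next
        case 2
        have "0 \<le> x + (- (x + 1) / r) * r" using form[of 1 "- (x + 1) / r"] 2 r by simp
        also have "\<dots> = -1" using r by simp
        finally show False by simp
      qed
    qed
  qed
  have "\<bar>x - y\<bar> = \<bar>X - Y\<bar> * (X + Y)"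
    unfolding XY using XY(3,4) by (simp add: power2_eq_square square_diff_square_factored abs_mult mult.commute)
  also have "\<dots> \<le> (X - Y)\<^sup>2 / (2 * \<tau>) + \<tau> * (X + Y)\<^sup>2 / 2"
  proof -
    have "0 \<le> (\<bar>X - Y\<bar> - \<tau> * (X + Y))\<^sup>2" by simp
    also have "\<dots> = (X - Y)\<^sup>2 - 2 * \<tau> * (\<bar>X - Y\<bar> * (X + Y)) + \<tau>\<^sup>2 * (X + Y)\<^sup>2"
      unfolding power2_diff[of "\<bar>X - Y\<bar>"] power_mult_distrib[of \<tau>] power2_abs by simp
    finally show ?thesis using t by (simp add: field_simps power2_eq_square)
  qed
  also have "\<dots> \<le> (x + y - r) / (2 * \<tau>) + \<tau> * (x + y)"
  proof (rule add_mono)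
    have "(X - Y)\<^sup>2 \<le> x + y - r" unfolding XY using r by (simp add: power2_diff algebra_simps)
    then show "(X - Y)\<^sup>2 / (2 * \<tau>) \<le> (x + y - r) / (2 * \<tau>)" using t by (intro divide_right_mono) auto
    have "(X + Y)\<^sup>2 \<le> 2 * (x + y)"
      unfolding XY using sum_squares_bound[of X Y] by (simp add: power2_sum)
    then have "\<tau> * (X + Y)\<^sup>2 \<le> \<tau> * (2 * (x + y))" using t by (intro mult_left_mono) auto
    also have "\<tau> * (2 * (x + y)) = 2 * (\<tau> * (x + y))" by (rule mult.left_commute)
    finally show "\<tau> * (X + Y)\<^sup>2 / 2 \<le> \<tau> * (x + y)" by simp
  qed
  finally show ?thesis .
qed

text \<open>Rounding up, and not down, keeps every positive weight positive.\<close>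
lemma rounded_up_normalisation:
  fixes F :: "'b \<Rightarrow> real" and N :: real
  assumes S: "finite S" and F: "\<And>q. q \<in> S \<Longrightarrow> F q \<ge> 0" "\<bar>sum F S - 1\<bar> \<le> \<delta>" "\<delta> < 1" and N: "N > 0"
  defines "M \<equiv> \<Sum>q\<in>S. real_of_int \<lceil>N * F q\<rceil>"
  shows "M > 0" "(\<Sum>q\<in>S. \<bar>real_of_int \<lceil>N * F q\<rceil> / M - F q\<bar>) \<le> \<delta> + 2 * card S / N"
proof -
  define e where "e q = real_of_int \<lceil>N * F q\<rceil> - N * F q" for q
  have e: "0 \<le> e q" "e q \<le> 1" for q unfolding e_def by linarith+
  have c: "real_of_int \<lceil>N * F q\<rceil> = N * F q + e q" for q unfolding e_def by simp
  have c0: "N * F q + e q \<ge> 0" if "q \<in> S" for q using F(1)[OF that] N e by simp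
  have M: "M = N * sum F S + sum e S" unfolding M_def c by (simp add: sum.distrib sum_distrib_left)
  have es: "0 \<le> sum e S" "sum e S \<le> card S"
    using e sum_mono[of S e "\<lambda>_. 1"] by (auto simp: sum_nonneg)
  have "sum F S > 0" using F(2,3) by linarith
  then show M0: "M > 0" unfolding M using N es by (simp add: add_pos_nonneg)
  have "(\<Sum>q\<in>S. \<bar>(N * F q + e q) / M - F q\<bar>) \<le> (\<Sum>q\<in>S. (N * F q + e q) * \<bar>1 / M - 1 / N\<bar> + e q / N)"
  proof (rule sum_mono)
    fix q assume q: "q \<in> S"
    have "(N * F q + e q) / M - F q = (N * F q + e q) * (1 / M - 1 / N) + e q / N"
      using N M0 by (simp add: field_simps)
    also have "\<bar>\<dots>\<bar> \<le> \<bar>(N * F q + e q) * (1 / M - 1 / N)\<bar> + \<bar>e q / N\<bar>" by (rule abs_triangle_ineq)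
    finally show "\<bar>(N * F q + e q) / M - F q\<bar> \<le> (N * F q + e q) * \<bar>1 / M - 1 / N\<bar> + e q / N"
      using c0[OF q] e N by (simp add: abs_mult)
  qed
  also have "\<dots> = M * \<bar>1 / M - 1 / N\<bar> + sum e S / N"
    unfolding sum.distrib sum_distrib_right[symmetric] sum_divide_distrib[symmetric] M sum_distrib_left[symmetric] ..
  also have "M * \<bar>1 / M - 1 / N\<bar> = \<bar>1 - M / N\<bar>"
  proof -
    have "M * \<bar>1 / M - 1 / N\<bar> = \<bar>M * (1 / M - 1 / N)\<bar>" using M0 by (simp add: abs_mult)
    then show ?thesis using M0 by (simp add: right_diff_distrib)
  qed
  also have "\<dots> \<le> \<delta> + card S / N"
  proof -
    have "M / N = sum F S + sum e S / N" unfolding M using N by (simp add: field_simps)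
    moreover have "sum e S / N \<le> card S / N" "0 \<le> sum e S / N" using es N by (auto intro: divide_right_mono)
    ultimately show ?thesis using F(2) by linarith
  qed
  also have "sum e S / N \<le> card S / N" using es N by (auto intro: divide_right_mono)
  finally show "(\<Sum>q\<in>S. \<bar>real_of_int \<lceil>N * F q\<rceil> / M - F q\<bar>) \<le> \<delta> + 2 * card S / N"
    unfolding c by (simp add: add_divide_distrib)
qed

context group begin

lemma sum_translated_support:
  fixes u :: "'a \<Rightarrow> 'c::comm_monoid_add"
  assumes S: "finite S" "S \<subseteq> carrier G" "g \<in> carrier G" "\<And>q. q \<notin> S \<Longrightarrow> u q = 0"
  shows "(\<Sum>h\<in>S \<union> (\<lambda>h. g \<otimes> h) ` S. u h) = sum u S"
    "(\<Sum>h\<in>S \<union> (\<lambda>h. g \<otimes> h) ` S. u (inv g \<otimes> h)) = sum u S"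
proof -
  show "(\<Sum>h\<in>S \<union> (\<lambda>h. g \<otimes> h) ` S. u h) = sum u S"
    by (rule sum.mono_neutral_right) (use S in auto)
  have "(\<Sum>h\<in>S \<union> (\<lambda>h. g \<otimes> h) ` S. u (inv g \<otimes> h)) = (\<Sum>h\<in>(\<lambda>h. g \<otimes> h) ` S. u (inv g \<otimes> h))"
  proof (rule sum.mono_neutral_right)
    show "\<forall>h\<in>S \<union> (\<lambda>h. g \<otimes> h) ` S - (\<lambda>h. g \<otimes> h) ` S. u (inv g \<otimes> h) = 0"
    proof
      fix h assume h: "h \<in> S \<union> (\<lambda>h. g \<otimes> h) ` S - (\<lambda>h. g \<otimes> h) ` S"
      then have "h \<in> carrier G" using S by auto
      then have "h = g \<otimes> (inv g \<otimes> h)" using S(3) by (simp add: m_assoc[symmetric])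
      then have "inv g \<otimes> h \<notin> S" using h by blast
      then show "u (inv g \<otimes> h) = 0" by (rule S(4))
    qed
  qed (use S in auto)
  also have "\<dots> = sum u S"
    by (subst sum.reindex) (use S in \<open>auto simp: inj_on_def m_assoc[symmetric] subset_iff intro!: sum.cong\<close>)
  finally show "(\<Sum>h\<in>S \<union> (\<lambda>h. g \<otimes> h) ` S. u (inv g \<otimes> h)) = sum u S" .
qed

text \<open>The two sums run over the same set, so that both can be compared with the weights point by point.\<close>
lemma shift_coeff_finite_sum:
  assumes xi: "\<And>i h. h \<notin> S \<Longrightarrow> \<xi> i h = 0" and S: "finite S" "S \<subseteq> carrier G" and g: "g \<in> carrier G"
  shows "shift_coeff \<xi> g i j = (\<Sum>h\<in>S \<union> (\<lambda>h. g \<otimes> h) ` S. \<xi> j (inv g \<otimes> h) * cnj (\<xi> i h))"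
    "shift_coeff \<xi> (inv g) i j = (\<Sum>h\<in>S \<union> (\<lambda>h. g \<otimes> h) ` S. \<xi> j h * cnj (\<xi> i (inv g \<otimes> h)))"
proof -
  have l: "\<xi> i \<in> l2 (carrier G)" for i by (rule l2_finite_support[OF S xi])
  have 1: "shift_coeff \<xi> g i j = (\<Sum>h\<in>S \<union> (\<lambda>h. g \<otimes> h) ` S. \<xi> j (inv g \<otimes> h) * cnj (\<xi> i h))" for i j
  proof -
    have "shift_coeff \<xi> g i j = (\<Sum>h\<in>S. left_regular G g (\<xi> j) h * cnj (\<xi> i h))"
      unfolding shift_coeff_def l2_inner_def by (rule infsum_finite_support) (use S xi in auto)
    also have "\<dots> = (\<Sum>h\<in>S. \<xi> j (inv g \<otimes> h) * cnj (\<xi> i h))"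
      by (rule sum.cong) (use S l in \<open>auto simp: left_regular_def\<close>)
    also have "\<dots> = (\<Sum>h\<in>S \<union> (\<lambda>h. g \<otimes> h) ` S. \<xi> j (inv g \<otimes> h) * cnj (\<xi> i h))"
      by (rule sum.mono_neutral_left) (use S xi in auto)
    finally show ?thesis .
  qed
  then show "shift_coeff \<xi> g i j = (\<Sum>h\<in>S \<union> (\<lambda>h. g \<otimes> h) ` S. \<xi> j (inv g \<otimes> h) * cnj (\<xi> i h))" .
  have "shift_coeff \<xi> (inv g) i j = cnj (shift_coeff \<xi> g j i)"
    unfolding shift_coeff_def by (rule l2_inner_left_regular_inv[OF l l g])
  then show "shift_coeff \<xi> (inv g) i j = (\<Sum>h\<in>S \<union> (\<lambda>h. g \<otimes> h) ` S. \<xi> j h * cnj (\<xi> i (inv g \<otimes> h)))"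
    unfolding 1 by (simp add: mult.commute)
qed

text \<open>The weight \<open>F t q\<close> is the value of the kernel at \<open>(t, t)\<close> on the vectors at \<open>q\<close>, and \<open>R g t h\<close> is the mixed term
  of the vectors at \<open>h\<close> and \<open>inv g \<otimes> h\<close>.  The three form a positive quadratic form, and their sums over \<open>h\<close> are
  close to 1, 1 and 2.  Where the form is positive, a mixed term of twice the size of the weights forces the
  weights to be nearly equal.\<close>
lemma exact_group_almost_invariant_weights:
  fixes \<delta> :: real
  assumes ex: "exact_group G" and E0: "finite E0" "E0 \<subseteq> carrier G" and d: "\<delta> > 0"
  shows "\<exists>S F. finite S \<and> S \<subseteq> carrier G \<and>
    (\<forall>t\<in>carrier G. (\<forall>q. F t q \<ge> 0) \<and> (\<forall>q. q \<notin> S \<longrightarrow> F t q = 0) \<and> \<bar>sum (F t) S - 1\<bar> \<le> \<delta>) \<and>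
    (\<forall>g\<in>E0. \<forall>t\<in>carrier G. \<forall>\<tau>>0.
       (\<Sum>h\<in>S \<union> (\<lambda>h. g \<otimes> h) ` S. \<bar>F (g \<otimes> t) h - F t (inv g \<otimes> h)\<bar>) \<le> 2 * \<delta> / \<tau> + 2 * \<tau> * (1 + \<delta>))"
proof -
  define E where "E = insert \<one> (E0 \<union> (\<lambda>g. inv g) ` E0)"
  have E: "finite E" "E \<subseteq> carrier G" "\<one> \<in> E" "\<And>g. g \<in> E \<Longrightarrow> inv g \<in> E"
    unfolding E_def using E0 by (auto simp: subset_iff)
  obtain n and m :: nat and \<Xi> p where X: "\<forall>k<m. \<Xi> k \<in> finite_tuples"
    and p: "positive_kernel n (carrier G) p"
    and near: "\<forall>g\<in>E. \<forall>t\<in>carrier G.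
       cmod ((\<Sum>i<n. \<Sum>j<n. (\<Sum>k<m. shift_coeff (\<Xi> k) g i j) * p i j (g \<otimes> t) t) - 1) < \<delta>"
    using exact_group_kernel[OF ex E d] by blast
  have "\<forall>k\<in>{..<m}. \<exists>S. finite S \<and> S \<subseteq> carrier G \<and> (\<forall>i h. h \<notin> S \<longrightarrow> \<Xi> k i h = 0)"
    using X unfolding finite_tuples_def by blast
  then obtain Sk where Sk: "\<forall>k\<in>{..<m}. finite (Sk k) \<and> Sk k \<subseteq> carrier G \<and> (\<forall>i h. h \<notin> Sk k \<longrightarrow> \<Xi> k i h = 0)"
    by (metis bchoice)
  define S where "S = (\<Union>k<m. Sk k)"
  have S: "finite S" "S \<subseteq> carrier G" unfolding S_def using Sk by auto
  have supp: "\<Xi> k i h = 0" if "k < m" "h \<notin> S" for k i h using that Sk unfolding S_def by blast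
  define W where "W k s t q r = (\<Sum>i<n. \<Sum>j<n. \<Xi> k j r * cnj (\<Xi> k i q) * p i j s t)" for k s t q r
  define F where "F t q = (\<Sum>k<m. Re (W k t t q q))" for t q
  define R where "R g t h = (\<Sum>k<m. Re (W k (g \<otimes> t) t h (inv g \<otimes> h)) + Re (W k t (g \<otimes> t) (inv g \<otimes> h) h))" for g t h
  have form: "a\<^sup>2 * Re (W k s s q q) + a * b * (Re (W k s t q r) + Re (W k t s r q)) + b\<^sup>2 * Re (W k t t r r) \<ge> 0"
    if "s \<in> carrier G" "t \<in> carrier G" for a b :: real and k s t q r
  proof -
    define \<alpha> \<beta> where "\<alpha> i = of_real a * \<Xi> k i q" and "\<beta> i = of_real b * \<Xi> k i r" for i
    have "(\<Sum>i<n. \<Sum>j<n. \<alpha> j * cnj (\<alpha> i) * p i j s s + \<beta> j * cnj (\<alpha> i) * p i j s t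
        + (\<alpha> j * cnj (\<beta> i) * p i j t s + \<beta> j * cnj (\<beta> i) * p i j t t)) \<in> \<real>\<^sub>\<ge>\<^sub>0"
      using p that unfolding positive_kernel_def by blast
    also have "(\<Sum>i<n. \<Sum>j<n. \<alpha> j * cnj (\<alpha> i) * p i j s s + \<beta> j * cnj (\<alpha> i) * p i j s t
        + (\<alpha> j * cnj (\<beta> i) * p i j t s + \<beta> j * cnj (\<beta> i) * p i j t t))
      = of_real (a\<^sup>2) * W k s s q q + of_real (a * b) * W k s t q r
        + (of_real (a * b) * W k t s r q + of_real (b\<^sup>2) * W k t t r r)"
      unfolding W_def sum_distrib_left sum.distrib[symmetric] \<alpha>_def \<beta>_def
      by (intro sum.cong refl) (simp add: power2_eq_square algebra_simps)
    finally have "Re (of_real (a\<^sup>2) * W k s s q q + of_real (a * b) * W k s t q r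
        + (of_real (a * b) * W k t s r q + of_real (b\<^sup>2) * W k t t r r)) \<ge> 0"
      by (simp only: complex_nonneg_Reals_iff)
    then show ?thesis by (simp add: algebra_simps)
  qed
  have Fform: "a\<^sup>2 * F (g \<otimes> t) h + a * b * R g t h + b\<^sup>2 * F t (inv g \<otimes> h) \<ge> 0"
    if "g \<in> carrier G" "t \<in> carrier G" for a b g t h
    unfolding F_def R_def sum_distrib_left sum.distrib[symmetric]
    by (rule sum_nonneg, rule form) (use that in auto)
  have F0: "F t q \<ge> 0" if "t \<in> carrier G" for t q
    unfolding F_def using form[OF that that, of 1 _ q 0] by (intro sum_nonneg) simp
  have Fsupp: "F t q = 0" if "q \<notin> S" for t q
    unfolding F_def W_def using supp that by simp
  have Wsum: "(\<Sum>h\<in>T. \<Sum>k<m. Re (W k s t (x h) (y h)))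
     = Re (\<Sum>i<n. \<Sum>j<n. (\<Sum>k<m. \<Sum>h\<in>T. \<Xi> k j (y h) * cnj (\<Xi> k i (x h))) * p i j s t)" for T s t x y
  proof -
    have "(\<Sum>h\<in>T. \<Sum>k<m. Re (W k s t (x h) (y h))) = Re (\<Sum>h\<in>T. \<Sum>k<m. \<Sum>i<n. \<Sum>j<n. \<Xi> k j (y h) * cnj (\<Xi> k i (x h)) * p i j s t)"
      unfolding W_def by simp
    also have "(\<Sum>h\<in>T. \<Sum>k<m. \<Sum>i<n. \<Sum>j<n. \<Xi> k j (y h) * cnj (\<Xi> k i (x h)) * p i j s t)
      = (\<Sum>k<m. \<Sum>h\<in>T. \<Sum>i<n. \<Sum>j<n. \<Xi> k j (y h) * cnj (\<Xi> k i (x h)) * p i j s t)"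
      by (rule sum.swap)
    also have "\<dots> = (\<Sum>k<m. \<Sum>i<n. \<Sum>h\<in>T. \<Sum>j<n. \<Xi> k j (y h) * cnj (\<Xi> k i (x h)) * p i j s t)"
      by (intro sum.cong refl sum.swap)
    also have "\<dots> = (\<Sum>i<n. \<Sum>k<m. \<Sum>j<n. \<Sum>h\<in>T. \<Xi> k j (y h) * cnj (\<Xi> k i (x h)) * p i j s t)"
      by (subst sum.swap) (intro sum.cong refl sum.swap)
    also have "\<dots> = (\<Sum>i<n. \<Sum>j<n. \<Sum>k<m. \<Sum>h\<in>T. \<Xi> k j (y h) * cnj (\<Xi> k i (x h)) * p i j s t)"
      by (intro sum.cong refl sum.swap)
    finally show ?thesis by (simp add: sum_distrib_right)
  qed
  have shift1: "(\<Sum>k<m. \<Sum>h\<in>S \<union> (\<lambda>h. g \<otimes> h) ` S. \<Xi> k j (inv g \<otimes> h) * cnj (\<Xi> k i h)) = (\<Sum>k<m. shift_coeff (\<Xi> k) g i j)"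
    and shift2: "(\<Sum>k<m. \<Sum>h\<in>S \<union> (\<lambda>h. g \<otimes> h) ` S. \<Xi> k j h * cnj (\<Xi> k i (inv g \<otimes> h))) = (\<Sum>k<m. shift_coeff (\<Xi> k) (inv g) i j)"
    if "g \<in> carrier G" for g i j
    by (intro sum.cong refl shift_coeff_finite_sum[symmetric] supp S that; simp)+
  have Re_near: "\<bar>Re z - 1\<bar> \<le> \<delta>" if "cmod (z - 1) < \<delta>" for z
    using abs_Re_le_cmod[of "z - 1"] that by simp
  have Fsum: "\<bar>sum (F t) S - 1\<bar> \<le> \<delta>" if t: "t \<in> carrier G" for t
  proof -
    have "sum (F t) S = (\<Sum>h\<in>S \<union> (\<lambda>h. \<one> \<otimes> h) ` S. \<Sum>k<m. Re (W k (\<one> \<otimes> t) t h (inv \<one> \<otimes> h)))"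
      unfolding F_def by (rule sum.cong) (use S t in \<open>auto simp: subset_iff\<close>)
    also have "\<dots> = Re (\<Sum>i<n. \<Sum>j<n. (\<Sum>k<m. shift_coeff (\<Xi> k) \<one> i j) * p i j (\<one> \<otimes> t) t)"
      unfolding Wsum shift1[OF one_closed] ..
    finally show ?thesis using Re_near[OF near[rule_format, OF E(3) t]] by (simp only:)
  qed
  have main: "(\<Sum>h\<in>S \<union> (\<lambda>h. g \<otimes> h) ` S. \<bar>F (g \<otimes> t) h - F t (inv g \<otimes> h)\<bar>) \<le> 2 * \<delta> / \<tau> + 2 * \<tau> * (1 + \<delta>)"
    if g: "g \<in> E0" and t: "t \<in> carrier G" and tau: "\<tau> > 0" for g t \<tau>
  proof -
    let ?T = "S \<union> (\<lambda>h. g \<otimes> h) ` S"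
    have gG: "g \<in> carrier G" "g \<in> E" "inv g \<in> E" "g \<otimes> t \<in> carrier G" "inv g \<otimes> (g \<otimes> t) = t"
      using g E0 t unfolding E_def by (auto simp: m_assoc[symmetric])
    define A B C where "A = sum (F (g \<otimes> t)) S" and "B = sum (F t) S" and "C = (\<Sum>h\<in>?T. R g t h)"
    have C: "C \<ge> 2 - 2 * \<delta>"
    proof -
      have "C = (\<Sum>h\<in>?T. \<Sum>k<m. Re (W k (g \<otimes> t) t h (inv g \<otimes> h))) + (\<Sum>h\<in>?T. \<Sum>k<m. Re (W k t (g \<otimes> t) (inv g \<otimes> h) h))"
        unfolding C_def R_def by (simp add: sum.distrib)
      also have "\<dots> = Re (\<Sum>i<n. \<Sum>j<n. (\<Sum>k<m. shift_coeff (\<Xi> k) g i j) * p i j (g \<otimes> t) t)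
         + Re (\<Sum>i<n. \<Sum>j<n. (\<Sum>k<m. shift_coeff (\<Xi> k) (inv g) i j) * p i j t (g \<otimes> t))"
        unfolding Wsum shift1[OF gG(1)] shift2[OF gG(1)] ..
      moreover have "\<bar>Re (\<Sum>i<n. \<Sum>j<n. (\<Sum>k<m. shift_coeff (\<Xi> k) g i j) * p i j (g \<otimes> t) t) - 1\<bar> \<le> \<delta>"
        by (rule Re_near[OF near[rule_format, OF gG(2) t]])
      moreover have "\<bar>Re (\<Sum>i<n. \<Sum>j<n. (\<Sum>k<m. shift_coeff (\<Xi> k) (inv g) i j) * p i j t (g \<otimes> t)) - 1\<bar> \<le> \<delta>"
        by (rule Re_near[OF near[rule_format, OF gG(3,4), unfolded gG(5)]])
      ultimately show ?thesis by linarith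
    qed
    have AB: "A \<le> 1 + \<delta>" "B \<le> 1 + \<delta>" unfolding A_def B_def using Fsum[OF gG(4)] Fsum[OF t] by auto
    have sums: "(\<Sum>h\<in>?T. F (g \<otimes> t) h) = A" "(\<Sum>h\<in>?T. F t (inv g \<otimes> h)) = B"
      unfolding A_def B_def using sum_translated_support[OF S gG(1)] Fsupp by auto
    have "(\<Sum>h\<in>?T. \<bar>F (g \<otimes> t) h - F t (inv g \<otimes> h)\<bar>)
      \<le> (\<Sum>h\<in>?T. (F (g \<otimes> t) h + F t (inv g \<otimes> h) - R g t h) / (2 * \<tau>) + \<tau> * (F (g \<otimes> t) h + F t (inv g \<otimes> h)))"
      by (intro sum_mono abs_diff_le_of_positive_form Fform gG t tau)
    also have "\<dots> = (A + B - C) / (2 * \<tau>) + \<tau> * (A + B)"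
      unfolding C_def sums[symmetric]
      by (simp only: sum.distrib sum_subtractf sum_divide_distrib[symmetric] sum_distrib_left[symmetric])
    also have "\<dots> \<le> (4 * \<delta>) / (2 * \<tau>) + \<tau> * (2 * (1 + \<delta>))"
      using AB C tau by (intro add_mono divide_right_mono mult_left_mono) auto
    also have "\<dots> = 2 * \<delta> / \<tau> + 2 * \<tau> * (1 + \<delta>)" by (simp add: mult.left_commute)
    finally show ?thesis .
  qed
  show ?thesis
    by (intro exI[of _ S] exI[of _ F] conjI ballI allI impI S F0 Fsupp Fsum main)
qed

text \<open>Finitely many values make the level sets of \<open>f\<close> a finite family, which can be used as coordinates.\<close>
lemma exact_group_finite_valued_weights:
  assumes ex: "exact_group G" and E0: "finite E0" "E0 \<subseteq> carrier G" and eps: "\<epsilon> > 0"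
  shows "\<exists>S f. almost_equivariant E0 \<epsilon> S f"
proof -
  \<comment> \<open>with \<open>\<tau> = \<epsilon> / 16\<close> below, \<open>2 * \<delta> / \<tau>\<close> and \<open>2 * \<tau> * (1 + \<delta>)\<close> are bounded by fractions of \<open>\<epsilon>\<close>\<close>
  define \<delta> where "\<delta> = min (1 / 4) (min (\<epsilon>\<^sup>2 / 256) (\<epsilon> / 16))"
  have d: "\<delta> > 0" "\<delta> \<le> 1 / 4" "\<delta> \<le> \<epsilon>\<^sup>2 / 256" "\<delta> \<le> \<epsilon> / 16" unfolding \<delta>_def using eps by auto
  obtain S F where S: "finite S" "S \<subseteq> carrier G"
    and Fall: "\<forall>t\<in>carrier G. (\<forall>q. F t q \<ge> 0) \<and> (\<forall>q. q \<notin> S \<longrightarrow> F t q = 0) \<and> \<bar>sum (F t) S - 1\<bar> \<le> \<delta>"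
    and inv_all: "\<forall>g\<in>E0. \<forall>t\<in>carrier G. \<forall>\<tau>>0.
       (\<Sum>h\<in>S \<union> (\<lambda>h. g \<otimes> h) ` S. \<bar>F (g \<otimes> t) h - F t (inv g \<otimes> h)\<bar>) \<le> 2 * \<delta> / \<tau> + 2 * \<tau> * (1 + \<delta>)"
    using exact_group_almost_invariant_weights[OF ex E0 d(1)] by (elim exE conjE) (rule that)
  have F: "\<And>t q. t \<in> carrier G \<Longrightarrow> F t q \<ge> 0" "\<And>t q. t \<in> carrier G \<Longrightarrow> q \<notin> S \<Longrightarrow> F t q = 0"
       "\<And>t. t \<in> carrier G \<Longrightarrow> \<bar>sum (F t) S - 1\<bar> \<le> \<delta>"
    using Fall by simp_all
  note inv = inv_all[rule_format]
  define N where "N = 32 * (real (card S) + 1) / \<epsilon>"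
  have N: "N > 0" "2 * card S / N \<le> \<epsilon> / 16"
  proof -
    have c: "32 * (real (card S) + 1) > 0" by simp
    then show "N > 0" unfolding N_def using eps by (rule divide_pos_pos)
    have "2 * real (card S) / N = (\<epsilon> / 16) * (real (card S) / (real (card S) + 1))"
      unfolding N_def using eps by (simp add: field_simps)
    also have "\<dots> \<le> (\<epsilon> / 16) * 1" using eps by (intro mult_left_mono) auto
    finally show "2 * card S / N \<le> \<epsilon> / 16" by simp
  qed
  define M where "M t = (\<Sum>q\<in>S. real_of_int \<lceil>N * F t q\<rceil>)" for t
  define f where "f t q = real_of_int \<lceil>N * F t q\<rceil> / M t" for t q
  have M: "M t > 0" and close: "(\<Sum>q\<in>S. \<bar>f t q - F t q\<bar>) \<le> \<epsilon> / 8" if t: "t \<in> carrier G" for t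
  proof -
    have "\<delta> < 1" using d by simp
    note r = rounded_up_normalisation[OF S(1) F(1)[OF t] F(3)[OF t] this N(1)]
    show "M t > 0" unfolding M_def by (rule r(1))
    show "(\<Sum>q\<in>S. \<bar>f t q - F t q\<bar>) \<le> \<epsilon> / 8"
      using r(2) d N(2) unfolding f_def M_def by linarith
  qed
  have f0: "f t q \<ge> 0" if "t \<in> carrier G" for t q
  proof -
    have "0 \<le> N * F t q" using F(1)[OF that] N by simp
    then have "0 \<le> real_of_int \<lceil>N * F t q\<rceil>" by linarith
    then show ?thesis unfolding f_def using M[OF that] by simp
  qed
  have fsupp: "f t q = 0" if "t \<in> carrier G" "q \<notin> S" for t q
    unfolding f_def using F(2)[OF that] by simp
  have fsum: "sum (f t) S = 1" if "t \<in> carrier G" for t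
  proof -
    have "sum (f t) S = M t / M t" unfolding f_def M_def sum_divide_distrib[symmetric] ..
    then show ?thesis using M[OF that] by simp
  qed
  have fin: "finite (f ` carrier G)"
  proof -
    define V where "V = {c :: 'a \<Rightarrow> int. \<forall>q. (q \<in> S \<longrightarrow> c q \<in> {0..\<lceil>2 * N\<rceil>}) \<and> (q \<notin> S \<longrightarrow> c q = 0)}"
    have "finite V" unfolding V_def by (rule finite_set_of_finite_funs) (use S in auto)
    moreover have "f ` carrier G \<subseteq> (\<lambda>c q. real_of_int (c q) / (\<Sum>q\<in>S. real_of_int (c q))) ` V"
    proof (rule image_subsetI)
      fix t assume t: "t \<in> carrier G"
      have "\<lceil>N * F t q\<rceil> \<in> {0..\<lceil>2 * N\<rceil>}" if "q \<in> S" for q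
      proof -
        have "F t q \<le> sum (F t) S" using that S F(1)[OF t] by (intro member_le_sum) auto
        also have "\<dots> \<le> 2" using F(3)[OF t] d by linarith
        finally have "N * F t q \<le> 2 * N" using N by simp
        moreover have "0 \<le> N * F t q" using F(1)[OF t] N by simp
        ultimately show ?thesis using ceiling_mono[of "0" "N * F t q"] by (simp add: ceiling_mono)
      qed
      then have "(\<lambda>q. \<lceil>N * F t q\<rceil>) \<in> V" unfolding V_def using F(2)[OF t] by simp
      then show "f t \<in> (\<lambda>c q. real_of_int (c q) / (\<Sum>q\<in>S. real_of_int (c q))) ` V"
        by (rule rev_image_eqI) (simp add: f_def M_def fun_eq_iff)
    qed
    ultimately show ?thesis by (rule finite_surj)
  qed
  have main: "(\<Sum>\<^sub>\<infinity>h\<in>carrier G. \<bar>f t (inv g \<otimes> h) - f (g \<otimes> t) h\<bar>) < \<epsilon>" if g: "g \<in> E0" and t: "t \<in> carrier G" for g t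
  proof -
    let ?T = "S \<union> (\<lambda>h. g \<otimes> h) ` S"
    have gG: "g \<in> carrier G" "g \<otimes> t \<in> carrier G" using g E0 t by auto
    have T: "finite ?T" "?T \<subseteq> carrier G" using S gG by auto
    have "(\<Sum>\<^sub>\<infinity>h\<in>carrier G. \<bar>f t (inv g \<otimes> h) - f (g \<otimes> t) h\<bar>) = (\<Sum>h\<in>?T. \<bar>f t (inv g \<otimes> h) - f (g \<otimes> t) h\<bar>)"
    proof (rule infsum_finite_support[OF T])
      fix h assume h: "h \<in> carrier G" "h \<notin> ?T"
      have "h = g \<otimes> (inv g \<otimes> h)" using gG h(1) by (simp add: m_assoc[symmetric])
      then have "inv g \<otimes> h \<notin> S" using h(2) by blast
      then show "\<bar>f t (inv g \<otimes> h) - f (g \<otimes> t) h\<bar> = 0" using fsupp[OF t] fsupp[OF gG(2)] h(2) by simp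
    qed
    also have "\<dots> \<le> (\<Sum>h\<in>?T. \<bar>f t (inv g \<otimes> h) - F t (inv g \<otimes> h)\<bar> + \<bar>F (g \<otimes> t) h - F t (inv g \<otimes> h)\<bar> + \<bar>f (g \<otimes> t) h - F (g \<otimes> t) h\<bar>)"
      by (rule sum_mono) linarith
    also have "\<dots> = (\<Sum>h\<in>?T. \<bar>f t (inv g \<otimes> h) - F t (inv g \<otimes> h)\<bar>) + (\<Sum>h\<in>?T. \<bar>F (g \<otimes> t) h - F t (inv g \<otimes> h)\<bar>)
        + (\<Sum>h\<in>?T. \<bar>f (g \<otimes> t) h - F (g \<otimes> t) h\<bar>)" by (simp add: sum.distrib)
    also have "(\<Sum>h\<in>?T. \<bar>f t (inv g \<otimes> h) - F t (inv g \<otimes> h)\<bar>) = (\<Sum>q\<in>S. \<bar>f t q - F t q\<bar>)"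
      by (rule sum_translated_support(2)[OF S gG(1)]) (use fsupp[OF t] F(2)[OF t] in simp)
    also have "(\<Sum>h\<in>?T. \<bar>f (g \<otimes> t) h - F (g \<otimes> t) h\<bar>) = (\<Sum>q\<in>S. \<bar>f (g \<otimes> t) q - F (g \<otimes> t) q\<bar>)"
      by (rule sum_translated_support(1)[OF S gG(1)]) (use fsupp[OF gG(2)] F(2)[OF gG(2)] in simp)
    also have "(\<Sum>q\<in>S. \<bar>f t q - F t q\<bar>) + (\<Sum>h\<in>?T. \<bar>F (g \<otimes> t) h - F t (inv g \<otimes> h)\<bar>) + (\<Sum>q\<in>S. \<bar>f (g \<otimes> t) q - F (g \<otimes> t) q\<bar>)
       \<le> \<epsilon> / 8 + (2 * \<delta> / (\<epsilon> / 16) + 2 * (\<epsilon> / 16) * (1 + \<delta>)) + \<epsilon> / 8"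
      by (intro add_mono close inv t gG g) (use eps in simp)
    also have "\<dots> < \<epsilon>"
    proof -
      have "2 * \<delta> / (\<epsilon> / 16) \<le> 2 * (\<epsilon>\<^sup>2 / 256) / (\<epsilon> / 16)"
        using d eps by (intro divide_right_mono mult_left_mono) auto
      also have "\<dots> = \<epsilon> / 8" using eps by (simp add: power2_eq_square)
      finally have 1: "2 * \<delta> / (\<epsilon> / 16) \<le> \<epsilon> / 8" .
      have "2 * (\<epsilon> / 16) * (1 + \<delta>) \<le> 2 * (\<epsilon> / 16) * 2" using d eps by (intro mult_left_mono) auto
      with 1 show ?thesis using eps by linarith
    qed
    finally show ?thesis .
  qed
  show ?thesis unfolding almost_equivariant_def
    by (intro exI[of _ S] exI[of _ f] conjI ballI allI impI S fin f0 fsupp fsum main)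
qed

end

context group begin

text \<open>Countably many pairs of a finite set and an error suffice, and each of them contributes finitely many
  level sets.\<close>
lemma countable_amenability_family:
  assumes cG: "countable (carrier G)" and ex: "exact_group G"
  shows "\<exists>\<A>. countable \<A> \<and> \<A> \<subseteq> Pow (carrier G) \<and> (\<forall>F \<epsilon>. finite F \<and> F \<subseteq> carrier G \<and> \<epsilon> > 0 \<longrightarrow>
    (\<exists>S f. almost_equivariant F \<epsilon> S f \<and> (\<forall>v\<in>f ` carrier G. {t \<in> carrier G. f t = v} \<in> \<A>)))"
proof -
  define I where "I = {F. finite F \<and> F \<subseteq> carrier G} \<times> range (\<lambda>k. inverse (real (Suc k)))"
  have cI: "countable I" unfolding I_def by (intro countable_SIGMA countable_Collect_finite_subset cG countable_image) simp_all
  have "\<forall>i\<in>I. \<exists>S f. almost_equivariant (fst i) (snd i) S f"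
    using exact_group_finite_valued_weights[OF ex] unfolding I_def by force
  then obtain Q f where Qf: "\<And>i. i \<in> I \<Longrightarrow> almost_equivariant (fst i) (snd i) (Q i) (f i)" by metis
  define \<A> where "\<A> = (\<Union>i\<in>I. (\<lambda>v. {t \<in> carrier G. f i t = v}) ` f i ` carrier G)"
  have c1: "countable \<A>" unfolding \<A>_def by (intro countable_UN cI countable_image cG)
  have c2: "\<A> \<subseteq> Pow (carrier G)" unfolding \<A>_def by auto
  have c3: "\<exists>S f. almost_equivariant F \<epsilon> S f \<and> (\<forall>v\<in>f ` carrier G. {t \<in> carrier G. f t = v} \<in> \<A>)"
    if F: "finite F" "F \<subseteq> carrier G" and eps: "\<epsilon> > 0" for F \<epsilon>
  proof -
    obtain k where k: "inverse (real (Suc k)) < \<epsilon>" using reals_Archimedean[OF eps] by blast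
    define i where "i = (F, inverse (real (Suc k)))"
    have iI: "i \<in> I" unfolding i_def I_def using F by blast
    have "almost_equivariant F (inverse (real (Suc k))) (Q i) (f i)" using Qf[OF iI] unfolding i_def by simp
    then have "almost_equivariant F \<epsilon> (Q i) (f i)"
      unfolding almost_equivariant_def by (elim conjE, intro conjI) (assumption | blast intro: less_trans[OF _ k])+
    moreover have "\<forall>v\<in>f i ` carrier G. {t \<in> carrier G. f i t = v} \<in> \<A>" unfolding \<A>_def using iI by blast
    ultimately show ?thesis by blast
  qed
  show ?thesis
  proof (intro exI[of _ \<A>] conjI allI impI c1 c2)
    fix F and \<epsilon> :: real assume "finite F \<and> F \<subseteq> carrier G \<and> \<epsilon> > 0"
    then show "\<exists>S f. almost_equivariant F \<epsilon> S f \<and> (\<forall>v\<in>f ` carrier G. {t \<in> carrier G. f t = v} \<in> \<A>)"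
      by (intro c3) auto
  qed
qed

end

section \<open>Actions on the non-compact Cantor set\<close>

text \<open>The family of coordinates consists of the translates of the return times \<open>S\<close>, of sets that yield freeness, and,
  if \<open>G\<close> is exact, of the level sets that yield amenability.\<close>
lemma (in group) cantor_action_of_type:
  fixes K :: "'k topology"
  assumes cG: "countable (carrier G)" and K: "noncompact_cantor_space K"
    and A: "minimal_type TYPE('x) G A" and inf: "infinite A" and big: "\<not> propto G (carrier G) A"
  shows "\<exists>\<alpha> x\<^sub>0. lc_G_space G K \<alpha> \<and> free_action G K \<alpha> \<and> minimal_action G K \<alpha> \<and>
    x\<^sub>0 \<in> topspace K \<and> G_type G K \<alpha> x\<^sub>0 = approx_class G A \<and> (exact_group G \<longrightarrow> amenable_action G K \<alpha>)"
proof -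
  note G = group_axioms
  have AG: "A \<subseteq> carrier G" "A \<noteq> {}" using A unfolding minimal_type_def by auto
  obtain X :: "'x topology" and a x\<^sub>0 where X: "pointed_lc_G_space G X a x\<^sub>0" "minimal_action G X a"
    and type: "G_type G X a x\<^sub>0 = approx_class G A"
    using A unfolding minimal_type_def by blast
  have lcX: "lc_G_space G X a" and x0: "x\<^sub>0 \<in> topspace X" using X unfolding pointed_lc_G_space_def by auto
  note aX = lc_G_spaceD[OF lcX]
  have "A \<in> approx_class G A"
    unfolding approx_class_def approx_def using AG propto_refl[OF G] by blast
  then have rel: "rel_compact_sets G X a x\<^sub>0 = sets_below G A"
    unfolding type[symmetric] G_type_def by blast
  obtain U C where UC: "openin X U" "compactin X C" "x\<^sub>0 \<in> U" "U \<subseteq> C"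
    using aX(1) x0 unfolding locally_compact_space_def by blast
  define S where "S = {g \<in> carrier G. a g x\<^sub>0 \<in> C}"
  define SU where "SU = {g \<in> carrier G. a g x\<^sub>0 \<in> U}"
  have SA: "propto G S A"
  proof -
    have "(\<lambda>g. a g x\<^sub>0) ` S \<subseteq> C" unfolding S_def by blast
    then have "X closure_of ((\<lambda>g. a g x\<^sub>0) ` S) \<subseteq> C"
      using compactin_imp_closedin[OF aX(2) UC(2)] by (rule closure_of_minimal)
    then have "compactin X (X closure_of ((\<lambda>g. a g x\<^sub>0) ` S))" by (rule closed_compactin[OF UC(2) _ closedin_closure_of])
    then have "S \<in> rel_compact_sets G X a x\<^sub>0" unfolding rel_compact_sets_def S_def by blast
    then show ?thesis unfolding rel sets_below_def by blast
  qed
  \<comment> \<open>the relatively compact piece \<open>A.x\<^sub>0\<close> is covered by finitely many translates of \<open>U\<close>, as every orbit meets \<open>U\<close>\<close>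
  have AS: "propto G A SU"
  proof -
    have "A \<in> rel_compact_sets G X a x\<^sub>0" unfolding rel sets_below_def using AG propto_refl[OF G AG(1)] by blast
    then have c: "compactin X (X closure_of ((\<lambda>g. a g x\<^sub>0) ` A))" unfolding rel_compact_sets_def by blast
    let ?O = "\<lambda>g. {x \<in> topspace X. a g x \<in> U}"
    have op: "\<And>V. V \<in> ?O ` carrier G \<Longrightarrow> openin X V"
      using aX(4) UC(1) unfolding continuous_map_def by blast
    have cov: "X closure_of ((\<lambda>g. a g x\<^sub>0) ` A) \<subseteq> \<Union>(?O ` carrier G)"
    proof
      fix x assume "x \<in> X closure_of ((\<lambda>g. a g x\<^sub>0) ` A)"
      then have x: "x \<in> topspace X" by (rule subsetD[OF closure_of_subset_topspace])
      then have "x\<^sub>0 \<in> X closure_of orbit G a x" using X(2) x0 unfolding minimal_action_def by blast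
      then obtain g where "g \<in> carrier G" "a g x \<in> U" using UC(1,3) unfolding in_closure_of orbit_def by blast
      then show "x \<in> \<Union>(?O ` carrier G)" using x by blast
    qed
    obtain \<F> where F: "finite \<F>" "\<F> \<subseteq> ?O ` carrier G" "X closure_of ((\<lambda>g. a g x\<^sub>0) ` A) \<subseteq> \<Union>\<F>"
      using compactinD[OF c op cov] by blast
    obtain F where F': "finite F" "F \<subseteq> carrier G" "\<F> = ?O ` F" using finite_subset_image[OF F(1,2)] by blast
    have "A \<subseteq> (\<lambda>g. inv g) ` F <#> SU"
    proof
      fix b assume b: "b \<in> A"
      then have bG: "b \<in> carrier G" using AG by blast
      have "(\<lambda>g. a g x\<^sub>0) ` A \<subseteq> topspace X" using AG aX(5) x0 by blast
      then have "a b x\<^sub>0 \<in> \<Union>\<F>" using closure_of_subset[of "(\<lambda>g. a g x\<^sub>0) ` A" X] b F(3) by blast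
      then obtain g where g: "g \<in> F" "a g (a b x\<^sub>0) \<in> U" unfolding F'(3) by blast
      have gG: "g \<in> carrier G" using g F' by blast
      have "g \<otimes> b \<in> SU" unfolding SU_def using aX(7)[OF gG bG x0] g gG bG by simp
      moreover have "b = inv g \<otimes> (g \<otimes> b)" using gG bG by (simp add: m_assoc[symmetric])
      ultimately show "b \<in> (\<lambda>g. inv g) ` F <#> SU" unfolding set_mult_def using g(1) by blast
    qed
    then show ?thesis unfolding propto_def using F' by (intro exI[of _ "(\<lambda>g. inv g) ` F"]) auto
  qed
  have "\<forall>g\<in>carrier G - {\<one>}. \<exists>D. D \<subseteq> carrier G \<and> (\<forall>h\<in>D. g \<otimes> h \<notin> D) \<and>
      (\<forall>h\<in>carrier G. h \<in> D \<or> g \<otimes> h \<in> D \<or> inv g \<otimes> h \<in> D)"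
    using displaced_cover by blast
  then obtain D where D: "\<forall>g\<in>carrier G - {\<one>}. D g \<subseteq> carrier G \<and> (\<forall>h\<in>D g. g \<otimes> h \<notin> D g) \<and>
      (\<forall>h\<in>carrier G. h \<in> D g \<or> g \<otimes> h \<in> D g \<or> inv g \<otimes> h \<in> D g)"
    by (rule bchoice[THEN exE])
  define adm where "adm \<A> \<longleftrightarrow> (\<forall>F \<epsilon>. finite F \<and> F \<subseteq> carrier G \<and> \<epsilon> > 0 \<longrightarrow>
    (\<exists>S f. almost_equivariant F \<epsilon> S f \<and> (\<forall>v\<in>f ` carrier G. {t \<in> carrier G. f t = v} \<in> \<A>)))" for \<A>
  obtain \<A> where fam: "countable \<A>" "\<A> \<subseteq> Pow (carrier G)" "exact_group G \<longrightarrow> adm \<A>"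
  proof (cases "exact_group G")
    case True
    have "\<exists>\<A>. countable \<A> \<and> \<A> \<subseteq> Pow (carrier G) \<and> adm \<A>"
      unfolding adm_def by (rule countable_amenability_family[OF cG True])
    then show ?thesis using that by blast
  next
    case False
    then show ?thesis using that[of "{}"] by simp
  qed
  define \<D>\<^sub>0 where "\<D>\<^sub>0 = insert S (D ` (carrier G - {\<one>}) \<union> \<A>)"
  define \<D> where "\<D> = (\<lambda>(g, E). g <# E) ` (carrier G \<times> \<D>\<^sub>0)"
  have sub0: "E \<subseteq> carrier G" if "E \<in> \<D>\<^sub>0" for E
    using that D fam(2) unfolding \<D>\<^sub>0_def S_def by auto
  have gen: "E \<in> \<D>" if "E \<in> \<D>\<^sub>0" for E
    unfolding \<D>_def using that lcos_mult_one[OF sub0[OF that]] by (intro image_eqI[of _ _ "(\<one>, E)"]) auto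
  have cD: "countable \<D>"
    unfolding \<D>_def \<D>\<^sub>0_def using cG fam(1) by (intro countable_image countable_SIGMA) auto
  interpret symbolic G \<D>
  proof unfold_locales
    show "E \<subseteq> carrier G" if "E \<in> \<D>" for E
      using that l_coset_subset_G[OF sub0] unfolding \<D>_def by auto
    show "g <# E \<in> \<D>" if E: "E \<in> \<D>" and g: "g \<in> carrier G" for E g
    proof -
      obtain k E' where E': "k \<in> carrier G" "E' \<in> \<D>\<^sub>0" "E = k <# E'" using E unfolding \<D>_def by auto
      have "g <# E = (g \<otimes> k) <# E'" unfolding E'(3) using lcos_m_assoc[OF sub0[OF E'(2)] g E'(1)] .
      then show ?thesis unfolding \<D>_def using E' g by (intro image_eqI[of _ _ "(g \<otimes> k, E')"]) auto
    qed
  qed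
  have SD: "S \<in> \<D>" by (rule gen) (simp add: \<D>\<^sub>0_def)
  obtain W w where sys: "symbolic_system G \<D> W S" and w: "w \<in> W"
    and min: "minimal_action G (symbolic_system.Y \<D> W) (symbolic_system.act G \<D> W)"
    and near: "\<forall>g\<in>carrier G. (a g x\<^sub>0 \<in> U \<longrightarrow> shift g w S) \<and> (shift g w S \<longrightarrow> a g x\<^sub>0 \<in> C)"
    using minimal_extension[OF lcX X(2) x0 UC(1,3) UC(2,4) S_def SD] by (elim exE conjE) (rule that)
  interpret symbolic_system G \<D> W S by (rule sys)
  have vG: "visits w \<subseteq> carrier G" unfolding visits_def by blast
  have vS: "visits w \<subseteq> S" "SU \<subseteq> visits w"
  proof -
    have "g \<in> S" if "g \<in> visits w" for g
    proof -
      have "g \<in> carrier G" "a g x\<^sub>0 \<in> C" using that near unfolding visits_def by auto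
      then show ?thesis unfolding S_def by simp
    qed
    then show "visits w \<subseteq> S" by blast
    show "SU \<subseteq> visits w" unfolding visits_def SU_def using near by blast
  qed
  have mono: "propto G B B'" if "B \<subseteq> B''" "propto G B'' B'" for B B' B''
    using that unfolding propto_def by blast
  have vA: "propto G (visits w) A" using mono[OF vS(1) SA] .
  have Av: "propto G A (visits w)"
    by (rule propto_trans[OF G vG AS]) (rule mono[OF vS(2) propto_refl[OF G vG]])
  have "rel_compact_sets G Y act w = sets_below G A"
    unfolding rel_compact_sets_Y[OF w] sets_below_eq_iff[OF G vG AG(1)] approx_def using vA Av by blast
  then have typeY: "G_type G Y act w = approx_class G A" by (rule G_type_eq_approx_class[OF G AG(1)])
  have free: "free_action G Y act"
  proof (rule free_act)
    fix g assume g: "g \<in> carrier G" "g \<noteq> \<one>"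
    then have Dg: "D g \<subseteq> carrier G" "\<forall>h\<in>D g. g \<otimes> h \<notin> D g"
      "\<forall>h\<in>carrier G. h \<in> D g \<or> g \<otimes> h \<in> D g \<or> inv g \<otimes> h \<in> D g"
      using D by auto
    have DD: "D g \<in> \<D>" by (rule gen) (use g in \<open>simp add: \<D>\<^sub>0_def\<close>)
    have mem: "h \<in> g <# D g \<longleftrightarrow> inv g \<otimes> h \<in> D g" "h \<in> inv g <# D g \<longleftrightarrow> g \<otimes> h \<in> D g"
      if "h \<in> carrier G" for h
      using mem_translate_iff[OF Dg(1), of "inv g" h] mem_translate_iff[OF Dg(1), of g h] that g by simp_all
    let ?P = "{D g, g <# D g, inv g <# D g}"
    have P1: "E \<inter> (inv g <# E) = {}" if E: "E \<in> ?P" for E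
    proof (rule ccontr)
      assume "E \<inter> (inv g <# E) \<noteq> {}"
      then obtain h where h: "h \<in> E" "h \<in> inv g <# E" by blast
      have ED: "E \<in> \<D>" using E DD translate g by auto
      have hG: "h \<in> carrier G" using h subset[OF ED] by blast
      have gh: "g \<otimes> h \<in> E" using mem_translate_iff[OF subset[OF ED] g(1) hG] h by blast
      have ghG: "g \<otimes> h \<in> carrier G" using g hG by simp
      from E consider "E = D g" | "E = g <# D g" | "E = inv g <# D g" by blast
      then show False
      proof cases
        case 1
        then show False using h(1) gh Dg(2) by blast
      next
        case 2
        have "inv g \<otimes> h \<in> D g" "inv g \<otimes> (g \<otimes> h) \<in> D g"
          using h(1) gh mem(1)[OF hG] mem(1)[OF ghG] 2 by auto
        moreover have "inv g \<otimes> (g \<otimes> h) = g \<otimes> (inv g \<otimes> h)"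
          using g hG by (simp add: m_assoc[symmetric])
        ultimately show False using Dg(2) by auto
      next
        case 3
        have "g \<otimes> h \<in> D g" "g \<otimes> (g \<otimes> h) \<in> D g"
          using h(1) gh mem(2)[OF hG] mem(2)[OF ghG] 3 by auto
        then show False using Dg(2) by blast
      qed
    qed
    have P2: "carrier G \<subseteq> \<Union>?P"
    proof
      fix h assume h: "h \<in> carrier G"
      have "h \<in> D g \<or> h \<in> inv g <# D g \<or> h \<in> g <# D g"
        unfolding mem[OF h] using Dg(3) h by blast
      then show "h \<in> \<Union>?P" by simp blast
    qed
    have P3: "?P \<subseteq> \<D>" using DD translate[OF DD] g by simp
    show "\<exists>P. finite P \<and> P \<subseteq> \<D> \<and> carrier G \<subseteq> \<Union>P \<and> (\<forall>E\<in>P. E \<inter> (inv g <# E) = {})"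
      by (rule exI[of _ ?P], intro conjI ballI P1 P2 P3) simp_all
  qed
  have amen: "amenable_action G Y act" if ex: "exact_group G"
  proof (rule amenable_act)
    fix F and \<epsilon> :: real assume F: "finite F" "F \<subseteq> carrier G" "\<epsilon> > 0"
    have "adm \<A>" using fam(3) ex by blast
    from this[unfolded adm_def, rule_format, OF conjI[OF F(1) conjI[OF F(2,3)]]]
    obtain Q f where "almost_equivariant F \<epsilon> Q f" "\<forall>v\<in>f ` carrier G. {t \<in> carrier G. f t = v} \<in> \<A>"
      by blast
    then show "\<exists>Q f. almost_equivariant F \<epsilon> Q f \<and> (\<forall>v\<in>f ` carrier G. {t \<in> carrier G. f t = v} \<in> \<D>)"
      using gen unfolding \<D>\<^sub>0_def by blast
  qed
  have "\<not> propto G (carrier G) (visits w)"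
    using propto_trans[OF G AG(1) _ vA] big by blast
  moreover have "infinite (visits w)"
  proof
    assume f: "finite (visits w)"
    obtain F where F: "finite F" "A \<subseteq> F <#> visits w" using Av unfolding propto_def by blast
    have "finite (F <#> visits w)" using F(1) f by (simp add: set_mult_def)
    then show False using F(2) inf finite_subset by blast
  qed
  ultimately have "noncompact_cantor_space Y" by (rule noncompact_cantor_Y[OF cD free min w])
  then have "Y homeomorphic_space K" using K by (rule noncompact_cantor_spaces_homeomorphic)
  then obtain h k where hk: "homeomorphic_maps Y K h k" unfolding homeomorphic_space_def by blast
  note T = G_space_transport[OF hk lc_G_space_Y]
  have "w \<in> topspace Y" using w topspace_Y by simp
  from T(5)[OF this] T(1) T(2)[OF free] T(3)[OF min] T(4)[OF amen] typeY
  show ?thesis by (intro exI conjI impI) auto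
qed

theorem theorem8p6:
  fixes G :: "('g, 'm) monoid_scheme" and K :: "'k topology"
  assumes "group G" and "countable (carrier G)" and "infinite (carrier G)"
    and "noncompact_cantor_space K"
  shows
    "((\<exists>\<alpha>. lc_G_space G K \<alpha> \<and> free_action G K \<alpha> \<and> minimal_action G K \<alpha>) \<and>
      (exact_group G \<longrightarrow>
        (\<exists>\<alpha>. lc_G_space G K \<alpha> \<and> free_action G K \<alpha> \<and> minimal_action G K \<alpha> \<and>
             amenable_action G K \<alpha>))) \<and>
     (\<forall>A. minimal_type TYPE('x) G A \<and>
          approx_class G A \<noteq> approx_class G (carrier G) \<and>
          approx_class G A \<noteq> approx_class G {\<one>\<^bsub>G\<^esub>} \<longrightarrow>
        (\<exists>\<alpha> x\<^sub>0. lc_G_space G K \<alpha> \<and> free_action G K \<alpha> \<and> minimal_action G K \<alpha> \<and>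
             x\<^sub>0 \<in> topspace K \<and> G_type G K \<alpha> x\<^sub>0 = approx_class G A) \<and>
        (exact_group G \<longrightarrow>
          (\<exists>\<alpha> x\<^sub>0. lc_G_space G K \<alpha> \<and> free_action G K \<alpha> \<and> minimal_action G K \<alpha> \<and>
               amenable_action G K \<alpha> \<and>
               x\<^sub>0 \<in> topspace K \<and> G_type G K \<alpha> x\<^sub>0 = approx_class G A)))"
proof -
  interpret group G by (rule assms(1))
  obtain A\<^sub>1 where A1: "minimal_type TYPE('g set \<Rightarrow> bool) G A\<^sub>1" "infinite A\<^sub>1" "\<not> propto G (carrier G) A\<^sub>1"
    using sparse_minimal_type[OF assms(2,3)] by blast
  obtain \<alpha> where 1: "lc_G_space G K \<alpha>" "free_action G K \<alpha>" "minimal_action G K \<alpha>"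
    "exact_group G \<longrightarrow> amenable_action G K \<alpha>"
    using cantor_action_of_type[OF assms(2,4) A1] by blast
  have 2: "\<exists>\<alpha> x\<^sub>0. lc_G_space G K \<alpha> \<and> free_action G K \<alpha> \<and> minimal_action G K \<alpha> \<and>
    x\<^sub>0 \<in> topspace K \<and> G_type G K \<alpha> x\<^sub>0 = approx_class G A \<and> (exact_group G \<longrightarrow> amenable_action G K \<alpha>)"
    if A: "minimal_type TYPE('x) G A" "approx_class G A \<noteq> approx_class G (carrier G)"
      "approx_class G A \<noteq> approx_class G {\<one>\<^bsub>G\<^esub>}" for A
  proof -
    have AG: "A \<subseteq> carrier G" "A \<noteq> {}" using A(1) unfolding minimal_type_def by auto
    have eq: "approx_class G A = approx_class G B" if "B \<subseteq> carrier G" "propto G A B" "propto G B A" for B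
      unfolding approx_class_def approx_def using that AG(1) propto_trans[OF assms(1)] by blast
    have "propto G A (carrier G)"
      unfolding propto_def using AG(1) by (intro exI[of _ "{\<one>\<^bsub>G\<^esub>}"]) (force simp: set_mult_def)
    then have big: "\<not> propto G (carrier G) A" using eq[of "carrier G"] A(2) by blast
    have inf: "infinite A"
    proof
      assume fin: "finite A"
      have "propto G A {\<one>\<^bsub>G\<^esub>}"
        unfolding propto_def using fin AG(1) by (intro exI[of _ A]) (force simp: set_mult_def)
      moreover have "propto G {\<one>\<^bsub>G\<^esub>} A"
      proof -
        obtain b where b: "b \<in> A" "b \<in> carrier G" using AG by blast
        then have "\<one>\<^bsub>G\<^esub> \<in> {inv\<^bsub>G\<^esub> b} <#>\<^bsub>G\<^esub> A" unfolding set_mult_def by force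
        then show ?thesis unfolding propto_def using b by (intro exI[of _ "{inv\<^bsub>G\<^esub> b}"]) auto
      qed
      ultimately show False using eq[of "{\<one>\<^bsub>G\<^esub>}"] A(3) by blast
    qed
    show ?thesis by (rule cantor_action_of_type[OF assms(2,4) A(1) inf big])
  qed
  show ?thesis
  proof (intro conjI allI impI)
    show "\<exists>\<alpha>. lc_G_space G K \<alpha> \<and> free_action G K \<alpha> \<and> minimal_action G K \<alpha>" using 1 by blast
    show "\<exists>\<alpha>. lc_G_space G K \<alpha> \<and> free_action G K \<alpha> \<and> minimal_action G K \<alpha> \<and> amenable_action G K \<alpha>"
      if "exact_group G" using 1 that by blast
    fix A assume A: "minimal_type TYPE('x) G A \<and> approx_class G A \<noteq> approx_class G (carrier G) \<and>
          approx_class G A \<noteq> approx_class G {\<one>\<^bsub>G\<^esub>}"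
    then obtain \<alpha> x\<^sub>0 where r: "lc_G_space G K \<alpha>" "free_action G K \<alpha>" "minimal_action G K \<alpha>"
      "x\<^sub>0 \<in> topspace K" "G_type G K \<alpha> x\<^sub>0 = approx_class G A" "exact_group G \<longrightarrow> amenable_action G K \<alpha>"
      using 2 by blast
    show "\<exists>\<alpha> x\<^sub>0. lc_G_space G K \<alpha> \<and> free_action G K \<alpha> \<and> minimal_action G K \<alpha> \<and>
             x\<^sub>0 \<in> topspace K \<and> G_type G K \<alpha> x\<^sub>0 = approx_class G A" using r by blast
    show "\<exists>\<alpha> x\<^sub>0. lc_G_space G K \<alpha> \<and> free_action G K \<alpha> \<and> minimal_action G K \<alpha> \<and> amenable_action G K \<alpha> \<and>
               x\<^sub>0 \<in> topspace K \<and> G_type G K \<alpha> x\<^sub>0 = approx_class G A" if "exact_group G" using r that by blast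
  qed
qed

end
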